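(* Let $A\in\mathbb{R}^{n_x\times n_x}$, $B\in\mathbb{R}^{n_x\times n_u}$ with $(A,B)$ stabilizable and $\rho(A)>0$; let $Q=Q^T>0$, $R=R^T>0$; and let $\tilde\beta>0$, $\alpha_0>0$ satisfy $\tilde\beta+\alpha_0<1/\rho(A)$. Let data $x(k_l),u(k_l),x(k_l+1)$, $l=0,\ldots,s$, with $x(k_l+1)=Ax(k_l)+Bu(k_l)$, be collected such that $$\mathrm{rank}([\Xi_2,\Xi_3,\Xi_4])=\tfrac12(n_x+n_u)(n_x+n_u+1).$$ Set $\tilde K^0=0$ and, for $j=0,1,2,\ldots$, with $\gamma_j=\tilde\beta+\sum_{m=0}^{j}\alpha_m$, update $$[vecs(\tilde P^j)^T,vec(\tilde L_1^j)^T,vecs(\tilde L_2^j)^T]^T=(\psi^{jT}\psi^j)^{-1}\psi^{jT}\phi^j,$$ $$\tilde K^{j+1}=\gamma_j^2\big(R+\gamma_j^2\tilde L_2^j\big)^{-1}\tilde L_1^{jT},$$ and choose $\alpha_{j+1}$ with $$0<\alpha_{j+1}<\gamma_j\sqrt{\frac{\sigma_{\min}[Q+(\tilde K^{j+1})^TR\tilde K^{j+1}]}{\sigma_{\max}[\tilde P^j-Q-(\tilde K^{j+1})^TR\tilde K^{j+1}]}+1}-\gamma_j,$$ until $\gamma_{j+1}=\tilde\beta+\sum_{m=0}^{j+1}\alpha_m\ge 1$. Then the closed-loop system satisfies $\rho(A-B\tilde K^{j+1})<1/\big(\tilde\beta+\sum_{m=0}^{j+1}\alpha_m\big)$ for $j=0,1,2,\ldots$,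 and the gain $\tilde K^{j+1}$ obtained when $\gamma_{j+1}\ge1$ is a stabilizing control gain of $x(k+1)=Ax(k)+Bu(k)$, i.e. $\rho(A-B\tilde K^{j+1})<1$. Moreover, setting $K^0=\tilde K^{j+1}$ for this final $j$ and updating, for $i=0,1,\ldots$, $$[vecs(P^i)^T,vec(L_1^i)^T,vecs(L_2^i)^T]^T=(\Psi^{iT}\Psi^i)^{-1}\Psi^{iT}\Phi^i,\qquad K^{i+1}=(R+L_2^i)^{-1}L_1^{iT},$$ one has $\lim_{i\to\infty}P^i=P^*$ and $\lim_{i\to\infty}K^i=K^*$.
   Context: $\rho(\cdot)$ is the spectral radius, $\sigma_{\max},\sigma_{\min}$ the maximum and minimum singular values, $\otimes$ the Kronecker product, and $>0$ for symmetric matrices means positive definite. $vec(X)$ stacks the columns of $X$. For symmetric $X\in\mathbb{R}^{n\times n}$, $vecs(X)=[X_{1,1},2X_{1,2},\ldots,2X_{1,n},X_{2,2},2X_{2,3},\ldots,2X_{n-1,n},X_{n,n}]^T$. For $\chi\in\mathbb{R}^n$, $vecv(\chi)=[\chi_1^2,\chi_1\chi_2,\ldots,\chi_1\chi_n,\chi_2^2,\chi_2\chi_3,\ldots,\chi_{n-1}\chi_n,\chi_n^2]^T$, so that $vecv(\chi)^Tvecs(X)=\chi^TX\chi$. $P^*=(P^* )^T>0$ is the positive definite solution of the algebraic Riccati equation $A^TPA-P-A^TPB(R+B^TPB)^{-1}B^TPA=-Q$, and $K^*=(R+B^TP^*B)^{-1}B^TP^*A$. Data matrices (with $k_0<k_1<\cdots<k_s$),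 each having $s+1$ rows indexed by $l=0,\ldots,s$; their $l$-th rows are: $\Xi_1$: $[vecv(x(k_l+1))-vecv(x(k_l))]^T$; $\Xi_2$: $[x(k_l)\otimes x(k_l)]^T$; $\Xi_3$: $[u(k_l)\otimes x(k_l)]^T$; $\Xi_4$: $vecv(u(k_l))^T$; $\Xi_5$: $vecv(x(k_l))^T$. For a gain $K\in\mathbb{R}^{n_u\times n_x}$, $\Xi_6(K)$ has $l$-th row $vecv(Kx(k_l))^T$. For the first iteration (unknowns $\tilde P^j,\tilde L_2^j$ symmetric, $\tilde L_1^j\in\mathbb{R}^{n_x\times n_u}$): $$\psi^j=\big[\Xi_1-(\gamma_j^{-2}-1)\Xi_5,\;-2\Xi_2(\tilde K^{jT}\otimes I_{n_x})-2\Xi_3,\;-\Xi_4+\Xi_6(\tilde K^j)\big],\qquad \phi^j=\gamma_j^{-2}\,\Xi_5\,vecs(-Q-(\tilde K^j)^TR\tilde K^j).$$ For the second iteration (unknowns $P^i,L_2^i$ symmetric, $L_1^i\in\mathbb{R}^{n_x\times n_u}$): $$\Psi^i=\big[\Xi_1,\;-2\Xi_2(K^{iT}\otimes I_{n_x})-2\Xi_3,\;-\Xi_4+\Xi_6(K^i)\big],\qquad \Phi^i=\Xi_5\,vecs(-Q-(K^i)^TRK^i).$$ *)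

theory Defs
  imports
    "Jordan_Normal_Form.Spectral_Radius"
    "Jordan_Normal_Form.DL_Rank"
    "Jordan_Normal_Form.Gauss_Jordan_Elimination"
begin

definition hcat :: "real mat \<Rightarrow> real mat \<Rightarrow> real mat" (infixr "@\<^sub>c" 65) where
  "X @\<^sub>c Y = mat (dim_row X) (dim_col X + dim_col Y)
     (\<lambda>(i, j). if j < dim_col X then X $$ (i, j) else Y $$ (i, j - dim_col X))"

(* A total version of the partial inverse; it is unspecified on singular matrices. *)
definition minv :: "real mat \<Rightarrow> real mat" where
  "minv M = the (mat_inverse M)"

definition kron_vec :: "real vec \<Rightarrow> real vec \<Rightarrow> real vec" (infixl "\<otimes>\<^sub>v" 70) where
  "v \<otimes>\<^sub>v w = vec (dim_vec v * dim_vec w)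
     (\<lambda>i. v $ (i div dim_vec w) * w $ (i mod dim_vec w))"

definition kron_mat :: "real mat \<Rightarrow> real mat \<Rightarrow> real mat" (infixl "\<otimes>\<^sub>m" 70) where
  "X \<otimes>\<^sub>m Y = mat (dim_row X * dim_row Y) (dim_col X * dim_col Y)
     (\<lambda>(i, j). X $$ (i div dim_row Y, j div dim_col Y) * Y $$ (i mod dim_row Y, j mod dim_col Y))"

definition rho :: "real mat \<Rightarrow> real" where
  "rho M = spectral_radius (map_mat complex_of_real M)"

(* Intended for square M. As M\<^sup>T * M is symmetric positive semidefinite, all its complex
   eigenvalues are real and nonnegative, so its real spectrum is the full spectrum. *)
definition singular_values :: "real mat \<Rightarrow> real set" where
  "singular_values M = sqrt ` spectrum (M\<^sup>T * M)"

definition sigma_max :: "real mat \<Rightarrow> real" where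
  "sigma_max M = Max (singular_values M)"

definition sigma_min :: "real mat \<Rightarrow> real" where
  "sigma_min M = Min (singular_values M)"

definition sym_mat :: "nat \<Rightarrow> real mat \<Rightarrow> bool" where
  "sym_mat n M \<longleftrightarrow> M \<in> carrier_mat n n \<and> M\<^sup>T = M"

definition pos_def :: "nat \<Rightarrow> real mat \<Rightarrow> bool" where
  "pos_def n M \<longleftrightarrow> sym_mat n M \<and> (\<forall>v \<in> carrier_vec n. v \<noteq> 0\<^sub>v n \<longrightarrow> v \<bullet> (M *\<^sub>v v) > 0)"

definition stabilizable :: "real mat \<Rightarrow> real mat \<Rightarrow> bool" where
  "stabilizable A B \<longleftrightarrow> (\<exists>K \<in> carrier_mat (dim_col B) (dim_row B). rho (A - B * K) < 1)"

definition riccati_sol :: "real mat \<Rightarrow> real mat \<Rightarrow> real mat \<Rightarrow> real mat \<Rightarrow> real mat" where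
  "riccati_sol A B Q R = (THE P. pos_def (dim_row A) P \<and>
     A\<^sup>T * P * A - P - A\<^sup>T * P * B * minv (R + B\<^sup>T * P * B) * B\<^sup>T * P * A = - Q)"

definition optimal_gain :: "real mat \<Rightarrow> real mat \<Rightarrow> real mat \<Rightarrow> real mat \<Rightarrow> real mat" where
  "optimal_gain A B Q R =
     (let P = riccati_sol A B Q R in minv (R + B\<^sup>T * P * B) * B\<^sup>T * P * A)"

(* (0,0), (0,1), ..., (0,n-1), (1,1), (1,2), ..., (n-1,n-1) *)
definition upper_pairs :: "nat \<Rightarrow> (nat \<times> nat) list" where
  "upper_pairs n = concat (map (\<lambda>i. map (\<lambda>j. (i, j)) [i..<n]) [0..<n])"

definition vecs :: "real mat \<Rightarrow> real vec" where
  "vecs X = vec_of_list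
     (map (\<lambda>(i, j). if i = j then X $$ (i, j) else 2 * X $$ (i, j)) (upper_pairs (dim_row X)))"

definition vecv :: "real vec \<Rightarrow> real vec" where
  "vecv v = vec_of_list (map (\<lambda>(i, j). v $ i * v $ j) (upper_pairs (dim_vec v)))"

(* the usual column-stacking vec; that name is taken by the vector constructor *)
definition vec_stack :: "real mat \<Rightarrow> real vec" where
  "vec_stack X = vec (dim_row X * dim_col X) (\<lambda>i. X $$ (i mod dim_row X, i div dim_row X))"

definition tri :: "nat \<Rightarrow> nat" where
  "tri n = n * (n + 1) div 2"

(* In the data matrices, n is the dimension of the state x and m that of the input u. *)

definition Xi1 :: "nat \<Rightarrow> (nat \<Rightarrow> real vec) \<Rightarrow> (nat \<Rightarrow> nat) \<Rightarrow> nat \<Rightarrow> real mat" where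
  "Xi1 n x k s = mat\<^sub>r (Suc s) (tri n) (\<lambda>l. vecv (x (k l + 1)) - vecv (x (k l)))"

definition Xi2 :: "nat \<Rightarrow> (nat \<Rightarrow> real vec) \<Rightarrow> (nat \<Rightarrow> nat) \<Rightarrow> nat \<Rightarrow> real mat" where
  "Xi2 n x k s = mat\<^sub>r (Suc s) (n * n) (\<lambda>l. x (k l) \<otimes>\<^sub>v x (k l))"

definition Xi3 :: "nat \<Rightarrow> nat \<Rightarrow> (nat \<Rightarrow> real vec) \<Rightarrow> (nat \<Rightarrow> real vec) \<Rightarrow> (nat \<Rightarrow> nat) \<Rightarrow> nat
    \<Rightarrow> real mat" where
  "Xi3 n m x u k s = mat\<^sub>r (Suc s) (m * n) (\<lambda>l. u (k l) \<otimes>\<^sub>v x (k l))"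

definition Xi4 :: "nat \<Rightarrow> (nat \<Rightarrow> real vec) \<Rightarrow> (nat \<Rightarrow> nat) \<Rightarrow> nat \<Rightarrow> real mat" where
  "Xi4 m u k s = mat\<^sub>r (Suc s) (tri m) (\<lambda>l. vecv (u (k l)))"

definition Xi5 :: "nat \<Rightarrow> (nat \<Rightarrow> real vec) \<Rightarrow> (nat \<Rightarrow> nat) \<Rightarrow> nat \<Rightarrow> real mat" where
  "Xi5 n x k s = mat\<^sub>r (Suc s) (tri n) (\<lambda>l. vecv (x (k l)))"

definition Xi6 :: "nat \<Rightarrow> (nat \<Rightarrow> real vec) \<Rightarrow> (nat \<Rightarrow> nat) \<Rightarrow> nat \<Rightarrow> real mat \<Rightarrow> real mat" where
  "Xi6 m x k s K = mat\<^sub>r (Suc s) (tri m) (\<lambda>l. vecv (K *\<^sub>v x (k l)))"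

definition psi :: "nat \<Rightarrow> nat \<Rightarrow> (nat \<Rightarrow> real vec) \<Rightarrow> (nat \<Rightarrow> real vec) \<Rightarrow> (nat \<Rightarrow> nat) \<Rightarrow> nat
    \<Rightarrow> real \<Rightarrow> real mat \<Rightarrow> real mat" where
  "psi n m x u k s g K =
     (Xi1 n x k s - (1 / g\<^sup>2 - 1) \<cdot>\<^sub>m Xi5 n x k s)
     @\<^sub>c ((- 2) \<cdot>\<^sub>m (Xi2 n x k s * (K\<^sup>T \<otimes>\<^sub>m 1\<^sub>m n)) - 2 \<cdot>\<^sub>m Xi3 n m x u k s)
     @\<^sub>c (- Xi4 m u k s + Xi6 m x k s K)"

definition phi :: "nat \<Rightarrow> (nat \<Rightarrow> real vec) \<Rightarrow> (nat \<Rightarrow> nat) \<Rightarrow> nat \<Rightarrow> real mat \<Rightarrow> real mat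
    \<Rightarrow> real \<Rightarrow> real mat \<Rightarrow> real vec" where
  "phi n x k s Q R g K = (1 / g\<^sup>2) \<cdot>\<^sub>v (Xi5 n x k s *\<^sub>v vecs (- Q - K\<^sup>T * R * K))"

definition Psi :: "nat \<Rightarrow> nat \<Rightarrow> (nat \<Rightarrow> real vec) \<Rightarrow> (nat \<Rightarrow> real vec) \<Rightarrow> (nat \<Rightarrow> nat) \<Rightarrow> nat
    \<Rightarrow> real mat \<Rightarrow> real mat" where
  "Psi n m x u k s K =
     Xi1 n x k s
     @\<^sub>c ((- 2) \<cdot>\<^sub>m (Xi2 n x k s * (K\<^sup>T \<otimes>\<^sub>m 1\<^sub>m n)) - 2 \<cdot>\<^sub>m Xi3 n m x u k s)
     @\<^sub>c (- Xi4 m u k s + Xi6 m x k s K)"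

definition Phi :: "nat \<Rightarrow> (nat \<Rightarrow> real vec) \<Rightarrow> (nat \<Rightarrow> nat) \<Rightarrow> nat \<Rightarrow> real mat \<Rightarrow> real mat
    \<Rightarrow> real mat \<Rightarrow> real vec" where
  "Phi n x k s Q R K = Xi5 n x k s *\<^sub>v vecs (- Q - K\<^sup>T * R * K)"

definition least_squares :: "real mat \<Rightarrow> real vec \<Rightarrow> real vec" where
  "least_squares M y = (minv (M\<^sup>T * M) * M\<^sup>T) *\<^sub>v y"

definition gam :: "real \<Rightarrow> (nat \<Rightarrow> real) \<Rightarrow> nat \<Rightarrow> real" where
  "gam \<beta> \<alpha> j = \<beta> + (\<Sum>i\<le>j. \<alpha> i)"

(* The first iteration is a do-until loop: pass j ends with the test gam (j + 1) \<ge> 1. Hence pass 0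
   is always performed, and pass j is performed iff the tests of all earlier passes failed. *)
definition performed :: "real \<Rightarrow> (nat \<Rightarrow> real) \<Rightarrow> nat \<Rightarrow> bool" where
  "performed \<beta> \<alpha> j \<longleftrightarrow> (\<forall>i<j. gam \<beta> \<alpha> (Suc i) < 1)"

(* convergence of real nr x nc matrices, taken entrywise *)
definition mat_tendsto :: "nat \<Rightarrow> nat \<Rightarrow> (nat \<Rightarrow> real mat) \<Rightarrow> real mat \<Rightarrow> bool" where
  "mat_tendsto nr nc X L \<longleftrightarrow> L \<in> carrier_mat nr nc \<and>
     (\<forall>i<nr. \<forall>j<nc. (\<lambda>t. X t $$ (i, j)) \<longlonglongrightarrow> L $$ (i, j))"

end

theory Submission
  imports Defs
begin

text \<open>Along the data, the least-squares equation says that a quadratic form in \<open>(x, u)\<close> vanishes, and the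
  rank condition forces that form to be zero. Hence the least-squares solution is exact: \<open>P\<close> solves the
  Lyapunov equation \<open>P = \<gamma>\<^sup>2 (A - B K)\<^sup>T P (A - B K) + Q + K\<^sup>T R K\<close>, and \<open>L\<^sub>1 = A\<^sup>T P B\<close>,
  \<open>L\<^sub>2 = B\<^sup>T P B\<close>, so that the new gain is a policy improvement step for \<open>(\<gamma> A, \<gamma> B)\<close>.
  Completing the square shows \<open>\<gamma>\<^sup>2 (A - B K')\<^sup>T P (A - B K') \<le> P - Q - K'\<^sup>T R K'\<close> for the new gain
  \<open>K'\<close>, and the singular value bound on the step size is exactly what lets \<open>\<gamma>\<close> grow while \<open>P\<close> remains a
  strict Lyapunov function. Once \<open>\<gamma> \<ge> 1\<close>, ordinary policy iteration decreases \<open>P\<close> monotonically;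
  its limit is a positive definite Riccati solution, which is unique.\<close>

section \<open>Bilinear forms of real matrices\<close>

text \<open>The bound \<open>rho (A - B * K) < 1 / \<gamma>\<close> plays a double role. It is the
  conclusion of each pass, but it also makes the next least-squares problem well posed: the rank
  condition turns a kernel vector of \<open>psi\<close> into a symmetric solution of
  \<open>P = \<gamma>^2 (A - B K)^T P (A - B K)\<close>, and stability of
  \<open>\<gamma> (A - B K)\<close> forces that solution to vanish. As \<open>minv\<close> is
  unspecified on singular matrices, nothing is known about an iterate until the bound for its gain
  is available, so every fact about the iterates is carried through an induction over the passes.
  The induction starts from \<open>\<beta> + \<alpha> 0 < 1 / rho A\<close>, which is the bound for
  the zero gain. Symmetric matrices are compared through their quadratic forms, so no
  diagonalization occurs. The spectral input is limited to geometric decay of the powers of a stable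
  matrix and to the existence of an extreme eigenvalue.\<close>

definition bform :: "real mat \<Rightarrow> real vec \<Rightarrow> real vec \<Rightarrow> real" where
  "bform P v w = v \<bullet> (P *\<^sub>v w)"

abbreviation qform :: "real mat \<Rightarrow> real vec \<Rightarrow> real" where
  "qform P v \<equiv> bform P v v"

lemma bform_add_left:
  "\<lbrakk>P \<in> carrier_mat r c; v \<in> carrier_vec r; v' \<in> carrier_vec r; w \<in> carrier_vec c\<rbrakk>
    \<Longrightarrow> bform P (v + v') w = bform P v w + bform P v' w"
  unfolding bform_def by (rule add_scalar_prod_distrib) auto

lemma bform_minus_left:
  "\<lbrakk>P \<in> carrier_mat r c; v \<in> carrier_vec r; v' \<in> carrier_vec r; w \<in> carrier_vec c\<rbrakk>
    \<Longrightarrow> bform P (v - v') w = bform P v w - bform P v' w"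
  unfolding bform_def by (rule minus_scalar_prod_distrib) auto

lemma bform_add_right:
  "\<lbrakk>P \<in> carrier_mat r c; v \<in> carrier_vec r; w \<in> carrier_vec c; w' \<in> carrier_vec c\<rbrakk>
    \<Longrightarrow> bform P v (w + w') = bform P v w + bform P v w'"
  unfolding bform_def by (simp add: mult_add_distrib_mat_vec[of P r c] scalar_prod_add_distrib[of _ r])

lemma bform_minus_right:
  "\<lbrakk>P \<in> carrier_mat r c; v \<in> carrier_vec r; w \<in> carrier_vec c; w' \<in> carrier_vec c\<rbrakk>
    \<Longrightarrow> bform P v (w - w') = bform P v w - bform P v w'"
  unfolding bform_def by (simp add: mult_minus_distrib_mat_vec[of P r c] scalar_prod_minus_distrib[of _ r])

lemma bform_smult_left:
  "\<lbrakk>P \<in> carrier_mat r c; v \<in> carrier_vec r; w \<in> carrier_vec c\<rbrakk>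
    \<Longrightarrow> bform P (a \<cdot>\<^sub>v v) w = a * bform P v w"
  unfolding bform_def by simp

lemma bform_smult_right:
  "\<lbrakk>P \<in> carrier_mat r c; v \<in> carrier_vec r; w \<in> carrier_vec c\<rbrakk>
    \<Longrightarrow> bform P v (a \<cdot>\<^sub>v w) = a * bform P v w"
  unfolding bform_def by (simp add: mult_mat_vec[of P r c])

lemma bform_add_mat:
  "\<lbrakk>P \<in> carrier_mat r c; P' \<in> carrier_mat r c; v \<in> carrier_vec r; w \<in> carrier_vec c\<rbrakk>
    \<Longrightarrow> bform (P + P') v w = bform P v w + bform P' v w"
  unfolding bform_def by (simp add: add_mult_distrib_mat_vec[of P r c] scalar_prod_add_distrib[of _ r])

lemma bform_minus_mat:
  "\<lbrakk>P \<in> carrier_mat r c; P' \<in> carrier_mat r c; v \<in> carrier_vec r; w \<in> carrier_vec c\<rbrakk>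
    \<Longrightarrow> bform (P - P') v w = bform P v w - bform P' v w"
  unfolding bform_def by (simp add: minus_mult_distrib_mat_vec[of P r c] scalar_prod_minus_distrib[of _ r])

lemma bform_smult_mat:
  assumes "P \<in> carrier_mat r c" "v \<in> carrier_vec r" "w \<in> carrier_vec c"
  shows "bform (a \<cdot>\<^sub>m P) v w = a * bform P v w"
proof -
  have "(a \<cdot>\<^sub>m P) *\<^sub>v w = a \<cdot>\<^sub>v (P *\<^sub>v w)" using assms by auto
  then show ?thesis unfolding bform_def using assms by simp
qed

lemma bform_uminus_mat:
  assumes "P \<in> carrier_mat r c" "v \<in> carrier_vec r" "w \<in> carrier_vec c"
  shows "bform (- P) v w = - bform P v w"
proof -
  have "(- P) *\<^sub>v w = - (P *\<^sub>v w)" using assms by auto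
  then show ?thesis unfolding bform_def using assms by simp
qed

lemmas bform_linear = bform_add_left bform_minus_left bform_add_right bform_minus_right
  bform_smult_left bform_smult_right

lemma bform_one: "\<lbrakk>v \<in> carrier_vec n; w \<in> carrier_vec n\<rbrakk> \<Longrightarrow> bform (1\<^sub>m n) v w = v \<bullet> w"
  unfolding bform_def by simp

lemma bform_zero_mat: "\<lbrakk>v \<in> carrier_vec r; w \<in> carrier_vec c\<rbrakk> \<Longrightarrow> bform (0\<^sub>m r c) v w = 0"
  using bform_smult_mat[of "0\<^sub>m r c" r c v w 0] by simp

lemma bform_mult:
  assumes "M \<in> carrier_mat r c" "N \<in> carrier_mat c d" "v \<in> carrier_vec r" "w \<in> carrier_vec d"
  shows "bform (M * N) v w = bform M v (N *\<^sub>v w)"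
  unfolding bform_def using assms by (simp add: assoc_mult_mat_vec[of M r c N d])

lemma bform_mult_transpose:
  assumes "M \<in> carrier_mat c r" "N \<in> carrier_mat c d" "v \<in> carrier_vec r" "w \<in> carrier_vec d"
  shows "bform (M\<^sup>T * N) v w = bform N (M *\<^sub>v v) w"
proof -
  have "v \<bullet> (M\<^sup>T *\<^sub>v (N *\<^sub>v w)) = (M\<^sup>T *\<^sub>v (N *\<^sub>v w)) \<bullet> v"
    using assms by (intro comm_scalar_prod[of _ r]) auto
  also have "\<dots> = (N *\<^sub>v w) \<bullet> (M *\<^sub>v v)"
    using assms by (intro transpose_vec_mult_scalar) auto
  also have "\<dots> = (M *\<^sub>v v) \<bullet> (N *\<^sub>v w)"
    using assms by (intro comm_scalar_prod[of _ c]) auto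
  finally show ?thesis unfolding bform_def using assms by (simp add: assoc_mult_mat_vec[of "M\<^sup>T" r c N d])
qed

lemma bform_congruence:
  assumes "M \<in> carrier_mat c r" "P \<in> carrier_mat c d" "N \<in> carrier_mat d e"
    "v \<in> carrier_vec r" "w \<in> carrier_vec e"
  shows "bform (M\<^sup>T * P * N) v w = bform P (M *\<^sub>v v) (N *\<^sub>v w)"
proof -
  have "bform (M\<^sup>T * P * N) v w = bform (M\<^sup>T * P) v (N *\<^sub>v w)"
    using assms by (intro bform_mult) auto
  then show ?thesis using assms bform_mult_transpose[of M c r P d v "N *\<^sub>v w"] by auto
qed

lemma bform_transpose:
  assumes "P \<in> carrier_mat r c" "v \<in> carrier_vec c" "w \<in> carrier_vec r"
  shows "bform P\<^sup>T v w = bform P w v"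
proof -
  have "bform P\<^sup>T v w = (P\<^sup>T *\<^sub>v w) \<bullet> v"
    unfolding bform_def using assms by (intro comm_scalar_prod[of _ c]) auto
  then show ?thesis unfolding bform_def
    using transpose_vec_mult_scalar[OF assms] by simp
qed

lemma sym_matD: "sym_mat n P \<Longrightarrow> P \<in> carrier_mat n n" "sym_mat n P \<Longrightarrow> P\<^sup>T = P"
  unfolding sym_mat_def by auto

lemma bform_sym:
  "\<lbrakk>sym_mat n P; v \<in> carrier_vec n; w \<in> carrier_vec n\<rbrakk> \<Longrightarrow> bform P v w = bform P w v"
  using bform_transpose[of P n n v w] by (simp add: sym_mat_def)

lemma qform_add:
  assumes "sym_mat n P" "v \<in> carrier_vec n" "w \<in> carrier_vec n"
  shows "qform P (v + w) = qform P v + 2 * bform P v w + qform P w"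
  using assms bform_sym[OF assms] by (simp add: bform_linear[OF sym_matD(1)[OF assms(1)]])

lemma qform_minus:
  assumes "sym_mat n P" "v \<in> carrier_vec n" "w \<in> carrier_vec n"
  shows "qform P (v - w) = qform P v - 2 * bform P v w + qform P w"
  using assms bform_sym[OF assms] by (simp add: bform_linear[OF sym_matD(1)[OF assms(1)]])

lemma qform_smult:
  "\<lbrakk>P \<in> carrier_mat n n; v \<in> carrier_vec n\<rbrakk> \<Longrightarrow> qform P (a \<cdot>\<^sub>v v) = a\<^sup>2 * qform P v"
  by (simp add: bform_linear[of P n n] power2_eq_square)

lemma bform_unit_vec:
  "\<lbrakk>P \<in> carrier_mat r c; i < r; j < c\<rbrakk> \<Longrightarrow> bform P (unit_vec r i) (unit_vec c j) = P $$ (i, j)"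
  unfolding bform_def by (simp add: scalar_prod_left_unit[of _ r] scalar_prod_right_unit[of _ c])

lemma mat_eqI_bform:
  assumes "P \<in> carrier_mat r c" "P' \<in> carrier_mat r c"
    and "\<And>v w. v \<in> carrier_vec r \<Longrightarrow> w \<in> carrier_vec c \<Longrightarrow> bform P v w = bform P' v w"
  shows "P = P'"
proof (rule eq_matI)
  fix i j assume "i < dim_row P'" "j < dim_col P'"
  then show "P $$ (i, j) = P' $$ (i, j)"
    using assms bform_unit_vec[of P r c i j] bform_unit_vec[of P' r c i j] by auto
qed (use assms in auto)

text \<open>Reduces equality and convergence of symmetric matrices to those of their quadratic
  forms, the quantities controlled by Lyapunov equations and by monotonicity.\<close>

lemma bform_polarization:
  assumes "sym_mat n P" "v \<in> carrier_vec n" "w \<in> carrier_vec n"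
  shows "bform P v w = (qform P (v + w) - qform P v - qform P w) / 2"
  using qform_add[OF assms] by simp

lemma sym_mat_eqI_qform:
  assumes "sym_mat n P" "sym_mat n P'"
    and "\<And>v. v \<in> carrier_vec n \<Longrightarrow> qform P v = qform P' v"
  shows "P = P'"
proof (rule mat_eqI_bform[of P n n])
  fix v w :: "real vec" assume vw: "v \<in> carrier_vec n" "w \<in> carrier_vec n"
  then show "bform P v w = bform P' v w"
    unfolding bform_polarization[OF assms(1) vw] bform_polarization[OF assms(2) vw]
    using assms(3) by simp
qed (use assms sym_matD in auto)

lemma sym_mat_add: "\<lbrakk>sym_mat n P; sym_mat n P'\<rbrakk> \<Longrightarrow> sym_mat n (P + P')"
  unfolding sym_mat_def by (auto simp: transpose_add)

lemma sym_mat_minus: "\<lbrakk>sym_mat n P; sym_mat n P'\<rbrakk> \<Longrightarrow> sym_mat n (P - P')"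
  unfolding sym_mat_def by (auto simp: transpose_minus)

lemma sym_mat_uminus: "sym_mat n P \<Longrightarrow> sym_mat n (- P)"
  unfolding sym_mat_def by (auto simp: transpose_uminus)

lemma transpose_smult_mat: "(a \<cdot>\<^sub>m P)\<^sup>T = a \<cdot>\<^sub>m P\<^sup>T"
  by (rule eq_matI) auto

lemma sym_mat_smult: "sym_mat n P \<Longrightarrow> sym_mat n (a \<cdot>\<^sub>m P)"
  unfolding sym_mat_def using transpose_smult_mat[of a P] by auto

lemma sym_mat_one: "sym_mat n (1\<^sub>m n)"
  unfolding sym_mat_def by auto

lemma sym_mat_congruence:
  assumes "sym_mat r P" "M \<in> carrier_mat r c"
  shows "sym_mat c (M\<^sup>T * P * M)"
proof -
  have P: "P \<in> carrier_mat r r" "P\<^sup>T = P" using assms(1) by (auto simp: sym_mat_def)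
  have "(M\<^sup>T * P * M)\<^sup>T = M\<^sup>T * (M\<^sup>T * P)\<^sup>T" using P assms(2) by (intro transpose_mult) auto
  also have "(M\<^sup>T * P)\<^sup>T = P * M" using P assms(2) by (subst transpose_mult) auto
  also have "M\<^sup>T * (P * M) = M\<^sup>T * P * M" using P assms(2) by (intro assoc_mult_mat[symmetric]) auto
  finally show ?thesis using assms P unfolding sym_mat_def by auto
qed

lemma sym_mat_transpose_mult: "M \<in> carrier_mat r c \<Longrightarrow> sym_mat c (M\<^sup>T * M)"
  using sym_mat_congruence[OF sym_mat_one, of M r c] by simp

lemma pos_defD:
  assumes "pos_def n P"
  shows "sym_mat n P" "P \<in> carrier_mat n n"
    and "v \<in> carrier_vec n \<Longrightarrow> v \<noteq> 0\<^sub>v n \<Longrightarrow> qform P v > 0"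
    and "v \<in> carrier_vec n \<Longrightarrow> qform P v \<ge> 0"
proof -
  have P: "P \<in> carrier_mat n n" using assms by (auto simp: pos_def_def sym_mat_def)
  show *: "v \<in> carrier_vec n \<Longrightarrow> v \<noteq> 0\<^sub>v n \<Longrightarrow> qform P v > 0"
    using assms by (simp add: pos_def_def bform_def)
  show "v \<in> carrier_vec n \<Longrightarrow> qform P v \<ge> 0"
    using * by (cases "v = 0\<^sub>v n") (use P in \<open>auto simp: bform_def intro: less_imp_le\<close>)
qed (use assms in \<open>auto simp: pos_def_def sym_mat_def\<close>)

lemma pos_defI:
  "\<lbrakk>sym_mat n P; \<And>v. v \<in> carrier_vec n \<Longrightarrow> v \<noteq> 0\<^sub>v n \<Longrightarrow> qform P v > 0\<rbrakk> \<Longrightarrow> pos_def n P"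
  by (simp add: pos_def_def bform_def)

section \<open>Inverses and exact least-squares solutions\<close>

lemma minv_inverse:
  assumes A: "A \<in> carrier_mat n n" and det: "det A \<noteq> 0"
  shows "minv A \<in> carrier_mat n n" "minv A * A = 1\<^sub>m n" "A * minv A = 1\<^sub>m n"
proof -
  have "A \<in> Units (ring_mat TYPE(real) n ())"
    using det_non_zero_imp_unit[OF A det] .
  then obtain B where B: "mat_inverse A = Some B" using mat_inverse(1)[OF A, of "()"] by blast
  show "minv A \<in> carrier_mat n n" "minv A * A = 1\<^sub>m n" "A * minv A = 1\<^sub>m n"
    using mat_inverse(2)[OF A B] B by (auto simp: minv_def)
qed

lemma pos_def_det: "pos_def n P \<Longrightarrow> det P \<noteq> 0"
proof
  assume P: "pos_def n P" and "det P = 0"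
  then obtain v where "v \<in> carrier_vec n" "v \<noteq> 0\<^sub>v n" "P *\<^sub>v v = 0\<^sub>v n"
    using det_0_iff_vec_prod_zero_field[OF pos_defD(2)[OF P]] by auto
  then show False using pos_defD(3)[OF P, of v] by (simp add: bform_def)
qed

lemma pos_def_minv:
  assumes "pos_def n P"
  shows "minv P \<in> carrier_mat n n" "minv P * P = 1\<^sub>m n" "P * minv P = 1\<^sub>m n"
  using minv_inverse[OF pos_defD(2) pos_def_det] assms by auto

text \<open>Injectivity makes the Gram matrix positive definite, so \<open>minv\<close> is a genuine
  inverse there. As the right-hand side lies in the range of \<open>M\<close>, the formula returns
  the preimage itself and not merely a best approximation.\<close>

lemma least_squares_solution:
  assumes M: "M \<in> carrier_mat r c" and z: "z \<in> carrier_vec c"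
    and inj: "\<And>y. y \<in> carrier_vec c \<Longrightarrow> M *\<^sub>v y = 0\<^sub>v r \<Longrightarrow> y = 0\<^sub>v c"
  shows "least_squares M (M *\<^sub>v z) = z"
proof -
  let ?G = "M\<^sup>T * M"
  have G: "?G \<in> carrier_mat c c" using M by auto
  have pd: "pos_def c ?G"
  proof (rule pos_defI[OF sym_mat_transpose_mult[OF M]])
    fix v :: "real vec" assume v: "v \<in> carrier_vec c" "v \<noteq> 0\<^sub>v c"
    have "qform ?G v = (M *\<^sub>v v) \<bullet> (M *\<^sub>v v)"
      using bform_mult_transpose[OF M M v(1) v(1)] by (simp add: bform_def)
    moreover have "M *\<^sub>v v \<noteq> 0\<^sub>v r" using inj v by blast
    ultimately show "qform ?G v > 0"
      using conjugate_square_greater_0_vec[of "M *\<^sub>v v" r] M v by auto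
  qed
  note I = pos_def_minv[OF pd]
  have "least_squares M (M *\<^sub>v z) = minv ?G *\<^sub>v (M\<^sup>T *\<^sub>v (M *\<^sub>v z))"
    unfolding least_squares_def using I M z by (intro assoc_mult_mat_vec[of _ c c _ r]) auto
  also have "M\<^sup>T *\<^sub>v (M *\<^sub>v z) = ?G *\<^sub>v z" using M z by (intro assoc_mult_mat_vec[symmetric]) auto
  also have "minv ?G *\<^sub>v (?G *\<^sub>v z) = (minv ?G * ?G) *\<^sub>v z"
    using I G z by (intro assoc_mult_mat_vec[symmetric]) auto
  also have "\<dots> = z" using I z by simp
  finally show ?thesis .
qed

section \<open>Spectral radius and the Lyapunov equation\<close>

lemma mult_mat_zero_vec: "M \<in> carrier_mat r c \<Longrightarrow> M *\<^sub>v 0\<^sub>v c = 0\<^sub>v r"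
  by (rule eq_vecI) auto

lemma mult_mat_vec_entry:
  assumes "M \<in> carrier_mat r c" "v \<in> carrier_vec c" "i < r"
  shows "(M *\<^sub>v v) $ i = (\<Sum>j<c. M $$ (i, j) * v $ j)"
  using assms by (auto simp: scalar_prod_def lessThan_atLeast0 intro!: sum.cong)

lemma rho_eigenvector:
  assumes "0 < n" "M \<in> carrier_mat n n"
  obtains w l where "w \<in> carrier_vec n" "w \<noteq> 0\<^sub>v n"
    "map_mat complex_of_real M *\<^sub>v w = l \<cdot>\<^sub>v w" "rho M = cmod l"
proof -
  let ?C = "map_mat complex_of_real M"
  have C: "?C \<in> carrier_mat n n" using assms by auto
  obtain l where l: "l \<in> spectrum ?C" "spectral_radius ?C = cmod l"
    using spectral_radius_mem_max(1)[OF C assms(1)] by auto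
  then obtain w where "eigenvector ?C w l"
    by (auto simp: spectrum_def eigenvalue_def)
  with l that[of w l] C show ?thesis
    by (auto simp: eigenvector_def rho_def)
qed

lemma rho_nonneg: "0 < n \<Longrightarrow> M \<in> carrier_mat n n \<Longrightarrow> 0 \<le> rho M"
  by (metis rho_eigenvector norm_ge_zero)

lemma eigenvalue_le_rho:
  assumes "0 < n" "M \<in> carrier_mat n n" "w \<in> carrier_vec n" "w \<noteq> 0\<^sub>v n"
    "map_mat complex_of_real M *\<^sub>v w = l \<cdot>\<^sub>v w"
  shows "cmod l \<le> rho M"
proof -
  let ?C = "map_mat complex_of_real M"
  have C: "?C \<in> carrier_mat n n" using assms by auto
  have "eigenvector ?C w l" using assms by (auto simp: eigenvector_def)
  then have "l \<in> spectrum ?C" by (auto simp: spectrum_def eigenvalue_def)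
  then show ?thesis
    unfolding rho_def using spectral_radius_mem_max(2)[OF C assms(1)] by auto
qed

text \<open>A complex eigenvector is split into its real and imaginary part, so that only real quadratic
  forms are needed: for \<open>M (a + \<i> b) = (p + \<i> q) (a + \<i> b)\<close> the values of a form at \<open>M a\<close> and \<open>M b\<close>
  add up to \<open>p\<^sup>2 + q\<^sup>2\<close> times its values at \<open>a\<close> and \<open>b\<close>.\<close>

lemma rho_lessI_qform:
  assumes n: "0 < n" and M: "M \<in> carrier_mat n n" and P: "pos_def n P" and c: "0 < c"
    and less: "\<And>v. v \<in> carrier_vec n \<Longrightarrow> v \<noteq> 0\<^sub>v n \<Longrightarrow> c\<^sup>2 * qform P (M *\<^sub>v v) < qform P v"
  shows "rho M < 1 / c"
proof -
  let ?C = "map_mat complex_of_real M"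
  obtain w l where w: "w \<in> carrier_vec n" "w \<noteq> 0\<^sub>v n"
    and ev: "?C *\<^sub>v w = l \<cdot>\<^sub>v w" and rho: "rho M = cmod l"
    using rho_eigenvector[OF n M] .
  define a where "a = map_vec Re w"
  define b where "b = map_vec Im w"
  define p where "p = Re l"
  define q where "q = Im l"
  have ab: "a \<in> carrier_vec n" "b \<in> carrier_vec n" using w by (auto simp: a_def b_def)
  have sP: "sym_mat n P" and cP: "P \<in> carrier_mat n n" using pos_defD[OF P] by auto
  have ent: "(\<Sum>j = 0..<n. complex_of_real (M $$ (i, j)) * w $ j) = l * w $ i" if "i < n" for i
  proof -
    have "(?C *\<^sub>v w) $ i = (l \<cdot>\<^sub>v w) $ i" using ev by simp
    then show ?thesis using that w M by (simp add: scalar_prod_def)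
  qed
  have Ma: "M *\<^sub>v a = p \<cdot>\<^sub>v a - q \<cdot>\<^sub>v b"
  proof (rule eq_vecI)
    fix i assume "i < dim_vec (p \<cdot>\<^sub>v a - q \<cdot>\<^sub>v b)"
    then have i: "i < n" using ab by auto
    show "(M *\<^sub>v a) $ i = (p \<cdot>\<^sub>v a - q \<cdot>\<^sub>v b) $ i"
      using arg_cong[OF ent[OF i], of Re] i w M
      by (simp add: scalar_prod_def a_def b_def p_def q_def)
  qed (use M ab in auto)
  have Mb: "M *\<^sub>v b = q \<cdot>\<^sub>v a + p \<cdot>\<^sub>v b"
  proof (rule eq_vecI)
    fix i assume "i < dim_vec (q \<cdot>\<^sub>v a + p \<cdot>\<^sub>v b)"
    then have i: "i < n" using ab by auto
    show "(M *\<^sub>v b) $ i = (q \<cdot>\<^sub>v a + p \<cdot>\<^sub>v b) $ i"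
      using arg_cong[OF ent[OF i], of Im] i w M
      by (simp add: scalar_prod_def a_def b_def p_def q_def)
  qed (use M ab in auto)
  have sum: "qform P (M *\<^sub>v a) + qform P (M *\<^sub>v b) = (p\<^sup>2 + q\<^sup>2) * (qform P a + qform P b)"
    unfolding Ma Mb using ab sP cP
    by (simp add: qform_add qform_minus qform_smult bform_smult_left[of P n n]
      bform_smult_right[of P n n] bform_sym[OF sP, of b a] algebra_simps)
  have "a \<noteq> 0\<^sub>v n \<or> b \<noteq> 0\<^sub>v n"
  proof (rule ccontr)
    assume "\<not> ?thesis"
    then have "a $ i = 0" "b $ i = 0" if "i < n" for i using that by auto
    then have "w = 0\<^sub>v n"
      using w by (intro eq_vecI) (auto simp: a_def b_def complex_eq_iff)
    with w show False by simp
  qed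
  \<comment> \<open>One of \<open>a\<close> and \<open>b\<close> may vanish, where only the weak
    inequality holds; the other one supplies strictness of the sum.\<close>
  moreover have "c\<^sup>2 * qform P (M *\<^sub>v v) \<le> qform P v" if "v \<in> carrier_vec n" for v
    using less[OF that] that M cP by (cases "v = 0\<^sub>v n") (auto simp: mult_mat_zero_vec bform_def intro: less_imp_le)
  ultimately have lt: "c\<^sup>2 * qform P (M *\<^sub>v a) + c\<^sup>2 * qform P (M *\<^sub>v b) < qform P a + qform P b"
    and pos: "0 < qform P a + qform P b"
    using less ab pos_defD(3,4)[OF P] by (smt (verit, best))+
  have "(c\<^sup>2 * (p\<^sup>2 + q\<^sup>2)) * (qform P a + qform P b) < 1 * (qform P a + qform P b)"
    unfolding mult.assoc sum[symmetric] using lt by (simp add: distrib_left)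
  then have "c\<^sup>2 * (p\<^sup>2 + q\<^sup>2) < 1" using pos by (simp only: mult_less_cancel_right_pos)
  then have "(c * cmod l)\<^sup>2 < 1\<^sup>2"
    by (simp add: cmod_def p_def q_def power_mult_distrib)
  then have "c * cmod l < 1" by (rule power_less_imp_less_base) simp
  then show ?thesis using c rho by (simp add: field_simps)
qed

section \<open>Decay of matrix powers and the Lyapunov series\<close>

lemma smult_pow_mat:
  fixes N :: "'a :: comm_ring_1 mat"
  assumes "N \<in> carrier_mat n n"
  shows "(a \<cdot>\<^sub>m N) ^\<^sub>m k = a ^ k \<cdot>\<^sub>m N ^\<^sub>m k"
proof (induction k)
  case 0
  then show ?case using assms by auto
next
  case (Suc k)
  have "(a \<cdot>\<^sub>m N) ^\<^sub>m Suc k = (a ^ k \<cdot>\<^sub>m N ^\<^sub>m k) * (a \<cdot>\<^sub>m N)" using Suc by simp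
  also have "\<dots> = a ^ k \<cdot>\<^sub>m (N ^\<^sub>m k * (a \<cdot>\<^sub>m N))" using assms by (intro mult_smult_assoc_mat[of _ n n]) auto
  also have "N ^\<^sub>m k * (a \<cdot>\<^sub>m N) = a \<cdot>\<^sub>m (N ^\<^sub>m k * N)" using assms by (intro mult_smult_distrib[of _ n n]) auto
  also have "a ^ k \<cdot>\<^sub>m (a \<cdot>\<^sub>m (N ^\<^sub>m k * N)) = a ^ Suc k \<cdot>\<^sub>m (N ^\<^sub>m Suc k)"
    by (rule eq_matI) (auto simp: algebra_simps)
  finally show ?case .
qed

text \<open>Spectral radius below 1 only yields bounded powers directly. Dividing by some
  \<open>r\<close> strictly between \<open>rho M\<close> and 1 leaves a matrix \<open>N\<close> with
  spectral radius still below 1, and its bounded powers times \<open>r ^ k\<close> give the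
  geometric rate.\<close>

lemma power_entries_bound:
  assumes n: "0 < n" and M: "M \<in> carrier_mat n n" and rho: "rho M < 1"
  obtains c r where "0 \<le> c" "0 < r" "r < 1"
    "\<And>k i j. i < n \<Longrightarrow> j < n \<Longrightarrow> \<bar>(M ^\<^sub>m k) $$ (i, j)\<bar> \<le> c * r ^ k"
proof -
  obtain r where r: "rho M < r" "r < 1" using rho dense by blast
  then have r0: "0 < r" using rho_nonneg[OF n M] by simp
  let ?C = "map_mat complex_of_real M"
  define N where "N = complex_of_real (1 / r) \<cdot>\<^sub>m ?C"
  have C: "?C \<in> carrier_mat n n" and N: "N \<in> carrier_mat n n" using M by (auto simp: N_def)
  have CN: "?C = complex_of_real r \<cdot>\<^sub>m N"
    unfolding N_def using r0 by (intro eq_matI) auto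
  have "spectral_radius N < 1"
  proof -
    obtain l where l: "l \<in> spectrum N" "spectral_radius N = cmod l"
      using spectral_radius_mem_max(1)[OF N n] by auto
    then obtain w where w: "w \<in> carrier_vec n" "w \<noteq> 0\<^sub>v n" "N *\<^sub>v w = l \<cdot>\<^sub>v w"
      using N by (auto simp: spectrum_def eigenvalue_def eigenvector_def)
    have "?C *\<^sub>v w = complex_of_real r \<cdot>\<^sub>v (N *\<^sub>v w)" unfolding CN
      using N w(1) by (intro eq_vecI) (auto simp: scalar_prod_def sum_distrib_left mult_ac)
    then have "?C *\<^sub>v w = (complex_of_real r * l) \<cdot>\<^sub>v w" using w by (simp add: smult_smult_assoc)
    then have "cmod (complex_of_real r * l) \<le> rho M" by (rule eigenvalue_le_rho[OF n M w(1,2)])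
    then have "r * cmod l \<le> rho M" using r0 by (simp add: norm_mult)
    then have "r * cmod l < r * 1" using r by linarith
    then have "cmod l < 1" using r0 by (simp only: mult_less_cancel_left_pos)
    then show ?thesis using l by simp
  qed
  then obtain c where c: "\<And>k. norm_bound (N ^\<^sub>m k) c"
    using spectral_radius_jnf_norm_bound_less_1_upper_triangular[OF N] by blast
  have bound: "\<bar>(M ^\<^sub>m k) $$ (i, j)\<bar> \<le> \<bar>c\<bar> * r ^ k" if ij: "i < n" "j < n" for k i j
  proof -
    have "map_mat complex_of_real (M ^\<^sub>m k) = complex_of_real r ^ k \<cdot>\<^sub>m N ^\<^sub>m k"
      using of_real_hom.mat_hom_pow[OF M, of k] smult_pow_mat[OF N] CN by metis
    then have "map_mat complex_of_real (M ^\<^sub>m k) $$ (i, j) = (complex_of_real r ^ k \<cdot>\<^sub>m N ^\<^sub>m k) $$ (i, j)"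
      by simp
    moreover have "M ^\<^sub>m k \<in> carrier_mat n n" "N ^\<^sub>m k \<in> carrier_mat n n" using M N by auto
    ultimately have "complex_of_real ((M ^\<^sub>m k) $$ (i, j)) = complex_of_real r ^ k * (N ^\<^sub>m k) $$ (i, j)"
      using ij by (metis carrier_matD index_map_mat(1) index_smult_mat(1))
    then have "\<bar>(M ^\<^sub>m k) $$ (i, j)\<bar> = r ^ k * cmod ((N ^\<^sub>m k) $$ (i, j))"
      using r0 by (metis abs_of_pos norm_mult norm_of_real norm_power)
    moreover have "cmod ((N ^\<^sub>m k) $$ (i, j)) \<le> \<bar>c\<bar>"
      using c[of k] \<open>N ^\<^sub>m k \<in> _\<close> ij unfolding norm_bound_def
      by (metis abs_ge_self carrier_matD order_trans)
    ultimately show ?thesis using r0 by (simp add: mult.commute mult_left_mono)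
  qed
  show ?thesis using that[of "\<bar>c\<bar>" r] bound r r0 by auto
qed

lemma bform_sum:
  assumes "P \<in> carrier_mat r c" "v \<in> carrier_vec r" "w \<in> carrier_vec c"
  shows "bform P v w = (\<Sum>i<r. \<Sum>j<c. v $ i * P $$ (i, j) * w $ j)"
proof -
  have "bform P v w = (\<Sum>i = 0..<r. v $ i * (\<Sum>j = 0..<c. P $$ (i, j) * w $ j))"
    using assms unfolding bform_def scalar_prod_def
    by (auto intro!: sum.cong simp: scalar_prod_def)
  then show ?thesis
    by (simp add: sum_distrib_left mult.assoc lessThan_atLeast0)
qed

lemma summable_qform_power:
  assumes n: "0 < n" and M: "M \<in> carrier_mat n n" and rho: "rho M < 1"
    and P: "P \<in> carrier_mat n n" and v: "v \<in> carrier_vec n"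
  shows "summable (\<lambda>k. qform P (M ^\<^sub>m k *\<^sub>v v))"
proof -
  obtain c r where c: "0 \<le> c" and r: "0 < r" "r < 1"
    and bound: "\<And>k i j. i < n \<Longrightarrow> j < n \<Longrightarrow> \<bar>(M ^\<^sub>m k) $$ (i, j)\<bar> \<le> c * r ^ k"
    using power_entries_bound[OF n M rho] by metis
  define d where "d = (\<Sum>j<n. c * \<bar>v $ j\<bar>)"
  have d: "0 \<le> d" unfolding d_def using c by (intro sum_nonneg) auto
  have ent: "\<bar>(M ^\<^sub>m k *\<^sub>v v) $ i\<bar> \<le> d * r ^ k" if i: "i < n" for i k
  proof -
    have Mk: "M ^\<^sub>m k \<in> carrier_mat n n" using M by auto
    have "(M ^\<^sub>m k *\<^sub>v v) $ i = (\<Sum>j<n. (M ^\<^sub>m k) $$ (i, j) * v $ j)"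
      by (rule mult_mat_vec_entry[OF Mk v i])
    also have "\<bar>\<dots>\<bar> \<le> (\<Sum>j<n. \<bar>(M ^\<^sub>m k) $$ (i, j) * v $ j\<bar>)" by (rule sum_abs)
    also have "\<dots> \<le> (\<Sum>j<n. (c * r ^ k) * \<bar>v $ j\<bar>)"
      using bound[OF i] by (intro sum_mono) (auto simp: abs_mult intro!: mult_right_mono)
    finally show ?thesis by (simp add: d_def sum_distrib_left mult_ac)
  qed
  define e where "e = (\<Sum>i<n. \<Sum>j<n. d * \<bar>P $$ (i, j)\<bar> * d)"
  have "norm (qform P (M ^\<^sub>m k *\<^sub>v v)) \<le> e * (r\<^sup>2) ^ k" for k
  proof -
    have y: "M ^\<^sub>m k *\<^sub>v v \<in> carrier_vec n"
      by (rule mult_mat_vec_carrier[OF pow_carrier_mat[OF M] v])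
    have "norm (qform P (M ^\<^sub>m k *\<^sub>v v)) \<le>
      (\<Sum>i<n. \<Sum>j<n. \<bar>(M ^\<^sub>m k *\<^sub>v v) $ i\<bar> * \<bar>P $$ (i, j)\<bar> * \<bar>(M ^\<^sub>m k *\<^sub>v v) $ j\<bar>)"
      unfolding bform_sum[OF P y y] real_norm_def
      by (rule order_trans[OF sum_abs], rule sum_mono, rule order_trans[OF sum_abs])
        (simp add: abs_mult)
    also have "\<dots> \<le> (\<Sum>i<n. \<Sum>j<n. (d * r ^ k) * \<bar>P $$ (i, j)\<bar> * (d * r ^ k))"
      using d r by (intro sum_mono mult_mono ent) auto
    also have "\<dots> = e * (r\<^sup>2) ^ k"
      unfolding e_def sum_distrib_right
      by (intro sum.cong refl) (simp add: mult_ac power2_eq_square power_mult_distrib)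
    finally show ?thesis .
  qed
  moreover have "summable (\<lambda>k. e * (r\<^sup>2) ^ k)"
    using r by (intro summable_mult summable_geometric) (simp add: abs_square_less_1)
  ultimately show ?thesis by (blast intro: summable_comparison_test')
qed

lemma pow_mat_Suc_mult_vec:
  assumes "M \<in> carrier_mat n n" "v \<in> carrier_vec n"
  shows "M ^\<^sub>m Suc k *\<^sub>v v = M ^\<^sub>m k *\<^sub>v (M *\<^sub>v v)"
  using assms by (simp add: assoc_mult_mat_vec[of _ n n _ n])

text \<open>Along the orbit of \<open>v\<close> the form does not increase, and it tends to zero
  because its values are summable; hence it starts at a nonnegative value. This is the source of
  every inequality between cost matrices below.\<close>

lemma qform_nonneg_of_stable:
  assumes n: "0 < n" and M: "M \<in> carrier_mat n n" and rho: "rho M < 1"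
    and P: "P \<in> carrier_mat n n"
    and le: "\<And>v. v \<in> carrier_vec n \<Longrightarrow> qform P (M *\<^sub>v v) \<le> qform P v"
    and v: "v \<in> carrier_vec n"
  shows "0 \<le> qform P v"
proof -
  have "qform P (M ^\<^sub>m k *\<^sub>v v) \<le> qform P v" if "v \<in> carrier_vec n" for k v
    using that
  proof (induction k arbitrary: v)
    case 0
    then show ?case using M by simp
  next
    case (Suc k)
    have "qform P (M ^\<^sub>m k *\<^sub>v (M *\<^sub>v v)) \<le> qform P (M *\<^sub>v v)" using Suc M by auto
    also have "\<dots> \<le> qform P v" using le Suc.prems .
    finally show ?case
      using M Suc.prems by (simp add: pow_mat_Suc_mult_vec del: pow_mat.simps)
  qed
  moreover have "(\<lambda>k. qform P (M ^\<^sub>m k *\<^sub>v v)) \<longlonglongrightarrow> 0"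
    using summable_qform_power[OF n M rho P v] by (rule summable_LIMSEQ_zero)
  ultimately show ?thesis using v by (intro LIMSEQ_le_const2) auto
qed

lemma mat_tendsto_entry:
  "mat_tendsto r c S P \<Longrightarrow> i < r \<Longrightarrow> j < c \<Longrightarrow> (\<lambda>k. S k $$ (i, j)) \<longlonglongrightarrow> P $$ (i, j)"
  by (auto simp: mat_tendsto_def)

lemma tendsto_bform:
  assumes "mat_tendsto r c S P" "\<And>k. S k \<in> carrier_mat r c" "v \<in> carrier_vec r" "w \<in> carrier_vec c"
  shows "(\<lambda>k. bform (S k) v w) \<longlonglongrightarrow> bform P v w"
proof -
  have P: "P \<in> carrier_mat r c" using assms(1) by (simp add: mat_tendsto_def)
  show ?thesis
    unfolding bform_sum[OF P assms(3,4)] bform_sum[OF assms(2) assms(3,4)]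
    by (intro tendsto_intros mat_tendsto_entry[OF assms(1)]) auto
qed

text \<open>Polarization passes from the quadratic forms to the bilinear forms, and unit vectors
  pass from these to the entries.\<close>

lemma sym_mat_limit:
  assumes S: "\<And>k. sym_mat n (S k)"
    and conv: "\<And>v. v \<in> carrier_vec n \<Longrightarrow> convergent (\<lambda>k. qform (S k) v)"
  obtains P where "sym_mat n P" "mat_tendsto n n S P"
proof -
  have conv_b: "convergent (\<lambda>k. bform (S k) v w)" if "v \<in> carrier_vec n" "w \<in> carrier_vec n" for v w
    unfolding bform_polarization[OF S that] divide_inverse using that
    by (intro convergent_diff convergent_mult convergent_const conv) auto
  have conv_e: "convergent (\<lambda>k. S k $$ (i, j))" if "i < n" "j < n" for i j
    using conv_b[of "unit_vec n i" "unit_vec n j"] bform_unit_vec[OF sym_matD(1)[OF S] that] by simp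
  define P where "P = mat n n (\<lambda>(i, j). lim (\<lambda>k. S k $$ (i, j)))"
  have tend: "mat_tendsto n n S P"
    using conv_e by (auto simp: mat_tendsto_def P_def convergent_LIMSEQ_iff)
  have "S k $$ (i, j) = S k $$ (j, i)" if "i < n" "j < n" for i j k
    using S[of k] that by (metis carrier_matD index_transpose_mat(1) sym_mat_def)
  then have "sym_mat n P" by (auto simp: sym_mat_def P_def)
  then show ?thesis using tend that by blast
qed

text \<open>The solution is the series of \<open>(M^T)^k W M^k\<close>, built as the limit of the
  fixed-point iteration \<open>S\<close> from zero. Its values are partial sums of
  \<open>qform W\<close> along an orbit, and the equation is the limit of the recursion.\<close>

lemma lyapunov_solution_exists:
  assumes n: "0 < n" and M: "M \<in> carrier_mat n n" and rho: "rho M < 1" and W: "sym_mat n W"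
  obtains P where "sym_mat n P" "\<And>v. v \<in> carrier_vec n \<Longrightarrow> qform P v = qform P (M *\<^sub>v v) + qform W v"
proof -
  define S where "S = rec_nat (0\<^sub>m n n) (\<lambda>_ X. M\<^sup>T * X * M + W)"
  have S0: "S 0 = 0\<^sub>m n n" and SS: "S (Suc k) = M\<^sup>T * S k * M + W" for k by (simp_all add: S_def)
  have sym: "sym_mat n (S k)" for k
  proof (induction k)
    case 0
    then show ?case by (auto simp: S0 sym_mat_def)
  next
    case (Suc k)
    then show ?case unfolding SS by (intro sym_mat_add sym_mat_congruence[OF _ M] W)
  qed
  have qS: "qform (S (Suc k)) v = qform (S k) (M *\<^sub>v v) + qform W v" if "v \<in> carrier_vec n" for k v
    unfolding SS using that M sym_matD(1)[OF sym] sym_matD(1)[OF W]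
    by (subst bform_add_mat[of _ n n]) (auto simp: bform_congruence[of M n n _ n M n])
  have sum: "qform (S k) v = (\<Sum>i<k. qform W (M ^\<^sub>m i *\<^sub>v v))" if "v \<in> carrier_vec n" for k v
    using that
  proof (induction k arbitrary: v)
    case 0
    then show ?case by (simp add: S0 bform_zero_mat)
  next
    case (Suc k)
    then have "qform (S (Suc k)) v = (\<Sum>i<k. qform W (M ^\<^sub>m Suc i *\<^sub>v v)) + qform W (M ^\<^sub>m 0 *\<^sub>v v)"
      using M by (simp add: qS pow_mat_Suc_mult_vec del: pow_mat.simps(2))
    then show ?case unfolding sum.lessThan_Suc_shift by simp
  qed
  have conv: "convergent (\<lambda>k. qform (S k) v)" if "v \<in> carrier_vec n" for v
    using summable_qform_power[OF n M rho sym_matD(1)[OF W] that] sum[OF that]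
    by (simp add: summable_iff_convergent)
  obtain P where P: "sym_mat n P" "mat_tendsto n n S P" using sym_mat_limit[OF sym conv] .
  have "qform P v = qform P (M *\<^sub>v v) + qform W v" if v: "v \<in> carrier_vec n" for v
  proof (rule LIMSEQ_unique)
    note T = tendsto_bform[OF P(2) sym_matD(1)[OF sym]]
    show "(\<lambda>k. qform (S (Suc k)) v) \<longlonglongrightarrow> qform P v" using LIMSEQ_Suc[OF T[OF v v]] .
    show "(\<lambda>k. qform (S (Suc k)) v) \<longlonglongrightarrow> qform P (M *\<^sub>v v) + qform W v"
      unfolding qS[OF v] using M v by (intro tendsto_intros T) auto
  qed
  then show ?thesis using that P by blast
qed

section \<open>Extreme singular values\<close>

lemma scalar_prod_self_nonneg: "0 \<le> v \<bullet> (v :: real vec)"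
  unfolding scalar_prod_def by (auto intro: sum_nonneg)

lemma scalar_prod_self_pos: "v \<in> carrier_vec n \<Longrightarrow> v \<noteq> 0\<^sub>v n \<Longrightarrow> 0 < v \<bullet> (v :: real vec)"
  using conjugate_square_greater_0_vec[of v n] by simp

text \<open>A crude entrywise bound. The added \<open>1\<close> keeps the constant positive even for
  the zero matrix, so that its reciprocal can serve as a step length.\<close>

lemma qform_bounded:
  assumes P: "P \<in> carrier_mat n n"
  obtains c where "0 < c" "\<And>v. v \<in> carrier_vec n \<Longrightarrow> qform P v \<le> c * (v \<bullet> v)"
proof -
  let ?c = "\<Sum>i<n. \<Sum>j<n. \<bar>P $$ (i, j)\<bar>"
  have "qform P v \<le> (?c + 1) * (v \<bullet> v)" if v: "v \<in> carrier_vec n" for v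
  proof -
    have sq: "(v $ i)\<^sup>2 \<le> v \<bullet> v" if "i < n" for i
    proof -
      have "v $ i * v $ i \<le> (\<Sum>j = 0..<n. v $ j * v $ j)"
        using that by (intro member_le_sum[of i "{0..<n}" "\<lambda>j. v $ j * v $ j"]) auto
      then show ?thesis using v by (simp add: scalar_prod_def power2_eq_square)
    qed
    have "v $ i * P $$ (i, j) * v $ j \<le> \<bar>P $$ (i, j)\<bar> * (v \<bullet> v)" if "i < n" "j < n" for i j
    proof -
      have "2 * (\<bar>v $ i\<bar> * \<bar>v $ j\<bar>) \<le> (v $ i)\<^sup>2 + (v $ j)\<^sup>2"
        using sum_squares_bound[of "\<bar>v $ i\<bar>" "\<bar>v $ j\<bar>"] by simp
      then have "\<bar>v $ i\<bar> * \<bar>v $ j\<bar> \<le> v \<bullet> v" using sq[OF that(1)] sq[OF that(2)] by linarith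
      then have "\<bar>P $$ (i, j)\<bar> * (\<bar>v $ i\<bar> * \<bar>v $ j\<bar>) \<le> \<bar>P $$ (i, j)\<bar> * (v \<bullet> v)"
        by (rule mult_left_mono) simp
      moreover have "v $ i * P $$ (i, j) * v $ j \<le> \<bar>v $ i * P $$ (i, j) * v $ j\<bar>" by simp
      ultimately show ?thesis by (simp add: abs_mult mult_ac)
    qed
    then have "qform P v \<le> (\<Sum>i<n. \<Sum>j<n. \<bar>P $$ (i, j)\<bar> * (v \<bullet> v))"
      unfolding bform_sum[OF P v v] by (intro sum_mono) auto
    then show ?thesis
      using scalar_prod_self_nonneg[of v] by (simp add: sum_distrib_right distrib_right)
  qed
  moreover have "0 < ?c + 1" by (smt (verit) sum_nonneg abs_ge_zero)
  ultimately show ?thesis using that by blast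
qed

text \<open>Take \<open>\<mu>\<close> as the supremum of the Rayleigh quotient. If \<open>T = \<mu> I - S\<close> were invertible, then
  \<open>0 \<le> qform T (v - T\<^sup>-\<^sup>1 v / c)\<close> would bound \<open>qform T\<close> away from \<open>0\<close> on the unit sphere.\<close>

lemma sym_mat_max_eigenvalue:
  assumes n: "0 < n" and S: "sym_mat n S"
  obtains \<mu> w where "w \<in> carrier_vec n" "w \<noteq> 0\<^sub>v n" "S *\<^sub>v w = \<mu> \<cdot>\<^sub>v w"
    "\<And>v. v \<in> carrier_vec n \<Longrightarrow> qform S v \<le> \<mu> * (v \<bullet> v)"
proof -
  have cS: "S \<in> carrier_mat n n" using S by (rule sym_matD)
  let ?X = "{qform S v | v. v \<in> carrier_vec n \<and> v \<bullet> v = 1}"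
  define \<mu> where "\<mu> = Sup ?X"
  obtain c where c: "0 < c" "\<And>v. v \<in> carrier_vec n \<Longrightarrow> qform S v \<le> c * (v \<bullet> v)"
    using qform_bounded[OF cS] by blast
  have bdd: "bdd_above ?X" using c(2) by (fastforce intro!: bdd_aboveI[of _ c])
  have ne: "?X \<noteq> {}" using n by (auto intro!: exI[of _ "unit_vec n 0"])
  have le: "qform S v \<le> \<mu> * (v \<bullet> v)" if v: "v \<in> carrier_vec n" for v
  proof (cases "v = 0\<^sub>v n")
    case True
    then show ?thesis using cS by (simp add: bform_def mult_mat_zero_vec)
  next
    case False
    define t where "t = v \<bullet> v"
    have t: "0 < t" unfolding t_def by (rule scalar_prod_self_pos[OF v False])
    let ?w = "(1 / sqrt t) \<cdot>\<^sub>v v"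
    have w: "?w \<in> carrier_vec n" using v by simp
    have tt: "(1 / sqrt t)\<^sup>2 = 1 / t" using t by (simp add: power_divide)
    have "?w \<bullet> ?w = (1 / sqrt t)\<^sup>2 * t"
      using v unfolding t_def power2_eq_square by (simp add: scalar_prod_smult_distrib[of _ n])
    then have "?w \<bullet> ?w = 1" using t tt by simp
    then have "qform S ?w \<le> \<mu>" unfolding \<mu>_def using w by (intro cSup_upper[OF _ bdd]) blast
    then have "1 / t * qform S v \<le> \<mu>" using qform_smult[OF cS v, of "1 / sqrt t"] tt by simp
    then show ?thesis using t unfolding t_def[symmetric] by (simp add: field_simps)
  qed
  define T where "T = \<mu> \<cdot>\<^sub>m 1\<^sub>m n - S"
  have T: "sym_mat n T" unfolding T_def by (intro sym_mat_minus sym_mat_smult sym_mat_one S)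
  have cT: "T \<in> carrier_mat n n" using T by (rule sym_matD)
  have qT: "qform T v = \<mu> * (v \<bullet> v) - qform S v" if "v \<in> carrier_vec n" for v
    unfolding T_def using that cS
    by (simp add: bform_minus_mat[of _ n n] bform_smult_mat[of _ n n] bform_one)
  have "det T = 0"
  proof (rule ccontr)
    assume "det T \<noteq> 0"
    note Ti = minv_inverse[OF cT this]
    obtain d where d: "0 < d" "\<And>v. v \<in> carrier_vec n \<Longrightarrow> qform (minv T) v \<le> d * (v \<bullet> v)"
      using qform_bounded[OF Ti(1)] by blast
    have "qform S v \<le> \<mu> - 1 / d" if v: "v \<in> carrier_vec n" and v1: "v \<bullet> v = 1" for v
    proof -
      define y where "y = minv T *\<^sub>v v"
      have y: "y \<in> carrier_vec n" unfolding y_def using Ti(1) v by auto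
      have "T *\<^sub>v y = (T * minv T) *\<^sub>v v"
        unfolding y_def using cT Ti(1) v by (intro assoc_mult_mat_vec[symmetric]) auto
      then have Ty: "T *\<^sub>v y = v" using Ti(3) v by simp
      have yv: "y \<bullet> v = qform (minv T) v"
        unfolding y_def bform_def using Ti(1) v by (intro comm_scalar_prod[of _ n]) auto
      \<comment> \<open>The step \<open>1 / d\<close> minimises
        \<open>t \<mapsto> d * t^2 - 2 * t\<close>, which bounds the change of the form; the minimum
        is \<open>- 1 / d\<close>.\<close>
      have "0 \<le> qform T (v - (1 / d) \<cdot>\<^sub>v y)"
        using v y qT le by simp
      also have "\<dots> = qform T v - 2 * (1 / d) * bform T v y + (1 / d)\<^sup>2 * qform T y"
        using v y cT by (simp add: qform_minus[OF T] qform_smult bform_smult_right[of T n n])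
      also have "bform T v y = 1" unfolding bform_def Ty v1 ..
      also have "qform T y = qform (minv T) v" unfolding bform_def[of T] Ty yv ..
      finally have "0 \<le> qform T v - 2 * (1 / d) + (1 / d)\<^sup>2 * qform (minv T) v" by simp
      moreover have "(1 / d)\<^sup>2 * qform (minv T) v \<le> (1 / d)\<^sup>2 * d"
        using d(2)[OF v] v1 by (intro mult_left_mono) auto
      moreover have "(1 / d)\<^sup>2 * d = 1 / d" using d(1) by (simp add: power2_eq_square)
      ultimately show ?thesis using qT[OF v] v1 by simp
    qed
    then have "\<mu> \<le> \<mu> - 1 / d" unfolding \<mu>_def by (intro cSup_least[OF ne]) auto
    with d show False by simp
  qed
  then obtain w where w: "w \<in> carrier_vec n" "w \<noteq> 0\<^sub>v n" "T *\<^sub>v w = 0\<^sub>v n"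
    using det_0_iff_vec_prod_zero_field[OF cT] by blast
  have "S *\<^sub>v w = \<mu> \<cdot>\<^sub>v w"
  proof (rule eq_vecI)
    fix i assume "i < dim_vec (\<mu> \<cdot>\<^sub>v w)"
    then have i: "i < n" using w by simp
    have "T *\<^sub>v w = (\<mu> \<cdot>\<^sub>m 1\<^sub>m n) *\<^sub>v w - S *\<^sub>v w"
      unfolding T_def using cS w by (intro minus_mult_distrib_mat_vec) auto
    also have "(\<mu> \<cdot>\<^sub>m 1\<^sub>m n) *\<^sub>v w = \<mu> \<cdot>\<^sub>v w" using w by auto
    finally have "\<mu> \<cdot>\<^sub>v w - S *\<^sub>v w = 0\<^sub>v n" using w(3) by simp
    then have "(\<mu> \<cdot>\<^sub>v w - S *\<^sub>v w) $ i = 0" using i by simp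
    then show "(S *\<^sub>v w) $ i = (\<mu> \<cdot>\<^sub>v w) $ i" using i w cS by simp
  qed (use cS w in auto)
  then show ?thesis using that w le by blast
qed

lemma finite_singular_values: "M \<in> carrier_mat n n \<Longrightarrow> finite (singular_values M)"
  unfolding singular_values_def by (intro finite_imageI card_finite_spectrum[of _ n]) auto

text \<open>For symmetric \<open>M\<close> the matrix \<open>M^T M\<close> is the square of
  \<open>M\<close> and has the eigenvalue \<open>\<mu>^2\<close>; the sign condition ensures that
  its root is \<open>\<mu>\<close> and not \<open>- \<mu>\<close>.\<close>

lemma eigenvalue_mem_singular_values:
  assumes M: "sym_mat n M" and w: "w \<in> carrier_vec n" "w \<noteq> 0\<^sub>v n"
    and ev: "M *\<^sub>v w = \<mu> \<cdot>\<^sub>v w" and \<mu>: "0 \<le> \<mu>"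
  shows "\<mu> \<in> singular_values M"
proof -
  have cM: "M \<in> carrier_mat n n" "M\<^sup>T = M" using sym_matD[OF M] by auto
  have "(M\<^sup>T * M) *\<^sub>v w = M *\<^sub>v (M *\<^sub>v w)"
    using cM w by (simp add: assoc_mult_mat_vec[of _ n n _ n])
  also have "\<dots> = (\<mu>\<^sup>2) \<cdot>\<^sub>v w"
    using cM w ev by (simp add: mult_mat_vec[of _ n n] smult_smult_assoc power2_eq_square)
  finally have "eigenvector (M\<^sup>T * M) w (\<mu>\<^sup>2)" using cM w by (auto simp: eigenvector_def)
  then have "\<mu>\<^sup>2 \<in> spectrum (M\<^sup>T * M)" by (auto simp: spectrum_def eigenvalue_def)
  then show ?thesis unfolding singular_values_def using \<mu> by (intro image_eqI[of _ _ "\<mu>\<^sup>2"]) auto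
qed

lemma qform_eigenvector:
  assumes "w \<in> carrier_vec n" "M *\<^sub>v w = \<mu> \<cdot>\<^sub>v w"
  shows "qform M w = \<mu> * (w \<bullet> w)"
  using assms by (simp add: bform_def)

text \<open>The largest eigenvalue bounds the form. Semidefiniteness makes it nonnegative, hence a
  singular value, hence at most the maximal one.\<close>

lemma qform_le_sigma_max:
  assumes n: "0 < n" and M: "sym_mat n M"
    and psd: "\<And>v. v \<in> carrier_vec n \<Longrightarrow> 0 \<le> qform M v"
    and v: "v \<in> carrier_vec n"
  shows "qform M v \<le> sigma_max M * (v \<bullet> v)"
proof -
  obtain \<mu> w where w: "w \<in> carrier_vec n" "w \<noteq> 0\<^sub>v n" "M *\<^sub>v w = \<mu> \<cdot>\<^sub>v w"
    and le: "\<And>v. v \<in> carrier_vec n \<Longrightarrow> qform M v \<le> \<mu> * (v \<bullet> v)"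
    using sym_mat_max_eigenvalue[OF n M] by metis
  have "0 \<le> \<mu> * (w \<bullet> w)" using psd[OF w(1)] qform_eigenvector[OF w(1,3)] by simp
  then have "0 \<le> \<mu>" using scalar_prod_self_pos[OF w(1,2)] by (simp add: zero_le_mult_iff)
  then have "\<mu> \<le> sigma_max M"
    unfolding sigma_max_def using eigenvalue_mem_singular_values[OF M w] 
    by (intro Max_ge finite_singular_values[OF sym_matD(1)[OF M]])
  then show ?thesis
    using le[OF v] scalar_prod_self_nonneg[of v] by (meson mult_right_mono order_trans)
qed

text \<open>The largest eigenvalue of \<open>- M\<close> is the negative of an eigenvalue of
  \<open>M\<close> that bounds the form from below; by definiteness it is a singular value.\<close>

lemma sigma_min_le_qform:
  assumes n: "0 < n" and M: "pos_def n M" and v: "v \<in> carrier_vec n"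
  shows "sigma_min M * (v \<bullet> v) \<le> qform M v"
proof -
  note sM = pos_defD(1)[OF M] and cM = pos_defD(2)[OF M]
  obtain \<mu> w where w: "w \<in> carrier_vec n" "w \<noteq> 0\<^sub>v n" "(- M) *\<^sub>v w = \<mu> \<cdot>\<^sub>v w"
    and le: "\<And>v. v \<in> carrier_vec n \<Longrightarrow> qform (- M) v \<le> \<mu> * (v \<bullet> v)"
    using sym_mat_max_eigenvalue[OF n sym_mat_uminus[OF sM]] by metis
  have "(- M) *\<^sub>v w = - (M *\<^sub>v w)" using cM w by auto
  then have "- (- (M *\<^sub>v w)) = - (\<mu> \<cdot>\<^sub>v w)" using w(3) by simp
  then have ev: "M *\<^sub>v w = (- \<mu>) \<cdot>\<^sub>v w" by auto
  have "0 < - \<mu> * (w \<bullet> w)" using pos_defD(3)[OF M w(1,2)] qform_eigenvector[OF w(1) ev] by simp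
  then have "0 \<le> - \<mu>" using scalar_prod_self_pos[OF w(1,2)] by (simp add: zero_less_mult_iff mult_less_0_iff)
  then have "sigma_min M \<le> - \<mu>"
    unfolding sigma_min_def using eigenvalue_mem_singular_values[OF sM w(1,2) ev]
    by (intro Min_le finite_singular_values[OF cM])
  then have "sigma_min M * (v \<bullet> v) \<le> - \<mu> * (v \<bullet> v)"
    using scalar_prod_self_nonneg by (rule mult_right_mono)
  then show ?thesis using le[OF v] bform_uminus_mat[OF cM v v] by simp
qed

text \<open>Let \<open>\<sigma>\<close> be the quotient and \<open>q = qform P (M v)\<close>. By
  \<open>decr\<close>, \<open>g^2 q\<close> is at most \<open>qform (P - W) v\<close>, hence at most
  \<open>sigma_max (P - W) * |v|^2\<close>; so \<open>\<sigma> g^2 q\<close> is at most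
  \<open>sigma_min W * |v|^2\<close> and therefore at most \<open>qform W v\<close>. Adding the two
  bounds gives \<open>(\<sigma> + 1) g^2 q \<le> qform P v\<close>, and the step size amounts to
  \<open>(g + a)^2 < g^2 (\<sigma> + 1)\<close>.\<close>

lemma rho_less_of_sigma_step:
  assumes n: "0 < n" and M: "M \<in> carrier_mat n n" and P: "pos_def n P" and W: "pos_def n W"
    and g: "0 < g"
    and decr: "\<And>v. v \<in> carrier_vec n \<Longrightarrow> g\<^sup>2 * qform P (M *\<^sub>v v) \<le> qform P v - qform W v"
    and a: "0 < a" "a < g * sqrt (sigma_min W / sigma_max (P - W) + 1) - g"
  shows "rho M < 1 / (g + a)"
proof (rule rho_lessI_qform[OF n M P])
  let ?\<sigma> = "sigma_min W / sigma_max (P - W)"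
  have ga: "g + a < g * sqrt (?\<sigma> + 1)" using a by simp
  then have "g * 1 < g * sqrt (?\<sigma> + 1)" using a by linarith
  then have "1 < sqrt (?\<sigma> + 1)" using g by (simp only: mult_less_cancel_left_pos)
  \<comment> \<open>Division by zero yields zero, so the existence of a positive admissible
    \<open>a\<close> already excludes a vanishing denominator.\<close>
  then have \<sigma>: "0 < ?\<sigma>" by simp
  have "(g + a)\<^sup>2 < (g * sqrt (?\<sigma> + 1))\<^sup>2" using ga g a by (intro power_strict_mono) auto
  then have ga2: "(g + a)\<^sup>2 < g\<^sup>2 * (?\<sigma> + 1)" using \<sigma> by (simp add: power_mult_distrib)
  show "0 < g + a" using g a by simp
  fix v :: "real vec" assume v: "v \<in> carrier_vec n" "v \<noteq> 0\<^sub>v n"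
  have Mv: "M *\<^sub>v v \<in> carrier_vec n" using M v by auto
  let ?q = "qform P (M *\<^sub>v v)"
  show "(g + a)\<^sup>2 * ?q < qform P v"
  \<comment> \<open>If \<open>?q\<close> vanishes, the claim is just \<open>0 < qform P v\<close>;
    otherwise its positivity is what makes \<open>sigma_max (P - W)\<close> positive.\<close>
  proof (cases "?q = 0")
    case True
    then show ?thesis using pos_defD(3)[OF P v] by simp
  next
    case False
    then have q: "0 < ?q" using pos_defD(4)[OF P Mv] by simp
    have D: "qform (P - W) y = qform P y - qform W y" if "y \<in> carrier_vec n" for y
      using that pos_defD(2)[OF P] pos_defD(2)[OF W] by (simp add: bform_minus_mat[of _ n n])
    have "0 \<le> qform (P - W) y" if "y \<in> carrier_vec n" for y
    proof -
      have "M *\<^sub>v y \<in> carrier_vec n" using M that by auto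
      then have "0 \<le> g\<^sup>2 * qform P (M *\<^sub>v y)" using pos_defD(4)[OF P] by simp
      then show ?thesis using decr[OF that] D[OF that] by simp
    qed
    then have up: "qform (P - W) v \<le> sigma_max (P - W) * (v \<bullet> v)"
      using v pos_defD(1)[OF P] pos_defD(1)[OF W] by (intro qform_le_sigma_max[OF n] sym_mat_minus) auto
    have low: "sigma_min W * (v \<bullet> v) \<le> qform W v" by (rule sigma_min_le_qform[OF n W v(1)])
    have gq: "g\<^sup>2 * ?q \<le> qform (P - W) v" using decr[OF v(1)] D[OF v(1)] by simp
    have "0 < g\<^sup>2 * ?q" using g q by simp
    then have "0 < sigma_max (P - W) * (v \<bullet> v)" using gq up by linarith
    then have smax: "0 < sigma_max (P - W)"
      using scalar_prod_self_nonneg[of v] by (simp add: zero_less_mult_iff)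
    have "?\<sigma> * (g\<^sup>2 * ?q) \<le> ?\<sigma> * (sigma_max (P - W) * (v \<bullet> v))"
      using gq up \<sigma> by (intro mult_left_mono) auto
    also have "\<dots> = sigma_min W * (v \<bullet> v)" using smax by simp
    finally have "?\<sigma> * (g\<^sup>2 * ?q) \<le> qform W v" using low by simp
    have "(g + a)\<^sup>2 * ?q < g\<^sup>2 * (?\<sigma> + 1) * ?q" using ga2 q by (rule mult_strict_right_mono)
    also have "\<dots> = ?\<sigma> * (g\<^sup>2 * ?q) + g\<^sup>2 * ?q" by (simp add: algebra_simps)
    also have "\<dots> \<le> qform W v + qform (P - W) v" using \<open>?\<sigma> * (g\<^sup>2 * ?q) \<le> qform W v\<close> gq by simp
    also have "\<dots> = qform P v" using D[OF v(1)] by simp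
    finally show ?thesis .
  qed
qed

section \<open>Vectorization and column rank\<close>

lemma set_upper_pairs: "set (upper_pairs n) = {(i, j). i \<le> j \<and> j < n}"
  unfolding upper_pairs_def by (auto simp: image_iff)

lemma distinct_upper_pairs: "distinct (upper_pairs n)"
  unfolding upper_pairs_def
  by (rule distinct_concat) (auto simp: distinct_map inj_on_def upt_conv_Cons)

lemma length_upper_pairs: "length (upper_pairs n) = tri n"
proof -
  have "length (upper_pairs n) = (\<Sum>i<n. n - i)"
    unfolding upper_pairs_def length_concat
    by (simp add: comp_def sum_list_distinct_conv_sum_set lessThan_atLeast0)
  also have "\<dots> = (\<Sum>i<n. Suc i)"
    by (subst sum.nat_diff_reindex[symmetric]) (auto intro!: sum.cong)
  also have "\<dots> = tri n"
    unfolding tri_def by (induction n) auto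
  finally show ?thesis .
qed

lemma vecs_carrier: "sym_mat n X \<Longrightarrow> vecs X \<in> carrier_vec (tri n)"
  unfolding carrier_vec_def vecs_def by (auto simp: length_upper_pairs sym_mat_def simp del: vec_of_list_map)

lemma vecv_carrier: "v \<in> carrier_vec n \<Longrightarrow> vecv v \<in> carrier_vec (tri n)"
  unfolding carrier_vec_def vecv_def by (auto simp: length_upper_pairs simp del: vec_of_list_map)

lemma sum_upper_pairs:
  fixes f :: "nat \<Rightarrow> nat \<Rightarrow> real"
  assumes f: "\<And>i j. i < n \<Longrightarrow> j < n \<Longrightarrow> f i j = f j i"
  shows "(\<Sum>(i, j)\<in>set (upper_pairs n). if i = j then f i j else 2 * f i j) = (\<Sum>i<n. \<Sum>j<n. f i j)"
proof -
  let ?U = "{(i, j). i < j \<and> j < n}" and ?D = "(\<lambda>i. (i, i)) ` {..<n}" and ?L = "{(i, j). j < i \<and> i < n}"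
  have finU: "finite ?U" and finL: "finite ?L"
    by (rule finite_subset[of _ "{..<n} \<times> {..<n}"]; auto)+
  have swap: "(\<Sum>(i, j)\<in>?L. f i j) = (\<Sum>(i, j)\<in>?U. f i j)"
    by (rule sum.reindex_bij_witness[where i = prod.swap and j = prod.swap]) (auto simp: f)
  have "(\<Sum>i<n. \<Sum>j<n. f i j) = (\<Sum>(i, j)\<in>{..<n} \<times> {..<n}. f i j)" by (rule sum.cartesian_product)
  also have "{..<n} \<times> {..<n} = (?U \<union> ?D) \<union> ?L" by (auto simp: image_iff)
  also have "(\<Sum>(i, j)\<in>(?U \<union> ?D) \<union> ?L. f i j) = (\<Sum>(i, j)\<in>?U \<union> ?D. f i j) + (\<Sum>(i, j)\<in>?L. f i j)"
    using finU finL by (intro sum.union_disjoint) auto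
  also have "(\<Sum>(i, j)\<in>?U \<union> ?D. f i j) = (\<Sum>(i, j)\<in>?U. f i j) + (\<Sum>(i, j)\<in>?D. f i j)"
    using finU by (intro sum.union_disjoint) auto
  finally have rhs: "(\<Sum>i<n. \<Sum>j<n. f i j) = 2 * (\<Sum>(i, j)\<in>?U. f i j) + (\<Sum>(i, j)\<in>?D. f i j)"
    using swap by simp
  have "set (upper_pairs n) = ?U \<union> ?D" unfolding set_upper_pairs by (auto simp: image_iff)
  then have "(\<Sum>(i, j)\<in>set (upper_pairs n). if i = j then f i j else 2 * f i j) =
    (\<Sum>(i, j)\<in>?U. if i = j then f i j else 2 * f i j) + (\<Sum>(i, j)\<in>?D. if i = j then f i j else 2 * f i j)"
    using finU by (simp only:) (intro sum.union_disjoint; auto)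
  also have "(\<Sum>(i, j)\<in>?U. if i = j then f i j else 2 * f i j) = (\<Sum>(i, j)\<in>?U. 2 * f i j)"
    by (intro sum.cong) auto
  also have "\<dots> = 2 * (\<Sum>(i, j)\<in>?U. f i j)" by (simp add: sum_distrib_left case_prod_beta)
  also have "(\<Sum>(i, j)\<in>?D. if i = j then f i j else 2 * f i j) = (\<Sum>(i, j)\<in>?D. f i j)"
    by (intro sum.cong) auto
  finally show ?thesis using rhs by simp
qed

lemma scalar_prod_vec_of_list:
  "length xs = length ys \<Longrightarrow> vec_of_list xs \<bullet> vec_of_list ys = sum_list (map2 (*) xs ys)"
  unfolding scalar_prod_def
  by (simp add: vec_of_list_index sum_list_sum_nth atLeast0LessThan del: vec_of_list_map)

lemma vecv_scalar_prod_vecs: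
  assumes X: "sym_mat n X" and v: "v \<in> carrier_vec n"
  shows "vecv v \<bullet> vecs X = qform X v"
proof -
  have cX: "X \<in> carrier_mat n n" and symX: "\<And>i j. i < n \<Longrightarrow> j < n \<Longrightarrow> X $$ (i, j) = X $$ (j, i)"
    using X by (auto simp: sym_mat_def) (metis carrier_matD index_transpose_mat(1))
  have "vecv v \<bullet> vecs X = sum_list (map (\<lambda>(i, j). v $ i * v $ j *
      (if i = j then X $$ (i, j) else 2 * X $$ (i, j))) (upper_pairs n))"
    unfolding vecv_def vecs_def using cX v
    by (simp add: scalar_prod_vec_of_list map2_map_map del: vec_of_list_map) (simp add: split_def)
  also have "\<dots> = (\<Sum>(i, j)\<in>set (upper_pairs n). if i = j then v $ i * X $$ (i, j) * v $ j
      else 2 * (v $ i * X $$ (i, j) * v $ j))"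
    unfolding sum_list_distinct_conv_sum_set[OF distinct_upper_pairs]
    by (intro sum.cong) (auto simp: mult_ac)
  also have "\<dots> = (\<Sum>i<n. \<Sum>j<n. v $ i * X $$ (i, j) * v $ j)"
    by (rule sum_upper_pairs) (simp add: symX mult_ac)
  finally show ?thesis unfolding bform_sum[OF cX v v] .
qed

lemma vecs_inject:
  assumes X: "sym_mat n X" and Y: "sym_mat n Y" and eq: "vecs X = vecs Y"
  shows "X = Y"
proof -
  have c: "X \<in> carrier_mat n n" "Y \<in> carrier_mat n n" using X Y by (auto simp: sym_mat_def)
  have "list_of_vec (vecs X) = list_of_vec (vecs Y)" using eq by simp
  then have *: "X $$ (i, j) = Y $$ (i, j)" if "i \<le> j" "j < n" for i j
    using that c unfolding vecs_def list_vec
    by (auto simp: set_upper_pairs split: if_splits)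
  show ?thesis
  proof (rule eq_matI)
    fix i j assume "i < dim_row Y" "j < dim_col Y"
    then have ij: "i < n" "j < n" using c by auto
    have "X $$ (i, j) = X $$ (j, i)" "Y $$ (i, j) = Y $$ (j, i)"
      using X Y ij by (auto simp: sym_mat_def) (metis carrier_matD index_transpose_mat(1))+
    then show "X $$ (i, j) = Y $$ (i, j)" using *[of i j] *[of j i] ij by (cases "i \<le> j") auto
  qed (use c in auto)
qed

text \<open>Together with \<open>vec_stack_surj\<close> this lets an arbitrary kernel vector of
  \<open>psi\<close> be read as a triple of matrices.\<close>

lemma vecs_surj:
  assumes z: "z \<in> carrier_vec (tri n)"
  obtains X where "sym_mat n X" "vecs X = z"
proof -
  let ?L = "upper_pairs n"
  define f where "f = (\<lambda>p. the (map_of (zip ?L (list_of_vec z)) p))"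
  have len: "length ?L = length (list_of_vec z)" using z by (simp add: length_upper_pairs)
  have f: "map f ?L = list_of_vec z"
    using len unfolding f_def
    by (intro nth_equalityI) (auto simp: map_of_zip_nth distinct_upper_pairs)
  \<comment> \<open>\<open>f\<close> looks up the coefficient of a pair. Halving off the diagonal
    undoes the factor in \<open>vecs\<close>, and \<open>min\<close> and \<open>max\<close> fold the
    lower triangle onto the upper one.\<close>
  define X where "X = mat n n (\<lambda>(i, j). f (min i j, max i j) / (if i = j then 1 else 2))"
  have X: "sym_mat n X" unfolding sym_mat_def X_def by (auto simp: min.commute max.commute)
  have "map (\<lambda>(i, j). if i = j then X $$ (i, j) else 2 * X $$ (i, j)) ?L = map f ?L"
    by (rule map_cong[OF refl]) (auto simp: set_upper_pairs X_def min_def max_def)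
  then have "vecs X = z"
    unfolding vecs_def using f vec_list[of z] by (simp add: X_def del: vec_of_list_map)
  with X that show ?thesis by blast
qed

section \<open>Column stacking and Kronecker products\<close>

lemma sum_div_mod:
  fixes f :: "nat \<Rightarrow> nat \<Rightarrow> real"
  shows "(\<Sum>i<r * c. f (i div c) (i mod c)) = (\<Sum>b<r. \<Sum>a<c. f b a)"
proof (cases "c = 0")
  case False
  have "(\<Sum>b<r. \<Sum>a<c. f b a) = (\<Sum>(b, a)\<in>{..<r} \<times> {..<c}. f b a)" by (rule sum.cartesian_product)
  also have "\<dots> = (\<Sum>i<r * c. f (i div c) (i mod c))"
  proof (rule sum.reindex_bij_witness[where j = "\<lambda>(b, a). b * c + a" and i = "\<lambda>i. (i div c, i mod c)"])
    fix p assume "p \<in> {..<r} \<times> {..<c}"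
    then obtain b a where p: "p = (b, a)" "b < r" "a < c" by auto
    have "b * c + a < Suc b * c" using p by simp
    also have "\<dots> \<le> r * c" using p by (intro mult_le_mono1) auto
    finally show "(case p of (b, a) \<Rightarrow> b * c + a) \<in> {..<r * c}" using p by simp
  qed (use False in \<open>auto simp: less_mult_imp_div_less\<close>)
  finally show ?thesis by simp
qed simp

lemma vec_stack_carrier: "X \<in> carrier_mat r c \<Longrightarrow> vec_stack X \<in> carrier_vec (c * r)"
  unfolding vec_stack_def by (auto simp: mult.commute)

lemma kron_vec_carrier: "v \<in> carrier_vec r \<Longrightarrow> w \<in> carrier_vec c \<Longrightarrow> v \<otimes>\<^sub>v w \<in> carrier_vec (r * c)"
  unfolding kron_vec_def by auto

lemma kron_vec_scalar_prod_vec_stack: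
  assumes X: "X \<in> carrier_mat n m" and u: "u \<in> carrier_vec m" and x: "x \<in> carrier_vec n"
  shows "(u \<otimes>\<^sub>v x) \<bullet> vec_stack X = bform X x u"
proof -
  have "(u \<otimes>\<^sub>v x) \<bullet> vec_stack X = (\<Sum>i<m * n. u $ (i div n) * x $ (i mod n) * X $$ (i mod n, i div n))"
    using assms unfolding scalar_prod_def kron_vec_def vec_stack_def
    by (auto simp: lessThan_atLeast0 mult.commute intro!: sum.cong)
  also have "\<dots> = (\<Sum>b<m. \<Sum>a<n. u $ b * x $ a * X $$ (a, b))" by (rule sum_div_mod)
  also have "\<dots> = (\<Sum>a<n. \<Sum>b<m. x $ a * X $$ (a, b) * u $ b)"
    by (subst sum.swap) (simp add: mult_ac)
  finally show ?thesis unfolding bform_sum[OF X x u] .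
qed

lemma vec_stack_inject:
  assumes X: "X \<in> carrier_mat n m" and Y: "Y \<in> carrier_mat n m" and eq: "vec_stack X = vec_stack Y"
  shows "X = Y"
proof (rule mat_eqI_bform[OF X Y])
  fix v w :: "real vec" assume "v \<in> carrier_vec n" "w \<in> carrier_vec m"
  then show "bform X v w = bform Y v w"
    using kron_vec_scalar_prod_vec_stack[OF X] kron_vec_scalar_prod_vec_stack[OF Y] eq by metis
qed

lemma vec_stack_surj:
  assumes z: "z \<in> carrier_vec (m * n)"
  obtains X where "X \<in> carrier_mat n m" "vec_stack X = z"
proof -
  define X where "X = mat n m (\<lambda>(a, b). z $ (b * n + a))"
  have "vec_stack X = z"
  proof (rule eq_vecI)
    fix i assume "i < dim_vec z"
    then have i: "i < m * n" using z by simp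
    then have "0 < n" by (cases n) auto
    then show "vec_stack X $ i = z $ i"
      using i unfolding vec_stack_def X_def by (simp add: less_mult_imp_div_less mult.commute)
  qed (use z in \<open>auto simp: vec_stack_def X_def\<close>)
  then show ?thesis using that[of X] by (simp add: X_def)
qed

section \<open>Block matrices, Kronecker factors and full column rank\<close>

lemma hcat_carrier:
  "X \<in> carrier_mat r c \<Longrightarrow> Y \<in> carrier_mat r d \<Longrightarrow> X @\<^sub>c Y \<in> carrier_mat r (c + d)"
  unfolding hcat_def by auto

lemma row_hcat:
  assumes "X \<in> carrier_mat r c" "Y \<in> carrier_mat r d" "i < r"
  shows "row (X @\<^sub>c Y) i = row X i @\<^sub>v row Y i"
  using assms by (intro eq_vecI) (auto simp: hcat_def)

lemma hcat_mult_append: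
  assumes "X \<in> carrier_mat r c" "Y \<in> carrier_mat r d" "v \<in> carrier_vec c" "w \<in> carrier_vec d"
  shows "(X @\<^sub>c Y) *\<^sub>v (v @\<^sub>v w) = X *\<^sub>v v + Y *\<^sub>v w"
proof (rule eq_vecI)
  fix i assume "i < dim_vec (X *\<^sub>v v + Y *\<^sub>v w)"
  then have i: "i < r" using assms by auto
  then have "((X @\<^sub>c Y) *\<^sub>v (v @\<^sub>v w)) $ i = row (X @\<^sub>c Y) i \<bullet> (v @\<^sub>v w)"
    using hcat_carrier[OF assms(1,2)] by simp
  also have "\<dots> = row X i \<bullet> v + row Y i \<bullet> w"
    unfolding row_hcat[OF assms(1,2) i] using assms i by (intro scalar_prod_append) auto
  finally show "((X @\<^sub>c Y) *\<^sub>v (v @\<^sub>v w)) $ i = (X *\<^sub>v v + Y *\<^sub>v w) $ i" using i assms by simp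
qed (use assms hcat_carrier[OF assms(1,2)] in auto)

lemma cols_hcat:
  assumes "X \<in> carrier_mat r c" "Y \<in> carrier_mat r d"
  shows "cols (X @\<^sub>c Y) = cols X @ cols Y"
  using assms by (intro nth_equalityI) (auto simp: hcat_def nth_append)

lemma mat_row_fun_mult_entry:
  assumes "i < nr" "f i \<in> carrier_vec nc"
  shows "(mat\<^sub>r nr nc f *\<^sub>v v) $ i = f i \<bullet> v"
  using assms by simp

lemma kron_mat_carrier:
  "X \<in> carrier_mat r c \<Longrightarrow> Y \<in> carrier_mat r' c' \<Longrightarrow> X \<otimes>\<^sub>m Y \<in> carrier_mat (r * r') (c * c')"
  unfolding kron_mat_def by auto

text \<open>The mixed-product rule
  \<open>(x \<otimes> y)^T (K^T \<otimes> I) = ((K x) \<otimes> y)^T\<close>, one column at a time;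
  the identity factor collapses the inner sum to the index \<open>q mod n'\<close>.\<close>

lemma kron_vec_mult_kron_mat:
  assumes K: "K \<in> carrier_mat m n" and x: "x \<in> carrier_vec n" and y: "y \<in> carrier_vec n'"
    and q: "q < m * n'"
  shows "(x \<otimes>\<^sub>v y) \<bullet> col (K\<^sup>T \<otimes>\<^sub>m 1\<^sub>m n') q = ((K *\<^sub>v x) \<otimes>\<^sub>v y) $ q"
proof -
  have n': "0 < n'" using q by (cases n') auto
  have qd: "q div n' < m" "q mod n' < n'" using q n' by (auto simp: less_mult_imp_div_less)
  have "(x \<otimes>\<^sub>v y) \<bullet> col (K\<^sup>T \<otimes>\<^sub>m 1\<^sub>m n') q = (\<Sum>i<n * n'. x $ (i div n') * y $ (i mod n') *
      (K $$ (q div n', i div n') * (if i mod n' = q mod n' then 1 else 0)))"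
    using assms qd n' unfolding scalar_prod_def kron_vec_def kron_mat_def
    by (auto simp: lessThan_atLeast0 less_mult_imp_div_less intro!: sum.cong)
  also have "\<dots> = (\<Sum>b<n. \<Sum>a<n'. x $ b * y $ a * (K $$ (q div n', b) * (if a = q mod n' then 1 else 0)))"
    by (rule sum_div_mod)
  also have "\<dots> = (\<Sum>b<n. K $$ (q div n', b) * x $ b * y $ (q mod n'))"
    using qd by (intro sum.cong refl) (simp add: if_distrib cong: if_cong)
  also have "\<dots> = (K *\<^sub>v x) $ (q div n') * y $ (q mod n')"
    unfolding mult_mat_vec_entry[OF K x qd(1)] sum_distrib_right ..
  also have "\<dots> = ((K *\<^sub>v x) \<otimes>\<^sub>v y) $ q" using K y q unfolding kron_vec_def by simp
  finally show ?thesis .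
qed

text \<open>A maximal independent set of columns has \<open>nc\<close> elements, so there are
  \<open>nc\<close> different columns. Distinctness has to be established because independence is a
  property of the set of columns, which does not notice repetitions.\<close>

lemma (in vec_space) full_rank_distinct_cols:
  assumes A: "A \<in> carrier_mat n nc" and rank: "rank A = nc"
  shows "distinct (cols A)"
proof -
  obtain S where S: "maximal S (\<lambda>T. T \<subseteq> set (cols A) \<and> lin_indpt T)"
    using maximal_exists[of "(\<lambda>T. T \<subseteq> set (cols A) \<and> lin_indpt T)" "card (set (cols A))" "{}"]
    by (meson List.finite_set card_mono empty_iff empty_subsetI finite_lin_indpt2 rev_finite_subset)
  then have "card S \<le> card (set (cols A))" by (simp add: card_mono maximal_def)
  moreover have "card S = nc" using rank_card_indpt[OF A S] rank by simp
  moreover have "length (cols A) = nc" using A by simp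
  ultimately show ?thesis
    using card_length[of "cols A"] by (intro card_distinct) simp
qed

lemma (in vec_space) full_rank_kernel_trivial:
  assumes A: "A \<in> carrier_mat n nc" and rank: "rank A = nc"
    and v: "v \<in> carrier_vec nc" "A *\<^sub>v v = 0\<^sub>v n"
  shows "v = 0\<^sub>v nc"
  using lin_depI[OF A v(1) _ v(2)] full_rank_lin_indpt[OF A rank] full_rank_distinct_cols[OF A rank] by blast

section \<open>Policy iteration for the linear-quadratic problem\<close>

lemma smult_mat_mult_vec:
  fixes M :: "'a :: comm_semiring_0 mat"
  shows "M \<in> carrier_mat r c \<Longrightarrow> v \<in> carrier_vec c \<Longrightarrow> (a \<cdot>\<^sub>m M) *\<^sub>v v = a \<cdot>\<^sub>v (M *\<^sub>v v)"
  by (intro eq_vecI) (auto simp: scalar_prod_def sum_distrib_left mult_ac)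

lemma rho_smult_less_1:
  assumes n: "0 < n" and M: "M \<in> carrier_mat n n" and a: "0 < a" and rho: "rho M < 1 / a"
  shows "rho (a \<cdot>\<^sub>m M) < 1"
proof -
  have aM: "a \<cdot>\<^sub>m M \<in> carrier_mat n n" using M by auto
  obtain w l where w: "w \<in> carrier_vec n" "w \<noteq> 0\<^sub>v n"
    and ev: "map_mat complex_of_real (a \<cdot>\<^sub>m M) *\<^sub>v w = l \<cdot>\<^sub>v w" and l: "rho (a \<cdot>\<^sub>m M) = cmod l"
    using rho_eigenvector[OF n aM] .
  have "map_mat complex_of_real M = complex_of_real (1 / a) \<cdot>\<^sub>m map_mat complex_of_real (a \<cdot>\<^sub>m M)"
    using a by (intro eq_matI) auto
  then have "map_mat complex_of_real M *\<^sub>v w =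
      complex_of_real (1 / a) \<cdot>\<^sub>v (map_mat complex_of_real (a \<cdot>\<^sub>m M) *\<^sub>v w)"
    using aM w(1) by (metis map_carrier_mat smult_mat_mult_vec)
  also have "\<dots> = (complex_of_real (1 / a) * l) \<cdot>\<^sub>v w" unfolding ev by (simp add: smult_smult_assoc)
  finally have "cmod (complex_of_real (1 / a) * l) \<le> rho M" by (rule eigenvalue_le_rho[OF n M w])
  then have "cmod l / a \<le> rho M" using a by (simp add: norm_mult norm_divide)
  then have "cmod l / a < 1 / a" using rho by linarith
  then show ?thesis using a l by (simp add: divide_less_cancel)
qed

lemma bform_congruence':
  assumes "M \<in> carrier_mat c r" "P \<in> carrier_mat c d" "N \<in> carrier_mat d e"
    "v \<in> carrier_vec r" "w \<in> carrier_vec e"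
  shows "bform (M\<^sup>T * (P * N)) v w = bform P (M *\<^sub>v v) (N *\<^sub>v w)"
proof -
  have "M\<^sup>T * (P * N) = M\<^sup>T * P * N" using assms by (intro assoc_mult_mat[symmetric]) auto
  then show ?thesis using bform_congruence[OF assms] by simp
qed

lemma sym_matI_bform:
  assumes M: "M \<in> carrier_mat n n"
    and "\<And>v w. v \<in> carrier_vec n \<Longrightarrow> w \<in> carrier_vec n \<Longrightarrow> bform M v w = bform M w v"
  shows "sym_mat n M"
proof -
  have "M\<^sup>T = M"
    using assms by (intro mat_eqI_bform[of _ n n]) (auto simp: bform_transpose[of M n n])
  then show ?thesis using M by (simp add: sym_mat_def)
qed

section \<open>Entrywise limits of matrices and of their inverses\<close>

lemma mat_tendstoI:
  "\<lbrakk>L \<in> carrier_mat r c; \<And>i j. i < r \<Longrightarrow> j < c \<Longrightarrow> (\<lambda>t. X t $$ (i, j)) \<longlonglongrightarrow> L $$ (i, j)\<rbrakk>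
    \<Longrightarrow> mat_tendsto r c X L"
  by (simp add: mat_tendsto_def)

lemma mat_tendsto_carrier: "mat_tendsto r c X L \<Longrightarrow> L \<in> carrier_mat r c"
  by (simp add: mat_tendsto_def)

lemma mat_tendsto_const: "L \<in> carrier_mat r c \<Longrightarrow> mat_tendsto r c (\<lambda>_. L) L"
  by (simp add: mat_tendsto_def)

lemma mat_tendsto_Suc: "mat_tendsto r c (\<lambda>t. X (Suc t)) L \<longleftrightarrow> mat_tendsto r c X L"
  by (simp add: mat_tendsto_def filterlim_sequentially_Suc[where f = "\<lambda>t. X t $$ _"])

lemma mat_tendsto_add:
  assumes X: "mat_tendsto r c X L" "\<And>t. X t \<in> carrier_mat r c"
    and Y: "mat_tendsto r c Y M" "\<And>t. Y t \<in> carrier_mat r c"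
  shows "mat_tendsto r c (\<lambda>t. X t + Y t) (L + M)"
proof (rule mat_tendstoI)
  fix i j assume ij: "i < r" "j < c"
  have "(\<lambda>t. X t $$ (i, j) + Y t $$ (i, j)) \<longlonglongrightarrow> L $$ (i, j) + M $$ (i, j)"
    using X Y ij by (intro tendsto_add mat_tendsto_entry)
  then show "(\<lambda>t. (X t + Y t) $$ (i, j)) \<longlonglongrightarrow> (L + M) $$ (i, j)"
    using ij Y(2) mat_tendsto_carrier[OF Y(1)] by (simp add: carrier_matD[OF Y(2)])
qed (use mat_tendsto_carrier[OF X(1)] mat_tendsto_carrier[OF Y(1)] in auto)

lemma mat_tendsto_minus:
  assumes X: "mat_tendsto r c X L" "\<And>t. X t \<in> carrier_mat r c"
    and Y: "mat_tendsto r c Y M" "\<And>t. Y t \<in> carrier_mat r c"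
  shows "mat_tendsto r c (\<lambda>t. X t - Y t) (L - M)"
proof (rule mat_tendstoI)
  fix i j assume ij: "i < r" "j < c"
  have "(\<lambda>t. X t $$ (i, j) - Y t $$ (i, j)) \<longlonglongrightarrow> L $$ (i, j) - M $$ (i, j)"
    using X Y ij by (intro tendsto_diff mat_tendsto_entry)
  then show "(\<lambda>t. (X t - Y t) $$ (i, j)) \<longlonglongrightarrow> (L - M) $$ (i, j)"
    using ij Y(2) mat_tendsto_carrier[OF Y(1)] by (simp add: carrier_matD[OF Y(2)])
qed (use mat_tendsto_carrier[OF X(1)] mat_tendsto_carrier[OF Y(1)] in auto)

lemma mat_tendsto_transpose:
  assumes X: "mat_tendsto r c X L" "\<And>t. X t \<in> carrier_mat r c"
  shows "mat_tendsto c r (\<lambda>t. (X t)\<^sup>T) L\<^sup>T"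
  using assms mat_tendsto_carrier[OF X(1)]
  by (auto simp: mat_tendsto_def carrier_matD[OF X(2)])

lemma mat_tendsto_mult:
  assumes X: "mat_tendsto r c X L" "\<And>t. X t \<in> carrier_mat r c"
    and Y: "mat_tendsto c d Y M" "\<And>t. Y t \<in> carrier_mat c d"
  shows "mat_tendsto r d (\<lambda>t. X t * Y t) (L * M)"
proof (rule mat_tendstoI)
  fix i j assume ij: "i < r" "j < d"
  have L: "L \<in> carrier_mat r c" "M \<in> carrier_mat c d" using mat_tendsto_carrier X(1) Y(1) by auto
  have entry: "(S * T) $$ (i, j) = (\<Sum>l<c. S $$ (i, l) * T $$ (l, j))"
    if "S \<in> carrier_mat r c" "T \<in> carrier_mat c d" for S T :: "real mat"
    using that ij by (auto simp: scalar_prod_def lessThan_atLeast0 intro!: sum.cong)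
  show "(\<lambda>t. (X t * Y t) $$ (i, j)) \<longlonglongrightarrow> (L * M) $$ (i, j)"
    unfolding entry[OF L] entry[OF X(2) Y(2)]
    using ij by (intro tendsto_sum tendsto_mult mat_tendsto_entry[OF X(1)] mat_tendsto_entry[OF Y(1)]) auto
qed (use mat_tendsto_carrier[OF X(1)] mat_tendsto_carrier[OF Y(1)] in auto)

lemma tendsto_det:
  assumes X: "mat_tendsto n n X L" "\<And>t. X t \<in> carrier_mat n n"
  shows "(\<lambda>t. det (X t)) \<longlonglongrightarrow> det L"
  unfolding det_def'[OF X(2)] det_def'[OF mat_tendsto_carrier[OF X(1)]]
  by (intro tendsto_sum tendsto_mult tendsto_const tendsto_prod mat_tendsto_entry[OF X(1)])
    (auto simp: permutes_in_image)

lemma mat_tendsto_delete: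
  assumes X: "mat_tendsto (Suc n) (Suc n) X L" "\<And>t. X t \<in> carrier_mat (Suc n) (Suc n)"
  shows "mat_tendsto n n (\<lambda>t. mat_delete (X t) i j) (mat_delete L i j)"
proof (rule mat_tendstoI)
  note L = mat_tendsto_carrier[OF X(1)]
  show "mat_delete L i j \<in> carrier_mat n n" using L by (simp add: mat_delete_def)
  fix i' j' assume "i' < n" "j' < n"
  then show "(\<lambda>t. mat_delete (X t) i j $$ (i', j')) \<longlonglongrightarrow> mat_delete L i j $$ (i', j')"
    using L by (simp add: mat_delete_def carrier_matD[OF X(2)] mat_tendsto_entry[OF X(1)])
qed

lemma minv_eq_adj_mat:
  assumes M: "M \<in> carrier_mat n n" and det: "det M \<noteq> 0"
  shows "minv M = (1 / det M) \<cdot>\<^sub>m adj_mat M"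
proof -
  note I = minv_inverse[OF M det] and adj = adj_mat[OF M]
  have "(1 / det M) \<cdot>\<^sub>m (M * adj_mat M) = 1\<^sub>m n"
    unfolding adj(2) using det by (intro eq_matI) auto
  then have "minv M = minv M * ((1 / det M) \<cdot>\<^sub>m (M * adj_mat M))"
    using I(1) by simp
  also have "\<dots> = (1 / det M) \<cdot>\<^sub>m ((minv M * M) * adj_mat M)"
    using I(1) M adj(1) by (simp add: mult_smult_distrib[of _ n n _ n] assoc_mult_mat[of _ n n _ n _ n])
  finally show ?thesis using I adj by simp
qed

text \<open>By Cramer's rule each entry of the inverse is a cofactor divided by the determinant,
  both polynomial in the entries. This yields the limit of the gains from the limit of the cost
  matrices.\<close>

lemma mat_tendsto_minv:
  assumes X: "mat_tendsto n n X L" "\<And>t. X t \<in> carrier_mat n n"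
    and det: "\<And>t. det (X t) \<noteq> 0" "det L \<noteq> 0"
  shows "mat_tendsto n n (\<lambda>t. minv (X t)) (minv L)"
proof (rule mat_tendstoI)
  note L = mat_tendsto_carrier[OF X(1)]
  show "minv L \<in> carrier_mat n n" using minv_inverse(1)[OF L det(2)] .
  fix i j assume ij: "i < n" "j < n"
  then obtain n' where n': "n = Suc n'" by (cases n) auto
  have "(\<lambda>t. cofactor (X t) j i) \<longlonglongrightarrow> cofactor L j i"
    unfolding cofactor_def
    using X L n' by (intro tendsto_mult tendsto_const tendsto_det[of n'] mat_tendsto_delete)
      (auto simp: mat_delete_def carrier_matD[OF X(2)])
  then have "(\<lambda>t. 1 / det (X t) * cofactor (X t) j i) \<longlonglongrightarrow> 1 / det L * cofactor L j i"
    by (intro tendsto_mult tendsto_divide tendsto_const tendsto_det[OF X] det)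
  then show "(\<lambda>t. minv (X t) $$ (i, j)) \<longlonglongrightarrow> minv L $$ (i, j)"
    using ij L unfolding minv_eq_adj_mat[OF X(2) det(1)] minv_eq_adj_mat[OF L det(2)]
    by (simp add: adj_mat_def carrier_matD[OF X(2)])
qed

text \<open>The greedy gain with respect to the cost \<open>P\<close> for the pair
  \<open>(g A, g B)\<close>. It is written with \<open>(A^T P B)^T\<close> instead of
  \<open>B^T P A\<close>, so that the update rule matches it literally once \<open>L1\<close> and
  \<open>L2\<close> are identified.\<close>

definition lq_gain :: "real mat \<Rightarrow> real mat \<Rightarrow> real mat \<Rightarrow> real \<Rightarrow> real mat \<Rightarrow> real mat" where
  "lq_gain A B R g P = g\<^sup>2 \<cdot>\<^sub>m (minv (R + g\<^sup>2 \<cdot>\<^sub>m (B\<^sup>T * P * B)) * (A\<^sup>T * P * B)\<^sup>T)"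

locale lq_problem =
  fixes n m :: nat and A B Q R :: "real mat"
  assumes n_pos: "0 < n"
    and A: "A \<in> carrier_mat n n" and B: "B \<in> carrier_mat n m"
    and Q: "pos_def n Q" and R: "pos_def m R"
begin

abbreviation gain :: "real \<Rightarrow> real mat \<Rightarrow> real mat" where "gain \<equiv> lq_gain A B R"

lemma closed_loop_carrier: "K \<in> carrier_mat m n \<Longrightarrow> A - B * K \<in> carrier_mat n n"
  using B by auto

lemma closed_loop_mult_vec:
  assumes "K \<in> carrier_mat m n" "v \<in> carrier_vec n"
  shows "(A - B * K) *\<^sub>v v = A *\<^sub>v v - B *\<^sub>v (K *\<^sub>v v)"
  using assms A B by (simp add: minus_mult_distrib_mat_vec[of _ n n] assoc_mult_mat_vec[of _ n m _ n])

section \<open>The greedy gain and completion of squares\<close>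

lemma pos_def_input_weight:
  assumes P: "sym_mat n P" "\<And>v. v \<in> carrier_vec n \<Longrightarrow> 0 \<le> qform P v"
  shows "pos_def m (R + g\<^sup>2 \<cdot>\<^sub>m (B\<^sup>T * P * B))"
proof (rule pos_defI)
  have S: "sym_mat m (B\<^sup>T * P * B)" using P(1) B by (rule sym_mat_congruence)
  show "sym_mat m (R + g\<^sup>2 \<cdot>\<^sub>m (B\<^sup>T * P * B))"
    by (intro sym_mat_add sym_mat_smult S pos_defD(1)[OF R])
  fix w :: "real vec" assume w: "w \<in> carrier_vec m" "w \<noteq> 0\<^sub>v m"
  have "qform (R + g\<^sup>2 \<cdot>\<^sub>m (B\<^sup>T * P * B)) w = qform R w + g\<^sup>2 * qform P (B *\<^sub>v w)"
    using w(1) sym_matD(1)[OF S] pos_defD(2)[OF R] sym_matD(1)[OF P(1)] B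
    by (simp add: bform_add_mat[of _ m m] bform_smult_mat[of _ m m] bform_congruence'[of B n m _ n B m])
  moreover have "0 \<le> qform P (B *\<^sub>v w)" using P(2) B w(1) by auto
  ultimately show "0 < qform (R + g\<^sup>2 \<cdot>\<^sub>m (B\<^sup>T * P * B)) w"
    using pos_defD(3)[OF R w] by (simp add: add_pos_nonneg)
qed

lemma gain_carrier:
  assumes P: "sym_mat n P" "\<And>v. v \<in> carrier_vec n \<Longrightarrow> 0 \<le> qform P v"
  shows "gain g P \<in> carrier_mat m n"
  unfolding lq_gain_def
  using pos_def_minv(1)[OF pos_def_input_weight[OF P, of g]] A B sym_matD(1)[OF P(1)]
  by (intro smult_carrier_mat mult_carrier_mat[of _ m m]) auto

lemma gain_input_weight:
  assumes P: "sym_mat n P" "\<And>v. v \<in> carrier_vec n \<Longrightarrow> 0 \<le> qform P v"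
    and v: "v \<in> carrier_vec n" and w: "w \<in> carrier_vec m"
  shows "bform (R + g\<^sup>2 \<cdot>\<^sub>m (B\<^sup>T * P * B)) w (gain g P *\<^sub>v v) = g\<^sup>2 * bform P (B *\<^sub>v w) (A *\<^sub>v v)"
proof -
  note cP = sym_matD(1)[OF P(1)]
  define T where "T = R + g\<^sup>2 \<cdot>\<^sub>m (B\<^sup>T * P * B)"
  note T = pos_def_input_weight[OF P, of g, folded T_def] and cK = gain_carrier[OF P, of g]
  have L: "A\<^sup>T * P * B \<in> carrier_mat n m" using A B cP by auto
  have "T * gain g P = g\<^sup>2 \<cdot>\<^sub>m (T * minv T * (A\<^sup>T * P * B)\<^sup>T)"
    unfolding lq_gain_def T_def[symmetric] using pos_defD(2)[OF T] pos_def_minv(1)[OF T] L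
    by (simp add: mult_smult_distrib[of _ m m _ n] assoc_mult_mat[of _ m m _ m _ n])
  also have "\<dots> = g\<^sup>2 \<cdot>\<^sub>m (A\<^sup>T * P * B)\<^sup>T"
    using pos_def_minv(3)[OF T] L by (simp add: left_mult_one_mat[of _ m n])
  finally have TK: "T * gain g P = g\<^sup>2 \<cdot>\<^sub>m (A\<^sup>T * P * B)\<^sup>T" .
  have "bform T w (gain g P *\<^sub>v v) = bform (T * gain g P) w v"
    using bform_mult[OF pos_defD(2)[OF T] cK w v] by simp
  also have "\<dots> = g\<^sup>2 * bform (A\<^sup>T * P * B)\<^sup>T w v"
    unfolding TK using L v w by (simp add: bform_smult_mat[of _ m n])
  also have "bform (A\<^sup>T * P * B)\<^sup>T w v = bform P (A *\<^sub>v v) (B *\<^sub>v w)"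
    using L v w A B cP by (simp add: bform_transpose[of _ n m] bform_congruence'[of A n n P n B m])
  also have "\<dots> = bform P (B *\<^sub>v w) (A *\<^sub>v v)"
    using A B v w by (intro bform_sym[OF P(1)]) auto
  finally show ?thesis unfolding T_def .
qed

text \<open>First-order optimality: \<open>z = K v\<close> is the critical point of
  \<open>z \<mapsto> g^2 * qform P (A v - B z) + qform R z\<close>, and \<open>w\<close> is the
  direction of variation.\<close>

lemma gain_stationary:
  assumes P: "sym_mat n P" "\<And>v. v \<in> carrier_vec n \<Longrightarrow> 0 \<le> qform P v"
    and v: "v \<in> carrier_vec n" and w: "w \<in> carrier_vec m"
  shows "bform R w (gain g P *\<^sub>v v) = g\<^sup>2 * bform P (B *\<^sub>v w) (A *\<^sub>v v - B *\<^sub>v (gain g P *\<^sub>v v))"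
proof -
  note cP = sym_matD(1)[OF P(1)]
  have Kv: "gain g P *\<^sub>v v \<in> carrier_vec m" by (rule mult_mat_vec_carrier[OF gain_carrier[OF P] v])
  have "bform (R + g\<^sup>2 \<cdot>\<^sub>m (B\<^sup>T * P * B)) w (gain g P *\<^sub>v v) =
      bform R w (gain g P *\<^sub>v v) + g\<^sup>2 * bform P (B *\<^sub>v w) (B *\<^sub>v (gain g P *\<^sub>v v))"
    using Kv w B cP pos_defD(2)[OF R]
    by (simp add: bform_add_mat[of _ m m] bform_smult_mat[of _ m m] bform_congruence'[of B n m P n B m])
  moreover have "A *\<^sub>v v \<in> carrier_vec n" "B *\<^sub>v w \<in> carrier_vec n" "B *\<^sub>v (gain g P *\<^sub>v v) \<in> carrier_vec n"
    using A B v w Kv by auto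
  ultimately show ?thesis
    using gain_input_weight[OF P v w, of g] cP
    by (simp add: bform_minus_right[of P n n] right_diff_distrib)
qed

text \<open>With \<open>z = K v + d\<close> the terms linear in \<open>d\<close> cancel by
  \<open>gain_stationary\<close>, which leaves a nonnegative quadratic remainder. Both policy
  improvement and the comparison of Riccati solutions rest on this identity.\<close>

lemma completion_of_squares:
  assumes P: "sym_mat n P" "\<And>v. v \<in> carrier_vec n \<Longrightarrow> 0 \<le> qform P v"
    and v: "v \<in> carrier_vec n" and z: "z \<in> carrier_vec m"
  shows "g\<^sup>2 * qform P (A *\<^sub>v v - B *\<^sub>v z) + qform R z =
    g\<^sup>2 * qform P (A *\<^sub>v v - B *\<^sub>v (gain g P *\<^sub>v v)) + qform R (gain g P *\<^sub>v v)
    + (qform R (z - gain g P *\<^sub>v v) + g\<^sup>2 * qform P (B *\<^sub>v (z - gain g P *\<^sub>v v)))"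
proof -
  define y where "y = gain g P *\<^sub>v v"
  define d where "d = z - y"
  define a where "a = A *\<^sub>v v - B *\<^sub>v y"
  note sR = pos_defD(1)[OF R]
  have y: "y \<in> carrier_vec m" unfolding y_def by (rule mult_mat_vec_carrier[OF gain_carrier[OF P] v])
  have d: "d \<in> carrier_vec m" unfolding d_def using y z by auto
  have a: "a \<in> carrier_vec n" unfolding a_def using A B v y by auto
  have Bd: "B *\<^sub>v d \<in> carrier_vec n" using B d by auto
  have zd: "z = y + d" unfolding d_def using y z by auto
  have "B *\<^sub>v z = B *\<^sub>v y + B *\<^sub>v d" unfolding zd using B y d by (rule mult_add_distrib_mat_vec)
  moreover have "A *\<^sub>v v \<in> carrier_vec n" "B *\<^sub>v y \<in> carrier_vec n" using A B v y by auto
  ultimately have ad: "A *\<^sub>v v - B *\<^sub>v z = a - B *\<^sub>v d"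
    unfolding a_def using Bd by (intro eq_vecI) auto
  have "bform R d y = g\<^sup>2 * bform P (B *\<^sub>v d) a"
    unfolding y_def a_def using gain_stationary[OF P v d] .
  then have qR: "qform R (y + d) = qform R y + 2 * (g\<^sup>2 * bform P (B *\<^sub>v d) a) + qform R d"
    using qform_add[OF sR y d] bform_sym[OF sR y d] by simp
  have qP: "qform P (a - B *\<^sub>v d) = qform P a - 2 * bform P (B *\<^sub>v d) a + qform P (B *\<^sub>v d)"
    using qform_minus[OF P(1) a Bd] bform_sym[OF P(1) a Bd] by simp
  have "g\<^sup>2 * qform P (a - B *\<^sub>v d) + qform R (y + d) =
      g\<^sup>2 * qform P a + qform R y + (qform R d + g\<^sup>2 * qform P (B *\<^sub>v d))"
    unfolding qR qP by (simp add: algebra_simps)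
  then show ?thesis unfolding zd[symmetric] ad[symmetric] unfolding a_def d_def y_def .
qed

text \<open>\<open>qform P\<close> is the cost of the feedback \<open>K\<close> for the scaled pair
  \<open>(g A, g B)\<close>. The equation is stated on vectors, which for symmetric matrices is
  equivalent to the matrix identity and lets completion of squares apply directly.\<close>

definition lyapunov :: "real \<Rightarrow> real mat \<Rightarrow> real mat \<Rightarrow> bool" where
  "lyapunov g K P \<longleftrightarrow> pos_def n P \<and> (\<forall>v\<in>carrier_vec n.
     qform P v = g\<^sup>2 * qform P (A *\<^sub>v v - B *\<^sub>v (K *\<^sub>v v)) + qform Q v + qform R (K *\<^sub>v v))"

lemma lyapunovD:
  assumes "lyapunov g K P"
  shows "pos_def n P" "sym_mat n P" "\<And>v. v \<in> carrier_vec n \<Longrightarrow> 0 \<le> qform P v"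
    "v \<in> carrier_vec n \<Longrightarrow>
      qform P v = g\<^sup>2 * qform P (A *\<^sub>v v - B *\<^sub>v (K *\<^sub>v v)) + qform Q v + qform R (K *\<^sub>v v)"
  using assms pos_defD[of n P] unfolding lyapunov_def by auto

lemma qform_input_nonneg: "K \<in> carrier_mat m n \<Longrightarrow> v \<in> carrier_vec n \<Longrightarrow> 0 \<le> qform R (K *\<^sub>v v)"
  using pos_defD(4)[OF R] by auto

text \<open>The old gain enters as a competitor: \<open>completion_of_squares\<close> at
  \<open>z = K v\<close> bounds the one-step cost of the new gain by that of the old one, which is
  \<open>qform P v\<close> by the Lyapunov equation.\<close>

lemma policy_improvement:
  assumes P: "lyapunov g K P" and K: "K \<in> carrier_mat m n" and v: "v \<in> carrier_vec n"
  shows "g\<^sup>2 * qform P (A *\<^sub>v v - B *\<^sub>v (gain g P *\<^sub>v v)) + qform Q v + qform R (gain g P *\<^sub>v v) \<le> qform P v"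
proof -
  have Kv: "K *\<^sub>v v \<in> carrier_vec m" using K v by auto
  have d: "K *\<^sub>v v - gain g P *\<^sub>v v \<in> carrier_vec m"
    using Kv mult_mat_vec_carrier[OF gain_carrier[OF lyapunovD(2,3)[OF P]] v] by auto
  then have "B *\<^sub>v (K *\<^sub>v v - gain g P *\<^sub>v v) \<in> carrier_vec n" using B by auto
  then have "0 \<le> qform R (K *\<^sub>v v - gain g P *\<^sub>v v) + g\<^sup>2 * qform P (B *\<^sub>v (K *\<^sub>v v - gain g P *\<^sub>v v))"
    using pos_defD(4)[OF R d] lyapunovD(3)[OF P] by simp
  then show ?thesis
    using completion_of_squares[OF lyapunovD(2,3)[OF P] v Kv, of g] lyapunovD(4)[OF P v] by simp
qed

text \<open>A decrease is enough, so the criterion also covers the improved gain, for which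
  \<open>P\<close> is in general not the exact cost.\<close>

lemma stable_of_decrease:
  assumes P: "pos_def n P" and K: "K \<in> carrier_mat m n"
    and le: "\<And>v. v \<in> carrier_vec n \<Longrightarrow>
      qform P (A *\<^sub>v v - B *\<^sub>v (K *\<^sub>v v)) + qform Q v + qform R (K *\<^sub>v v) \<le> qform P v"
  shows "rho (A - B * K) < 1"
proof -
  have "rho (A - B * K) < 1 / 1"
  proof (rule rho_lessI_qform[OF n_pos closed_loop_carrier[OF K] P])
    fix v :: "real vec" assume v: "v \<in> carrier_vec n" "v \<noteq> 0\<^sub>v n"
    then show "1\<^sup>2 * qform P ((A - B * K) *\<^sub>v v) < qform P v"
      using le[OF v(1)] pos_defD(3)[OF Q v] qform_input_nonneg[OF K v(1)]
      by (simp add: closed_loop_mult_vec[OF K])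
  qed simp
  then show ?thesis by simp
qed

lemma lyapunov_stable:
  assumes P: "lyapunov 1 K P" and K: "K \<in> carrier_mat m n"
  shows "rho (A - B * K) < 1"
  using lyapunovD(4)[OF P] by (intro stable_of_decrease[OF lyapunovD(1)[OF P] K]) simp

text \<open>The hypothesis says that \<open>P' - P\<close> does not increase along the stable closed
  loop of \<open>K\<close>. Cost matrices of different gains are compared in this way along one
  common loop.\<close>

lemma qform_le_of_closed_loop:
  assumes P: "P \<in> carrier_mat n n" "P' \<in> carrier_mat n n" and K: "K \<in> carrier_mat m n"
    and rho: "rho (A - B * K) < 1"
    and le: "\<And>v. v \<in> carrier_vec n \<Longrightarrow> qform P v - qform P (A *\<^sub>v v - B *\<^sub>v (K *\<^sub>v v))
      \<le> qform P' v - qform P' (A *\<^sub>v v - B *\<^sub>v (K *\<^sub>v v))"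
    and v: "v \<in> carrier_vec n"
  shows "qform P v \<le> qform P' v"
proof -
  have D: "qform (P' - P) y = qform P' y - qform P y" if "y \<in> carrier_vec n" for y
    using that P by (simp add: bform_minus_mat[of _ n n])
  have "0 \<le> qform (P' - P) v"
  proof (rule qform_nonneg_of_stable[OF n_pos closed_loop_carrier[OF K] rho _ _ v])
    fix v :: "real vec" assume v: "v \<in> carrier_vec n"
    have "A *\<^sub>v v - B *\<^sub>v (K *\<^sub>v v) \<in> carrier_vec n" using A B K v by auto
    then show "qform (P' - P) ((A - B * K) *\<^sub>v v) \<le> qform (P' - P) v"
      unfolding closed_loop_mult_vec[OF K v] using le[OF v] D v by simp
  qed (use P in auto)
  then show ?thesis using D[OF v] by simp
qed

section \<open>Riccati solutions as fixed points of policy improvement\<close>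

lemma riccati_gain:
  assumes P: "sym_mat n P" "\<And>v. v \<in> carrier_vec n \<Longrightarrow> 0 \<le> qform P v"
  shows "minv (R + B\<^sup>T * P * B) * B\<^sup>T * P * A = gain 1 P"
    and "A\<^sup>T * P * B * minv (R + B\<^sup>T * P * B) * B\<^sup>T * P * A = A\<^sup>T * P * (B * gain 1 P)"
proof -
  note cP = sym_matD[OF P(1)]
  have one: "1 \<cdot>\<^sub>m M = M" for M :: "real mat" by (rule eq_matI) auto
  have inv: "minv (R + B\<^sup>T * P * B) \<in> carrier_mat m m"
    using pos_def_minv(1)[OF pos_def_input_weight[OF P, of 1]] by (simp add: one)
  have "(A\<^sup>T * P * B)\<^sup>T = B\<^sup>T * (A\<^sup>T * P)\<^sup>T" using A B cP by (intro transpose_mult) auto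
  also have "(A\<^sup>T * P)\<^sup>T = P * A" using A cP by (subst transpose_mult) auto
  finally show *: "minv (R + B\<^sup>T * P * B) * B\<^sup>T * P * A = gain 1 P"
    unfolding lq_gain_def using inv A B cP
    by (simp add: one assoc_mult_mat[of _ m m _ n _ n] assoc_mult_mat[of _ m n _ n _ n])
  have "A\<^sup>T * P * B * minv (R + B\<^sup>T * P * B) * B\<^sup>T * P * A =
      A\<^sup>T * P * B * (minv (R + B\<^sup>T * P * B) * B\<^sup>T * P * A)"
    using inv A B cP
    by (simp add: assoc_mult_mat[of _ n m _ m _ n] assoc_mult_mat[of _ n m _ n _ n]
      assoc_mult_mat[of _ m n _ n _ n] assoc_mult_mat[of _ m m _ n _ n])
  also have "\<dots> = A\<^sup>T * P * (B * gain 1 P)"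
    unfolding * using A B cP gain_carrier[OF P] by (intro assoc_mult_mat[of _ n n _ m _ n]) auto
  finally show "A\<^sup>T * P * B * minv (R + B\<^sup>T * P * B) * B\<^sup>T * P * A = A\<^sup>T * P * (B * gain 1 P)" .
qed

lemma riccati_iff_lyapunov:
  assumes P: "pos_def n P"
  shows "A\<^sup>T * P * A - P - A\<^sup>T * P * B * minv (R + B\<^sup>T * P * B) * B\<^sup>T * P * A = - Q
    \<longleftrightarrow> lyapunov 1 (gain 1 P) P"
proof -
  note sP = pos_defD(1)[OF P] and cP = pos_defD(2)[OF P] and psd = pos_defD(4)[OF P]
  note sQ = pos_defD(1)[OF Q] and cQ = pos_defD(2)[OF Q]
  define K where "K = gain 1 P"
  note K = gain_carrier[OF sP psd, of 1, folded K_def]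
  have BK: "B * K \<in> carrier_mat n n" using B K by auto
  define X where "X = A\<^sup>T * P * A - P - A\<^sup>T * P * (B * K)"
  have cX: "X \<in> carrier_mat n n" 
    unfolding X_def using A cP by (intro minus_carrier_mat mult_carrier_mat[OF _ BK]) auto
  have vecs: "A *\<^sub>v v \<in> carrier_vec n" "K *\<^sub>v v \<in> carrier_vec m" "B *\<^sub>v (K *\<^sub>v v) \<in> carrier_vec n"
    "A *\<^sub>v v - B *\<^sub>v (K *\<^sub>v v) \<in> carrier_vec n"
    if "v \<in> carrier_vec n" for v using that A B K by auto
  have bX: "bform X v w = bform P (A *\<^sub>v v) (A *\<^sub>v w) - bform P v w - bform P (A *\<^sub>v v) (B *\<^sub>v (K *\<^sub>v w))"
    if "v \<in> carrier_vec n" "w \<in> carrier_vec n" for v w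
  proof -
    have c: "A\<^sup>T * P * A \<in> carrier_mat n n" "A\<^sup>T * P * (B * K) \<in> carrier_mat n n"
      using A cP by (auto intro!: mult_carrier_mat[OF _ BK])
    then have "A\<^sup>T * P * A - P \<in> carrier_mat n n" using cP by auto
    then have "bform X v w = bform (A\<^sup>T * P * A) v w - bform P v w - bform (A\<^sup>T * P * (B * K)) v w"
      unfolding X_def using bform_minus_mat[OF _ c(2) that] bform_minus_mat[OF c(1) cP that] by simp
    then show ?thesis
      using bform_congruence[OF A cP A that] bform_congruence[OF A cP BK that] B K that
      by (simp add: assoc_mult_mat_vec[of B n m K n])
  qed
  \<comment> \<open>By \<open>gain_input_weight\<close> both sides are the value of the symmetric
    form \<open>R + B^T P B\<close> at \<open>K v\<close> and \<open>K w\<close>. This makes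
    \<open>X\<close> symmetric, hence determined by its quadratic form.\<close>
  have symK: "bform P (A *\<^sub>v v) (B *\<^sub>v (K *\<^sub>v w)) = bform P (A *\<^sub>v w) (B *\<^sub>v (K *\<^sub>v v))"
    if v: "v \<in> carrier_vec n" and w: "w \<in> carrier_vec n" for v w
    using gain_input_weight[OF sP psd v vecs(2)[OF w], of 1]
      gain_input_weight[OF sP psd w vecs(2)[OF v], of 1]
      bform_sym[OF pos_defD(1)[OF pos_def_input_weight[OF sP psd, of 1]] vecs(2)[OF v] vecs(2)[OF w]]
      bform_sym[OF sP vecs(1)[OF v] vecs(3)[OF w]] bform_sym[OF sP vecs(1)[OF w] vecs(3)[OF v]]
    unfolding K_def[symmetric] by simp
  have sX: "sym_mat n X"
  proof (rule sym_matI_bform[OF cX])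
    fix v w :: "real vec" assume v: "v \<in> carrier_vec n" and w: "w \<in> carrier_vec n"
    show "bform X v w = bform X w v"
      unfolding bX[OF v w] bX[OF w v] symK[OF v w]
      using bform_sym[OF sP v w] bform_sym[OF sP vecs(1)[OF v] vecs(1)[OF w]] by simp
  qed
  \<comment> \<open>Stationarity in the direction \<open>K v\<close> expresses the input cost
    through \<open>P\<close>; the closed-loop cost then collapses to the terms that occur in
    \<open>bX\<close>.\<close>
  have quad: "qform P (A *\<^sub>v v - B *\<^sub>v (K *\<^sub>v v)) + qform R (K *\<^sub>v v) =
      qform P (A *\<^sub>v v) - bform P (A *\<^sub>v v) (B *\<^sub>v (K *\<^sub>v v))" if v: "v \<in> carrier_vec n" for v
  proof -
    have "qform R (K *\<^sub>v v) = bform P (B *\<^sub>v (K *\<^sub>v v)) (A *\<^sub>v v - B *\<^sub>v (K *\<^sub>v v))"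
      using gain_stationary[OF sP psd v vecs(2)[OF v], of 1] unfolding K_def[symmetric] by simp
    also have "\<dots> = bform P (A *\<^sub>v v) (B *\<^sub>v (K *\<^sub>v v)) - qform P (B *\<^sub>v (K *\<^sub>v v))"
      using bform_minus_right[OF cP vecs(3)[OF v] vecs(1)[OF v] vecs(3)[OF v]]
        bform_sym[OF sP vecs(1)[OF v] vecs(3)[OF v]] by simp
    finally show ?thesis using qform_minus[OF sP vecs(1)[OF v] vecs(3)[OF v]] by simp
  qed
  have "X = - Q \<longleftrightarrow> (\<forall>v\<in>carrier_vec n. qform X v = qform (- Q) v)"
    using sym_mat_eqI_qform[OF sX sym_mat_uminus[OF sQ]] by auto
  also have "\<dots> \<longleftrightarrow> (\<forall>v\<in>carrier_vec n. qform P v =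
      qform P (A *\<^sub>v v - B *\<^sub>v (K *\<^sub>v v)) + qform Q v + qform R (K *\<^sub>v v))"
  proof (intro ball_cong refl)
    fix v :: "real vec" assume v: "v \<in> carrier_vec n"
    show "qform X v = qform (- Q) v \<longleftrightarrow>
        qform P v = qform P (A *\<^sub>v v - B *\<^sub>v (K *\<^sub>v v)) + qform Q v + qform R (K *\<^sub>v v)"
      unfolding bX[OF v v] bform_uminus_mat[OF cQ v v] using quad[OF v] by linarith
  qed
  also have "\<dots> \<longleftrightarrow> lyapunov 1 K P" using P by (simp add: lyapunov_def)
  finally have "A\<^sup>T * P * A - P - A\<^sup>T * P * (B * gain 1 P) = - Q \<longleftrightarrow> lyapunov 1 (gain 1 P) P"
    unfolding X_def K_def .
  moreover have "A\<^sup>T * P * B * minv (R + B\<^sup>T * P * B) * B\<^sup>T * P * A = A\<^sup>T * P * (B * gain 1 P)"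
    by (rule riccati_gain(2)[OF sP psd])
  ultimately show ?thesis by (simp only:)
qed

text \<open>Both matrices are compared along the stable loop of \<open>gain 1 P'\<close>. There
  \<open>P'\<close> satisfies its equation exactly, while for \<open>P\<close> this gain is merely a
  competitor, so completion of squares leaves a deficit of the right sign. Exchanging the roles
  gives uniqueness.\<close>

lemma riccati_solution_le:
  assumes P: "lyapunov 1 (gain 1 P) P" and P': "lyapunov 1 (gain 1 P') P'" and v: "v \<in> carrier_vec n"
  shows "qform P v \<le> qform P' v"
proof -
  let ?K = "gain 1 P" and ?K' = "gain 1 P'"
  note psd = lyapunovD(2,3)[OF P] and psd' = lyapunovD(2,3)[OF P']
  have K: "?K \<in> carrier_mat m n" "?K' \<in> carrier_mat m n"
    using gain_carrier[OF psd] gain_carrier[OF psd'] by auto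
  show ?thesis
  proof (rule qform_le_of_closed_loop[OF _ _ K(2) lyapunov_stable[OF P' K(2)] _ v])
    fix v :: "real vec" assume v: "v \<in> carrier_vec n"
    have Kv: "?K *\<^sub>v v \<in> carrier_vec m" "?K' *\<^sub>v v \<in> carrier_vec m" using K v by auto
    then have d: "?K' *\<^sub>v v - ?K *\<^sub>v v \<in> carrier_vec m" by auto
    then have "B *\<^sub>v (?K' *\<^sub>v v - ?K *\<^sub>v v) \<in> carrier_vec n" using B by auto
    then have "0 \<le> qform R (?K' *\<^sub>v v - ?K *\<^sub>v v) + qform P (B *\<^sub>v (?K' *\<^sub>v v - ?K *\<^sub>v v))"
      using pos_defD(4)[OF R d] psd(2) by simp
    then show "qform P v - qform P (A *\<^sub>v v - B *\<^sub>v (?K' *\<^sub>v v))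
        \<le> qform P' v - qform P' (A *\<^sub>v v - B *\<^sub>v (?K' *\<^sub>v v))"
      using completion_of_squares[OF psd v Kv(2), of 1] lyapunovD(4)[OF P v] lyapunovD(4)[OF P' v] by simp
  qed (use sym_matD(1) psd(1) psd'(1) in auto)
qed

lemma riccati_sol_eq:
  assumes P: "lyapunov 1 (gain 1 P) P"
  shows "riccati_sol A B Q R = P"
  unfolding riccati_sol_def
proof (rule the_equality)
  have dim: "dim_row A = n" using A by simp
  show "pos_def (dim_row A) P \<and>
      A\<^sup>T * P * A - P - A\<^sup>T * P * B * minv (R + B\<^sup>T * P * B) * B\<^sup>T * P * A = - Q"
    using P riccati_iff_lyapunov lyapunovD(1)[OF P] dim by simp
  fix P' assume P': "pos_def (dim_row A) P' \<and>
      A\<^sup>T * P' * A - P' - A\<^sup>T * P' * B * minv (R + B\<^sup>T * P' * B) * B\<^sup>T * P' * A = - Q"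
  then have L: "lyapunov 1 (gain 1 P') P'" using riccati_iff_lyapunov[of P'] unfolding dim by blast
  show "P' = P"
    using riccati_solution_le[OF P L] riccati_solution_le[OF L P]
    by (intro sym_mat_eqI_qform[OF lyapunovD(2)[OF L] lyapunovD(2)[OF P]] antisym)
qed

section \<open>Solvability and uniqueness of the Lyapunov equation of a gain\<close>

lemma lyapunov_exists:
  assumes K: "K \<in> carrier_mat m n" and g: "0 < g" and rho: "rho (A - B * K) < 1 / g"
  obtains P where "lyapunov g K P"
proof -
  let ?M = "g \<cdot>\<^sub>m (A - B * K)" and ?W = "Q + K\<^sup>T * R * K"
  note cl = closed_loop_carrier[OF K] and sR = pos_defD(1)[OF R] and sQ = pos_defD(1)[OF Q]
  have M: "?M \<in> carrier_mat n n" using cl by (rule smult_carrier_mat)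
  have rhoM: "rho ?M < 1" by (rule rho_smult_less_1[OF n_pos cl g rho])
  have W: "sym_mat n ?W" by (intro sym_mat_add sym_mat_congruence[OF sR K] sQ)
  obtain P where P: "sym_mat n P"
    and fixpoint: "\<And>v. v \<in> carrier_vec n \<Longrightarrow> qform P v = qform P (?M *\<^sub>v v) + qform ?W v"
    using lyapunov_solution_exists[OF n_pos M rhoM W] by blast
  have qW: "qform ?W v = qform Q v + qform R (K *\<^sub>v v)" if "v \<in> carrier_vec n" for v
    using that K sym_matD(1)[OF sR] sym_matD(1)[OF sQ]
    by (simp add: bform_add_mat[of _ n n] bform_congruence'[of K m n R m K n])
  have qM: "qform P (?M *\<^sub>v v) = g\<^sup>2 * qform P (A *\<^sub>v v - B *\<^sub>v (K *\<^sub>v v))" if v: "v \<in> carrier_vec n" for v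
  proof -
    have "A *\<^sub>v v - B *\<^sub>v (K *\<^sub>v v) \<in> carrier_vec n" using A B K v by auto
    then show ?thesis
      unfolding smult_mat_mult_vec[OF cl v] closed_loop_mult_vec[OF K v]
      by (rule qform_smult[OF sym_matD(1)[OF P]])
  qed
  have W_nonneg: "0 \<le> qform ?W v" if "v \<in> carrier_vec n" for v
    using qW[OF that] pos_defD(4)[OF Q that] qform_input_nonneg[OF K that] by simp
  \<comment> \<open>The source term is nonnegative, so \<open>P\<close> does not increase along the
    stable scaled loop; strict positivity then comes from \<open>Q\<close>.\<close>
  have nonneg: "0 \<le> qform P v" if "v \<in> carrier_vec n" for v
    using fixpoint W_nonneg by (intro qform_nonneg_of_stable[OF n_pos M rhoM sym_matD(1)[OF P] _ that]) simp
  have "pos_def n P"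
  proof (rule pos_defI[OF P])
    fix v :: "real vec" assume v: "v \<in> carrier_vec n" "v \<noteq> 0\<^sub>v n"
    have "0 \<le> qform P (?M *\<^sub>v v)" using nonneg M v(1) by auto
    then show "0 < qform P v"
      using fixpoint[OF v(1)] qW[OF v(1)] pos_defD(3)[OF Q v] qform_input_nonneg[OF K v(1)] by simp
  qed
  then have "lyapunov g K P" using fixpoint qW qM by (simp add: lyapunov_def)
  then show ?thesis using that by blast
qed

text \<open>The form is invariant under the stable matrix \<open>g (A - B K)\<close>, so the orbit
  argument applies to \<open>P\<close> and to \<open>- P\<close>. This is the part of the
  injectivity of \<open>psi\<close> that depends on the spectral bound.\<close>

lemma homogeneous_lyapunov_zero:
  assumes K: "K \<in> carrier_mat m n" and g: "0 < g" and rho: "rho (A - B * K) < 1 / g"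
    and P: "sym_mat n P"
    and eq: "\<And>v. v \<in> carrier_vec n \<Longrightarrow> qform P v = g\<^sup>2 * qform P (A *\<^sub>v v - B *\<^sub>v (K *\<^sub>v v))"
  shows "P = 0\<^sub>m n n"
proof -
  let ?M = "g \<cdot>\<^sub>m (A - B * K)"
  note cl = closed_loop_carrier[OF K] and cP = sym_matD(1)[OF P]
  have M: "?M \<in> carrier_mat n n" using cl by (rule smult_carrier_mat)
  have rhoM: "rho ?M < 1" by (rule rho_smult_less_1[OF n_pos cl g rho])
  have inv: "qform P (?M *\<^sub>v v) = qform P v" if v: "v \<in> carrier_vec n" for v
  proof -
    have "A *\<^sub>v v - B *\<^sub>v (K *\<^sub>v v) \<in> carrier_vec n" using A B K v by auto
    then show ?thesis
      unfolding smult_mat_mult_vec[OF cl v] closed_loop_mult_vec[OF K v] eq[OF v]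
      by (rule qform_smult[OF cP])
  qed
  have "qform P v = 0" if v: "v \<in> carrier_vec n" for v
  proof (rule antisym)
    show "0 \<le> qform P v" using inv by (intro qform_nonneg_of_stable[OF n_pos M rhoM cP _ v]) simp
    have "0 \<le> qform (- P) v"
    proof (rule qform_nonneg_of_stable[OF n_pos M rhoM _ _ v])
      fix v :: "real vec" assume v: "v \<in> carrier_vec n"
      then have "?M *\<^sub>v v \<in> carrier_vec n" using M by auto
      then show "qform (- P) (?M *\<^sub>v v) \<le> qform (- P) v"
        using inv[OF v] v by (simp add: bform_uminus_mat[OF cP])
    qed (use cP in auto)
    then show "qform P v \<le> 0" using v by (simp add: bform_uminus_mat[OF cP])
  qed
  then show ?thesis
    by (intro sym_mat_eqI_qform[OF P]) (auto simp: sym_mat_def bform_zero_mat)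
qed

text \<open>The premise \<open>step\<close> is conditional because least-squares evaluation is
  justified only at a stabilizing gain; stability is therefore carried through an induction before
  any cost matrix is used.\<close>

lemma policy_iteration_converges:
  assumes K0: "K 0 \<in> carrier_mat m n" "rho (A - B * K 0) < 1"
    and step: "\<And>i. K i \<in> carrier_mat m n \<Longrightarrow> rho (A - B * K i) < 1
      \<Longrightarrow> lyapunov 1 (K i) (P i) \<and> K (Suc i) = gain 1 (P i)"
  shows "mat_tendsto n n P (riccati_sol A B Q R)" "mat_tendsto m n K (optimal_gain A B Q R)"
proof -
  have stable: "K i \<in> carrier_mat m n \<and> rho (A - B * K i) < 1" for i
  proof (induction i)
    case 0
    then show ?case using K0 by simp
  next
    case (Suc i)
    then have L: "lyapunov 1 (K i) (P i)" and K: "K (Suc i) = gain 1 (P i)" using step by auto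
    have c: "K (Suc i) \<in> carrier_mat m n" unfolding K by (rule gain_carrier[OF lyapunovD(2,3)[OF L]])
    moreover have "rho (A - B * K (Suc i)) < 1"
      using policy_improvement[OF L] Suc
      by (intro stable_of_decrease[OF lyapunovD(1)[OF L] c]) (simp add: K)
    ultimately show ?case by simp
  qed
  then have cK: "K i \<in> carrier_mat m n" and L: "lyapunov 1 (K i) (P i)"
    and K: "K (Suc i) = gain 1 (P i)" for i using step by auto
  note sP = lyapunovD(2)[OF L] and psd = lyapunovD(3)[OF L]
  note cP = sym_matD(1)[OF sP]
  \<comment> \<open>Both costs are compared along the loop of \<open>K (Suc i)\<close>: for
    \<open>P (Suc i)\<close> the Lyapunov equation holds there, for \<open>P i\<close> the
    inequality of policy improvement.\<close>
  have decr: "qform (P (Suc i)) v \<le> qform (P i) v" if v: "v \<in> carrier_vec n" for i v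
  proof (rule qform_le_of_closed_loop[OF cP cP cK _ _ v])
    show "rho (A - B * K (Suc i)) < 1" using stable by blast
    fix v :: "real vec" assume v: "v \<in> carrier_vec n"
    show "qform (P (Suc i)) v - qform (P (Suc i)) (A *\<^sub>v v - B *\<^sub>v (K (Suc i) *\<^sub>v v))
        \<le> qform (P i) v - qform (P i) (A *\<^sub>v v - B *\<^sub>v (K (Suc i) *\<^sub>v v))"
      using lyapunovD(4)[OF L[of "Suc i"] v] policy_improvement[OF L[of i] cK v] by (simp add: K)
  qed
  have conv: "convergent (\<lambda>i. qform (P i) v)" if v: "v \<in> carrier_vec n" for v
  proof -
    have "decseq (\<lambda>i. qform (P i) v)" using decr[OF v] by (simp add: decseq_Suc_iff)
    then obtain l where "(\<lambda>i. qform (P i) v) \<longlonglongrightarrow> l"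
      using decseq_convergent[of "\<lambda>i. qform (P i) v" 0] psd[OF v] by blast
    then show ?thesis by (rule convergentI)
  qed
  obtain S where S: "sym_mat n S" and limP: "mat_tendsto n n P S"
    using sym_mat_limit[OF sP conv] .
  note cS = sym_matD(1)[OF S]
  \<comment> \<open>A limit of positive definite matrices is a priori only semidefinite; the uniform
    lower bound \<open>Q\<close> keeps \<open>S\<close> definite.\<close>
  have S_ge: "qform Q v \<le> qform S v" if v: "v \<in> carrier_vec n" for v
  proof (rule LIMSEQ_le_const[OF tendsto_bform[OF limP cP v v]])
    have "qform Q v \<le> qform (P i) v" for i
    proof -
      have "A *\<^sub>v v - B *\<^sub>v (K i *\<^sub>v v) \<in> carrier_vec n" using A B cK[of i] v by auto
      then show ?thesis
        using lyapunovD(4)[OF L[of i] v] psd qform_input_nonneg[OF cK v, of i] by simp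
    qed
    then show "\<exists>N. \<forall>i\<ge>N. qform Q v \<le> qform (P i) v" by blast
  qed
  have pdS: "pos_def n S"
    using S_ge pos_defD(3)[OF Q] by (intro pos_defI[OF S]) (meson less_le_trans)
  note psdS = pos_defD(4)[OF pdS]
  define K' where "K' = gain 1 S"
  have one: "1\<^sup>2 \<cdot>\<^sub>m M = M" for M :: "real mat" by (rule eq_matI) auto
  have "mat_tendsto m n (\<lambda>i. minv (R + B\<^sup>T * P i * B) * (A\<^sup>T * P i * B)\<^sup>T)
      (minv (R + B\<^sup>T * S * B) * (A\<^sup>T * S * B)\<^sup>T)"
  proof (rule mat_tendsto_mult)
    have tB: "mat_tendsto m m (\<lambda>i. B\<^sup>T * P i * B) (B\<^sup>T * S * B)"
      using B cP by (intro mat_tendsto_mult[of _ n] mat_tendsto_const limP) auto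
    have tT: "mat_tendsto m m (\<lambda>i. R + B\<^sup>T * P i * B) (R + B\<^sup>T * S * B)"
      using B cP pos_defD(2)[OF R] by (intro mat_tendsto_add mat_tendsto_const tB) auto
    have pd: "pos_def m (R + B\<^sup>T * P i * B)" for i
      using pos_def_input_weight[of "P i" 1] sP psd unfolding one by blast
    have pdl: "pos_def m (R + B\<^sup>T * S * B)"
      using pos_def_input_weight[of S 1] S psdS unfolding one by blast
    show "mat_tendsto m m (\<lambda>i. minv (R + B\<^sup>T * P i * B)) (minv (R + B\<^sup>T * S * B))"
      by (rule mat_tendsto_minv[OF tT pos_defD(2)[OF pd] pos_def_det[OF pd] pos_def_det[OF pdl]])
    show "minv (R + B\<^sup>T * P i * B) \<in> carrier_mat m m" for i by (rule pos_def_minv(1)[OF pd])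
    have tA: "mat_tendsto n m (\<lambda>i. A\<^sup>T * P i * B) (A\<^sup>T * S * B)"
      using A B cP by (intro mat_tendsto_mult[of _ n] mat_tendsto_const limP) auto
    show "mat_tendsto m n (\<lambda>i. (A\<^sup>T * P i * B)\<^sup>T) (A\<^sup>T * S * B)\<^sup>T"
      using A B cP by (intro mat_tendsto_transpose tA) auto
    show "(A\<^sup>T * P i * B)\<^sup>T \<in> carrier_mat m n" for i using A B cP by auto
  qed
  then have "mat_tendsto m n (\<lambda>i. K (Suc i)) K'" unfolding K K'_def lq_gain_def one .
  \<comment> \<open>The gain lags one index behind its cost, and shifting the index does not change
    the limit.\<close>
  then have limK: "mat_tendsto m n K K'" by (simp only: mat_tendsto_Suc)
  note cK' = mat_tendsto_carrier[OF limK]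
  have "qform S v = qform S (A *\<^sub>v v - B *\<^sub>v (K' *\<^sub>v v)) + qform Q v + qform R (K' *\<^sub>v v)"
    if v: "v \<in> carrier_vec n" for v
  proof (rule LIMSEQ_unique[OF tendsto_bform[OF limP cP v v]])
    have cl: "A - B * K i \<in> carrier_mat n n" for i by (rule closed_loop_carrier[OF cK])
    have tcl: "mat_tendsto n n (\<lambda>i. A - B * K i) (A - B * K')"
      using A B cK by (intro mat_tendsto_minus mat_tendsto_mult[of _ m] mat_tendsto_const limK) auto
    \<comment> \<open>The argument \<open>A v - B (K i v)\<close> varies with \<open>i\<close>.
      Moving the closed loop into the matrix by congruence leaves fixed vectors, to which
      \<open>tendsto_bform\<close> applies.\<close>
    have tq: "mat_tendsto n n (\<lambda>i. (A - B * K i)\<^sup>T * P i * (A - B * K i)) ((A - B * K')\<^sup>T * S * (A - B * K'))"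
      using cl cP
      by (intro mat_tendsto_mult[of n n] mat_tendsto_transpose tcl limP) (auto intro: mult_carrier_mat[of _ n n])
    have tr: "mat_tendsto n n (\<lambda>i. (K i)\<^sup>T * R * K i) (K'\<^sup>T * R * K')"
      using cK pos_defD(2)[OF R]
      by (intro mat_tendsto_mult[of n m] mat_tendsto_transpose mat_tendsto_const limK)
        (auto intro: mult_carrier_mat[of _ n m])
    have "(\<lambda>i. qform ((A - B * K i)\<^sup>T * P i * (A - B * K i)) v + qform Q v + qform ((K i)\<^sup>T * R * K i) v)
        \<longlonglongrightarrow> qform ((A - B * K')\<^sup>T * S * (A - B * K')) v + qform Q v + qform (K'\<^sup>T * R * K') v"
    proof (intro tendsto_add tendsto_const tendsto_bform[OF tq _ v v] tendsto_bform[OF tr _ v v])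
      show "(A - B * K i)\<^sup>T * P i * (A - B * K i) \<in> carrier_mat n n" for i
        using sym_matD(1)[OF sym_mat_congruence[OF sP cl]] .
      show "(K i)\<^sup>T * R * K i \<in> carrier_mat n n" for i
        using sym_matD(1)[OF sym_mat_congruence[OF pos_defD(1)[OF R] cK]] .
    qed
    moreover have "qform ((A - B * F)\<^sup>T * X * (A - B * F)) v + qform Q v + qform (F\<^sup>T * R * F) v =
        qform X (A *\<^sub>v v - B *\<^sub>v (F *\<^sub>v v)) + qform Q v + qform R (F *\<^sub>v v)"
      if "F \<in> carrier_mat m n" "X \<in> carrier_mat n n" for F X
      using bform_congruence[OF closed_loop_carrier[OF that(1)] that(2) closed_loop_carrier[OF that(1)] v v]
        bform_congruence[OF that(1) pos_defD(2)[OF R] that(1) v v]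
        closed_loop_mult_vec[OF that(1) v] by simp
    ultimately have "(\<lambda>i. qform (P i) (A *\<^sub>v v - B *\<^sub>v (K i *\<^sub>v v)) + qform Q v + qform R (K i *\<^sub>v v))
        \<longlonglongrightarrow> qform S (A *\<^sub>v v - B *\<^sub>v (K' *\<^sub>v v)) + qform Q v + qform R (K' *\<^sub>v v)"
      using cK cP cK' cS by simp
    then show "(\<lambda>i. qform (P i) v) \<longlonglongrightarrow>
        qform S (A *\<^sub>v v - B *\<^sub>v (K' *\<^sub>v v)) + qform Q v + qform R (K' *\<^sub>v v)"
      using lyapunovD(4)[OF L v] by simp
  qed
  \<comment> \<open>\<open>K'\<close> is both the limit of the gains and the gain of
    \<open>S\<close>, so the limit of the Lyapunov equations is the Riccati equation for
    \<open>S\<close>.\<close>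
  then have LS: "lyapunov 1 (gain 1 S) S" using pdS by (simp add: lyapunov_def K'_def)
  show "mat_tendsto n n P (riccati_sol A B Q R)" using limP riccati_sol_eq[OF LS] by simp
  show "mat_tendsto m n K (optimal_gain A B Q R)"
    using limK riccati_gain(1)[OF S psdS]
    by (simp add: optimal_gain_def riccati_sol_eq[OF LS] K'_def)
qed

end

section \<open>Recovering the iterates from data\<close>

lemma vecs_zero: "vecs (0\<^sub>m n n) = 0\<^sub>v (tri n)"
proof (rule eq_vecI)
  fix i assume "i < dim_vec (0\<^sub>v (tri n) :: real vec)"
  then have i: "i < length (upper_pairs n)" by (simp add: length_upper_pairs)
  then have "upper_pairs n ! i \<in> set (upper_pairs n)" by (rule nth_mem)
  then show "vecs (0\<^sub>m n n) $ i = 0\<^sub>v (tri n) $ i"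
    using i unfolding vecs_def
    by (auto simp: vec_of_list_index set_upper_pairs length_upper_pairs simp del: vec_of_list_map)
qed (simp add: vecs_def length_upper_pairs del: vec_of_list_map)

lemma vec_stack_zero: "vec_stack (0\<^sub>m n m) = 0\<^sub>v (m * n)"
proof (rule eq_vecI)
  fix i assume "i < dim_vec (0\<^sub>v (m * n) :: real vec)"
  then have i: "i < m * n" by simp
  then have "0 < n" by (cases n) auto
  then show "vec_stack (0\<^sub>m n m) $ i = 0\<^sub>v (m * n) $ i"
    using i by (simp add: vec_stack_def less_mult_imp_div_less mult.commute)
qed (simp add: vec_stack_def)

lemma append_zero_vec: "0\<^sub>v r @\<^sub>v 0\<^sub>v c = (0\<^sub>v (r + c) :: 'a :: zero vec)"
  by (rule eq_vecI) auto

text \<open>The left side counts the columns of \<open>[Xi5, Xi3, Xi4]\<close>, so the rank in the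
  data condition is the full column rank of that matrix.\<close>

lemma tri_add: "tri n + (m * n + tri m) = (n + m) * (n + m + 1) div 2"
proof -
  have "2 * tri i = i * (i + 1)" for i
    unfolding tri_def by (simp add: algebra_simps)
  from this[of n] this[of m] have "2 * (tri n + (m * n + tri m)) = (n + m) * (n + m + 1)"
    by (simp add: algebra_simps)
  then show ?thesis by simp
qed

locale sampled_lq = lq_problem n m A B Q R
  for n m :: nat and A B Q R :: "real mat" +
  fixes s :: nat and x u :: "nat \<Rightarrow> real vec" and k :: "nat \<Rightarrow> nat"
  assumes x: "l \<le> s \<Longrightarrow> x (k l) \<in> carrier_vec n"
    and u: "l \<le> s \<Longrightarrow> u (k l) \<in> carrier_vec m"
    and dynamics: "l \<le> s \<Longrightarrow> x (k l + 1) = A *\<^sub>v x (k l) + B *\<^sub>v u (k l)"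
    and rank: "vec_space.rank (Suc s) (Xi2 n x k s @\<^sub>c Xi3 n m x u k s @\<^sub>c Xi4 m u k s)
      = (n + m) * (n + m + 1) div 2"
begin

lemma x_next: "l \<le> s \<Longrightarrow> x (k l + 1) \<in> carrier_vec n"
  using dynamics A B x u by auto

lemma Xi_carrier:
  "Xi1 n x k s \<in> carrier_mat (Suc s) (tri n)" "Xi2 n x k s \<in> carrier_mat (Suc s) (n * n)"
  "Xi3 n m x u k s \<in> carrier_mat (Suc s) (m * n)" "Xi4 m u k s \<in> carrier_mat (Suc s) (tri m)"
  "Xi5 n x k s \<in> carrier_mat (Suc s) (tri n)" "Xi6 m x k s K \<in> carrier_mat (Suc s) (tri m)"
  by (auto simp: Xi1_def Xi2_def Xi3_def Xi4_def Xi5_def Xi6_def)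

text \<open>\<open>Xi2\<close> runs over all ordered pairs of coordinates and \<open>Xi5\<close>
  over those with \<open>i \<le> j\<close>; products commute, so both list the same columns
  \<open>c i j\<close>. Sets suffice because the rank is the dimension of the span of the
  columns.\<close>

lemma set_cols_Xi2_Xi5: "set (cols (Xi2 n x k s)) = set (cols (Xi5 n x k s))"
proof -
  define c where "c = (\<lambda>i j. vec (Suc s) (\<lambda>l. x (k l) $ i * x (k l) $ j))"
  have c_sym: "c i j = c j i" for i j by (simp add: c_def mult.commute)
  have kron: "(v \<otimes>\<^sub>v v) $ p = v $ (p div n) * v $ (p mod n)" if "v \<in> carrier_vec n" "p < n * n" for v p
    using that by (auto simp: kron_vec_def)
  have col2: "col (Xi2 n x k s) p = c (p div n) (p mod n)" if p: "p < n * n" for p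
    using p x by (intro eq_vecI) (auto simp: Xi2_def c_def kron)
  have vecv: "vecv v $ p = v $ fst (upper_pairs n ! p) * v $ snd (upper_pairs n ! p)"
    if "v \<in> carrier_vec n" "p < tri n" for v p
    using that
    by (simp add: vecv_def vec_of_list_index length_upper_pairs split_def del: vec_of_list_map)
  have col5: "col (Xi5 n x k s) p = c (fst (upper_pairs n ! p)) (snd (upper_pairs n ! p))" if p: "p < tri n" for p
    using p x
    by (intro eq_vecI) (auto simp: Xi5_def c_def vecv)
  have "set (cols (Xi2 n x k s)) = (\<lambda>p. c (p div n) (p mod n)) ` {..<n * n}"
    using col2 Xi_carrier(2) by (auto simp: cols_def atLeast0LessThan)
  also have "\<dots> = (\<lambda>(i, j). c i j) ` ({..<n} \<times> {..<n})"
  proof (intro equalityI subsetI)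
    fix y assume "y \<in> (\<lambda>p. c (p div n) (p mod n)) ` {..<n * n}"
    then show "y \<in> (\<lambda>(i, j). c i j) ` ({..<n} \<times> {..<n})"
      using n_pos by (auto simp: less_mult_imp_div_less intro!: image_eqI[where x = "(_, _)"])
  next
    fix y assume "y \<in> (\<lambda>(i, j). c i j) ` ({..<n} \<times> {..<n})"
    then obtain i j where y: "y = c i j" and ij: "i < n" "j < n" by auto
    have "i * n + j < Suc i * n" using ij by simp
    also have "\<dots> \<le> n * n" using ij by (intro mult_le_mono1) auto
    finally show "y \<in> (\<lambda>p. c (p div n) (p mod n)) ` {..<n * n}"
      using y ij by (intro image_eqI[of _ _ "i * n + j"]) auto
  qed
  also have "\<dots> = (\<lambda>(i, j). c i j) ` set (upper_pairs n)"
  proof (intro equalityI subsetI)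
    fix y assume "y \<in> (\<lambda>(i, j). c i j) ` ({..<n} \<times> {..<n})"
    then obtain i j where y: "y = c i j" and ij: "i < n" "j < n" by auto
    then have "y = c (min i j) (max i j)" using c_sym by (auto simp: min_def max_def)
    then show "y \<in> (\<lambda>(i, j). c i j) ` set (upper_pairs n)"
      using ij by (intro image_eqI[of _ _ "(min i j, max i j)"]) (auto simp: set_upper_pairs)
  qed (auto simp: set_upper_pairs)
  also have "\<dots> = (\<lambda>p. c (fst (upper_pairs n ! p)) (snd (upper_pairs n ! p))) ` {..<tri n}"
    unfolding set_conv_nth length_upper_pairs by (auto simp: image_iff split_def)
  also have "\<dots> = set (cols (Xi5 n x k s))"
    using col5 Xi_carrier(5) by (auto simp: cols_def atLeast0LessThan)
  finally show ?thesis .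
qed

text \<open>Passing from \<open>\<Xi>\<^sub>2\<close> to \<open>\<Xi>\<^sub>5\<close> only removes repeated columns, so the rank condition says that
  \<open>[\<Xi>\<^sub>5, \<Xi>\<^sub>3, \<Xi>\<^sub>4]\<close> has full column rank.\<close>

lemma data_determine_quadratic_form:
  assumes M: "sym_mat n M" and N: "N \<in> carrier_mat n m" and S: "sym_mat m S"
    and zero: "\<And>l. l \<le> s \<Longrightarrow> qform M (x (k l)) + bform N (x (k l)) (u (k l)) + qform S (u (k l)) = 0"
  shows "M = 0\<^sub>m n n" "N = 0\<^sub>m n m" "S = 0\<^sub>m m m"
proof -
  let ?E = "Xi5 n x k s @\<^sub>c (Xi3 n m x u k s @\<^sub>c Xi4 m u k s)"
  let ?z = "vecs M @\<^sub>v (vec_stack N @\<^sub>v vecs S)"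
  have c34: "Xi3 n m x u k s @\<^sub>c Xi4 m u k s \<in> carrier_mat (Suc s) (m * n + tri m)"
    by (intro hcat_carrier Xi_carrier)
  have E: "?E \<in> carrier_mat (Suc s) (tri n + (m * n + tri m))"
    by (intro hcat_carrier Xi_carrier)
  have "set (cols ?E) = set (cols (Xi2 n x k s @\<^sub>c Xi3 n m x u k s @\<^sub>c Xi4 m u k s))"
    unfolding cols_hcat[OF Xi_carrier(5) c34] cols_hcat[OF Xi_carrier(2) c34] set_append
      set_cols_Xi2_Xi5 ..
  then have rankE: "vec_space.rank (Suc s) ?E = tri n + (m * n + tri m)"
    using rank unfolding vec_space.rank_def tri_add by simp
  note zc = vecs_carrier[OF M] vec_stack_carrier[OF N] vecs_carrier[OF S]
  have z: "?z \<in> carrier_vec (tri n + (m * n + tri m))" using zc by (intro append_carrier_vec)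
  have "?E *\<^sub>v ?z = 0\<^sub>v (Suc s)"
  proof (rule eq_vecI)
    fix l assume "l < dim_vec (0\<^sub>v (Suc s) :: real vec)"
    then have l: "l < Suc s" "l \<le> s" by auto
    note xl = x[OF l(2)] and ul = u[OF l(2)]
    have "?E *\<^sub>v ?z = Xi5 n x k s *\<^sub>v vecs M + (Xi3 n m x u k s *\<^sub>v vec_stack N + Xi4 m u k s *\<^sub>v vecs S)"
      using hcat_mult_append[OF Xi_carrier(5) c34 zc(1) append_carrier_vec[OF zc(2,3)]]
        hcat_mult_append[OF Xi_carrier(3,4) zc(2,3)] by simp
    also have "\<dots> $ l = vecv (x (k l)) \<bullet> vecs M + ((u (k l) \<otimes>\<^sub>v x (k l)) \<bullet> vec_stack N + vecv (u (k l)) \<bullet> vecs S)"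
      using l Xi_carrier(3,4) unfolding Xi3_def Xi4_def Xi5_def
      by (simp add: mat_row_fun_mult_entry vecv_carrier[OF xl] vecv_carrier[OF ul] kron_vec_carrier[OF ul xl]
        del: index_mult_mat_vec)
    also have "\<dots> = 0"
      using zero[OF l(2)] vecv_scalar_prod_vecs[OF M xl] vecv_scalar_prod_vecs[OF S ul]
        kron_vec_scalar_prod_vec_stack[OF N ul xl] by simp
    finally show "(?E *\<^sub>v ?z) $ l = 0\<^sub>v (Suc s) $ l" using l by simp
  qed (use E in auto)
  then have "?z = 0\<^sub>v (tri n + (m * n + tri m))"
    by (rule vec_space.full_rank_kernel_trivial[OF E rankE z])
  also have "\<dots> = vecs (0\<^sub>m n n) @\<^sub>v (vec_stack (0\<^sub>m n m) @\<^sub>v vecs (0\<^sub>m m m))"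
    by (simp add: vecs_zero vec_stack_zero append_zero_vec)
  finally have eq: "vecs M = vecs (0\<^sub>m n n)" "vec_stack N = vec_stack (0\<^sub>m n m)" "vecs S = vecs (0\<^sub>m m m)"
    using zc by (simp_all add: append_vec_eq[of _ "tri n"] append_vec_eq[of _ "m * n"] vecs_zero vec_stack_zero)
  have zero_sym: "sym_mat i (0\<^sub>m i i)" for i by (auto simp: sym_mat_def)
  show "M = 0\<^sub>m n n" by (rule vecs_inject[OF M zero_sym eq(1)])
  show "N = 0\<^sub>m n m" by (rule vec_stack_inject[OF N _ eq(2)]) auto
  show "S = 0\<^sub>m m m" by (rule vecs_inject[OF S zero_sym eq(3)])
qed

section \<open>The regression system as quadratic forms in state and input\<close>

lemma row_Xi2_kron:
  assumes K: "K \<in> carrier_mat m n" and l: "l \<le> s"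
  shows "row (Xi2 n x k s * (K\<^sup>T \<otimes>\<^sub>m 1\<^sub>m n)) l = (K *\<^sub>v x (k l)) \<otimes>\<^sub>v x (k l)"
proof (rule eq_vecI)
  have kr: "K\<^sup>T \<otimes>\<^sub>m 1\<^sub>m n \<in> carrier_mat (n * n) (m * n)"
    using K by (intro kron_mat_carrier) auto
  have Kx: "(K *\<^sub>v x (k l)) \<otimes>\<^sub>v x (k l) \<in> carrier_vec (m * n)"
    using K x[OF l] by (intro kron_vec_carrier) auto
  have row2: "row (Xi2 n x k s) l = x (k l) \<otimes>\<^sub>v x (k l)"
    using l kron_vec_carrier[OF x[OF l] x[OF l]] by (simp add: Xi2_def)
  fix q assume "q < dim_vec ((K *\<^sub>v x (k l)) \<otimes>\<^sub>v x (k l))"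
  then have q: "q < m * n" using Kx by simp
  then have "row (Xi2 n x k s * (K\<^sup>T \<otimes>\<^sub>m 1\<^sub>m n)) l $ q = row (Xi2 n x k s) l \<bullet> col (K\<^sup>T \<otimes>\<^sub>m 1\<^sub>m n) q"
    using kr l Xi_carrier(2) by simp
  also have "\<dots> = ((K *\<^sub>v x (k l)) \<otimes>\<^sub>v x (k l)) $ q"
    unfolding row2 by (rule kron_vec_mult_kron_mat[OF K x[OF l] x[OF l] q])
  finally show "row (Xi2 n x k s * (K\<^sup>T \<otimes>\<^sub>m 1\<^sub>m n)) l $ q = ((K *\<^sub>v x (k l)) \<otimes>\<^sub>v x (k l)) $ q" .
qed (use K x[OF l] in \<open>auto simp: kron_vec_def kron_mat_def\<close>)

lemma psi_blocks_carrier: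
  assumes K: "K \<in> carrier_mat m n"
  shows "Xi1 n x k s - (1 / g\<^sup>2 - 1) \<cdot>\<^sub>m Xi5 n x k s \<in> carrier_mat (Suc s) (tri n)"
    and "K\<^sup>T \<otimes>\<^sub>m 1\<^sub>m n \<in> carrier_mat (n * n) (m * n)"
    and "Xi2 n x k s * (K\<^sup>T \<otimes>\<^sub>m 1\<^sub>m n) \<in> carrier_mat (Suc s) (m * n)"
    and "(- 2) \<cdot>\<^sub>m (Xi2 n x k s * (K\<^sup>T \<otimes>\<^sub>m 1\<^sub>m n)) - 2 \<cdot>\<^sub>m Xi3 n m x u k s \<in> carrier_mat (Suc s) (m * n)"
    and "- Xi4 m u k s + Xi6 m x k s K \<in> carrier_mat (Suc s) (tri m)"
    and "psi n m x u k s g K \<in> carrier_mat (Suc s) (tri n + (m * n + tri m))"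
proof -
  show 1: "Xi1 n x k s - (1 / g\<^sup>2 - 1) \<cdot>\<^sub>m Xi5 n x k s \<in> carrier_mat (Suc s) (tri n)"
    using Xi_carrier by (intro minus_carrier_mat smult_carrier_mat)
  show kr: "K\<^sup>T \<otimes>\<^sub>m 1\<^sub>m n \<in> carrier_mat (n * n) (m * n)"
    using K by (intro kron_mat_carrier) auto
  show "Xi2 n x k s * (K\<^sup>T \<otimes>\<^sub>m 1\<^sub>m n) \<in> carrier_mat (Suc s) (m * n)"
    by (rule mult_carrier_mat[OF Xi_carrier(2) kr])
  show 2: "(- 2) \<cdot>\<^sub>m (Xi2 n x k s * (K\<^sup>T \<otimes>\<^sub>m 1\<^sub>m n)) - 2 \<cdot>\<^sub>m Xi3 n m x u k s \<in> carrier_mat (Suc s) (m * n)"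
    using Xi_carrier(3) by (intro minus_carrier_mat smult_carrier_mat)
  show 3: "- Xi4 m u k s + Xi6 m x k s K \<in> carrier_mat (Suc s) (tri m)"
    using Xi_carrier(6) by (intro add_carrier_mat)
  show "psi n m x u k s g K \<in> carrier_mat (Suc s) (tri n + (m * n + tri m))"
    unfolding psi_def by (intro hcat_carrier 1 2 3)
qed

text \<open>\<open>dynamics\<close> replaces the next state by \<open>A v + B w\<close>, so each row
  becomes a quadratic form in state and input whose coefficients depend on the unknown matrices.
  This is the shape to which the rank condition applies.\<close>

lemma psi_mult_entry:
  assumes K: "K \<in> carrier_mat m n" and P: "sym_mat n P" and L1: "L1 \<in> carrier_mat n m" and L2: "sym_mat m L2"
    and l: "l \<le> s"
  defines "v \<equiv> x (k l)" and "w \<equiv> u (k l)"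
  shows "(psi n m x u k s g K *\<^sub>v (vecs P @\<^sub>v vec_stack L1 @\<^sub>v vecs L2)) $ l =
    qform P (A *\<^sub>v v + B *\<^sub>v w) - 1 / g\<^sup>2 * qform P v
    - 2 * bform L1 v (K *\<^sub>v v) - 2 * bform L1 v w - qform L2 w + qform L2 (K *\<^sub>v v)"
proof -
  note vc = x[OF l, folded v_def] and wc = u[OF l, folded w_def] and nc = x_next[OF l]
  have Kv: "K *\<^sub>v v \<in> carrier_vec m" using K vc by auto
  have ls: "l < Suc s" using l by simp
  note C = psi_blocks_carrier[OF K] and zc = vecs_carrier[OF P] vec_stack_carrier[OF L1] vecs_carrier[OF L2]
  let ?F1 = "Xi1 n x k s - (1 / g\<^sup>2 - 1) \<cdot>\<^sub>m Xi5 n x k s"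
  let ?F2 = "(- 2) \<cdot>\<^sub>m (Xi2 n x k s * (K\<^sup>T \<otimes>\<^sub>m 1\<^sub>m n)) - 2 \<cdot>\<^sub>m Xi3 n m x u k s"
  let ?F3 = "- Xi4 m u k s + Xi6 m x k s K"
  have split: "psi n m x u k s g K *\<^sub>v (vecs P @\<^sub>v vec_stack L1 @\<^sub>v vecs L2) =
      ?F1 *\<^sub>v vecs P + (?F2 *\<^sub>v vec_stack L1 + ?F3 *\<^sub>v vecs L2)"
    unfolding psi_def
      hcat_mult_append[OF C(1) hcat_carrier[OF C(4,5)] zc(1) append_carrier_vec[OF zc(2,3)]]
      hcat_mult_append[OF C(4,5) zc(2,3)] ..
  have entry: "(?F1 *\<^sub>v vecs P + (?F2 *\<^sub>v vec_stack L1 + ?F3 *\<^sub>v vecs L2)) $ l =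
      (?F1 *\<^sub>v vecs P) $ l + ((?F2 *\<^sub>v vec_stack L1) $ l + (?F3 *\<^sub>v vecs L2) $ l)"
    using ls by (simp add: carrier_matD(1)[OF Xi_carrier(3)] carrier_matD(1)[OF Xi_carrier(6)] del: index_mult_mat_vec)
  note nc' = nc[unfolded Suc_eq_plus1[symmetric]]
  have x1: "(Xi1 n x k s *\<^sub>v vecs P) $ l = qform P (A *\<^sub>v v + B *\<^sub>v w) - qform P v"
    unfolding Xi1_def v_def w_def using ls vecv_carrier[OF x[OF l]] vecv_carrier[OF nc'] zc(1)
    by (subst mat_row_fun_mult_entry)
      (auto simp: minus_scalar_prod_distrib[of _ "tri n"] vecv_scalar_prod_vecs[OF P nc']
        vecv_scalar_prod_vecs[OF P x[OF l]] dynamics[OF l, unfolded Suc_eq_plus1[symmetric], symmetric])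
  have x5: "(Xi5 n x k s *\<^sub>v vecs P) $ l = qform P v"
    unfolding Xi5_def v_def using ls vecv_carrier[OF x[OF l]]
    by (subst mat_row_fun_mult_entry) (auto simp: vecv_scalar_prod_vecs[OF P x[OF l]])
  have "(?F1 *\<^sub>v vecs P) $ l =
      (Xi1 n x k s *\<^sub>v vecs P) $ l - (1 / g\<^sup>2 - 1) * (Xi5 n x k s *\<^sub>v vecs P) $ l"
    unfolding minus_mult_distrib_mat_vec[OF Xi_carrier(1) smult_carrier_mat[OF Xi_carrier(5)] zc(1)]
      smult_mat_mult_vec[OF Xi_carrier(5) zc(1)]
    using ls by (simp add: carrier_matD(1)[OF Xi_carrier(5)] del: index_mult_mat_vec)
  then have f1: "(?F1 *\<^sub>v vecs P) $ l = qform P (A *\<^sub>v v + B *\<^sub>v w) - 1 / g\<^sup>2 * qform P v"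
    unfolding x1 x5 by (simp add: left_diff_distrib)
  have "((Xi2 n x k s * (K\<^sup>T \<otimes>\<^sub>m 1\<^sub>m n)) *\<^sub>v vec_stack L1) $ l = ((K *\<^sub>v v) \<otimes>\<^sub>v v) \<bullet> vec_stack L1"
    using ls C(3) unfolding v_def row_Xi2_kron[OF K l, symmetric] by (intro index_mult_mat_vec) auto
  then have x2: "((Xi2 n x k s * (K\<^sup>T \<otimes>\<^sub>m 1\<^sub>m n)) *\<^sub>v vec_stack L1) $ l = bform L1 v (K *\<^sub>v v)"
    unfolding kron_vec_scalar_prod_vec_stack[OF L1 Kv vc] .
  have x3: "(Xi3 n m x u k s *\<^sub>v vec_stack L1) $ l = bform L1 v w"
    unfolding Xi3_def using ls kron_vec_carrier[OF u[OF l] x[OF l]]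
    by (subst mat_row_fun_mult_entry)
      (auto simp: v_def w_def kron_vec_scalar_prod_vec_stack[OF L1 u[OF l] x[OF l]])
  have "(?F2 *\<^sub>v vec_stack L1) $ l =
      - 2 * ((Xi2 n x k s * (K\<^sup>T \<otimes>\<^sub>m 1\<^sub>m n)) *\<^sub>v vec_stack L1) $ l
      - 2 * (Xi3 n m x u k s *\<^sub>v vec_stack L1) $ l"
    unfolding minus_mult_distrib_mat_vec[OF smult_carrier_mat[OF C(3)] smult_carrier_mat[OF Xi_carrier(3)] zc(2)]
      smult_mat_mult_vec[OF C(3) zc(2)] smult_mat_mult_vec[OF Xi_carrier(3) zc(2)]
    using ls by (simp add: carrier_matD(1)[OF Xi_carrier(2)] carrier_matD(1)[OF Xi_carrier(3)]
      del: index_mult_mat_vec)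
  then have f2: "(?F2 *\<^sub>v vec_stack L1) $ l = - 2 * bform L1 v (K *\<^sub>v v) - 2 * bform L1 v w"
    unfolding x2 x3 .
  have x4: "(Xi4 m u k s *\<^sub>v vecs L2) $ l = qform L2 w"
    unfolding Xi4_def w_def using ls vecv_carrier[OF u[OF l]]
    by (subst mat_row_fun_mult_entry) (auto simp: vecv_scalar_prod_vecs[OF L2 u[OF l]])
  have x6: "(Xi6 m x k s K *\<^sub>v vecs L2) $ l = qform L2 (K *\<^sub>v v)"
    unfolding Xi6_def using ls vecv_carrier[OF Kv]
    by (subst mat_row_fun_mult_entry) (auto simp: vecv_scalar_prod_vecs[OF L2 Kv, unfolded v_def] v_def)
  have um: "(- Xi4 m u k s) *\<^sub>v vecs L2 = - (Xi4 m u k s *\<^sub>v vecs L2)"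
    using Xi_carrier(4) zc(3) by auto
  have "(?F3 *\<^sub>v vecs L2) $ l = - (Xi4 m u k s *\<^sub>v vecs L2) $ l + (Xi6 m x k s K *\<^sub>v vecs L2) $ l"
    unfolding add_mult_distrib_mat_vec[OF uminus_carrier_mat[OF Xi_carrier(4)] Xi_carrier(6) zc(3)] um
    using ls by (simp add: carrier_matD(1)[OF Xi_carrier(4)] carrier_matD(1)[OF Xi_carrier(6)]
      del: index_mult_mat_vec)
  then have f3: "(?F3 *\<^sub>v vecs L2) $ l = - qform L2 w + qform L2 (K *\<^sub>v v)"
    unfolding x4 x6 .
  show ?thesis unfolding split entry f1 f2 f3 by simp
qed

lemma phi_entry:
  assumes K: "K \<in> carrier_mat m n" and l: "l \<le> s"
  shows "phi n x k s Q R g K $ l = - 1 / g\<^sup>2 * (qform Q (x (k l)) + qform R (K *\<^sub>v x (k l)))"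
proof -
  note sK = sym_mat_congruence[OF pos_defD(1)[OF R] K] and sQ = pos_defD(1)[OF Q]
  have W: "sym_mat n (- Q - K\<^sup>T * R * K)" by (intro sym_mat_minus sym_mat_uminus sK sQ)
  have "qform (- Q - K\<^sup>T * R * K) (x (k l)) = - qform Q (x (k l)) - qform R (K *\<^sub>v x (k l))"
    using bform_minus_mat[OF sym_matD(1)[OF sym_mat_uminus[OF sQ]] sym_matD(1)[OF sK] x[OF l] x[OF l]]
      bform_uminus_mat[OF sym_matD(1)[OF sQ] x[OF l] x[OF l]]
      bform_congruence[OF K pos_defD(2)[OF R] K x[OF l] x[OF l]] by simp
  moreover have "(Xi5 n x k s *\<^sub>v vecs (- Q - K\<^sup>T * R * K)) $ l = qform (- Q - K\<^sup>T * R * K) (x (k l))"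
    unfolding Xi5_def using l vecv_carrier[OF x[OF l]]
    by (subst mat_row_fun_mult_entry) (auto simp: vecv_scalar_prod_vecs[OF W x[OF l]])
  moreover have "phi n x k s Q R g K $ l = 1 / g\<^sup>2 * (Xi5 n x k s *\<^sub>v vecs (- Q - K\<^sup>T * R * K)) $ l"
    unfolding phi_def using l Xi_carrier(5) by (simp del: index_mult_mat_vec)
  ultimately have "phi n x k s Q R g K $ l = 1 / g\<^sup>2 * (- qform Q (x (k l)) - qform R (K *\<^sub>v x (k l)))"
    by (simp only:)
  then show ?thesis by (simp add: algebra_simps)
qed

text \<open>For a kernel vector \<open>(P, L1, L2)\<close> a quadratic form vanishes on the data,
  hence identically. Its mixed and input coefficients force \<open>L1 = A^T P B\<close> and
  \<open>L2 = B^T P B\<close>; the state coefficient then turns into a homogeneous Lyapunov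
  equation, and stability gives \<open>P = 0\<close>.\<close>

lemma psi_kernel_trivial:
  assumes K: "K \<in> carrier_mat m n" and g: "0 < g" and rho: "rho (A - B * K) < 1 / g"
    and z: "z \<in> carrier_vec (tri n + (m * n + tri m))" and ker: "psi n m x u k s g K *\<^sub>v z = 0\<^sub>v (Suc s)"
  shows "z = 0\<^sub>v (tri n + (m * n + tri m))"
proof -
  obtain z1 z2 z3 where z_split: "z = z1 @\<^sub>v (z2 @\<^sub>v z3)"
    and zc: "z1 \<in> carrier_vec (tri n)" "z2 \<in> carrier_vec (m * n)" "z3 \<in> carrier_vec (tri m)"
  proof
    let ?y = "vec_last z (m * n + tri m)"
    show "z = vec_first z (tri n) @\<^sub>v (vec_first ?y (m * n) @\<^sub>v vec_last ?y (tri m))"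
      using z by simp
  qed auto
  obtain P where P: "sym_mat n P" "vecs P = z1" using vecs_surj[OF zc(1)] .
  obtain L1 where L1: "L1 \<in> carrier_mat n m" "vec_stack L1 = z2" using vec_stack_surj[OF zc(2)] .
  obtain L2 where L2: "sym_mat m L2" "vecs L2 = z3" using vecs_surj[OF zc(3)] .
  note cP = sym_matD(1)[OF P(1)] and cL2 = sym_matD(1)[OF L2(1)]
  \<comment> \<open>\<open>L1 * K\<close> need not be symmetric; \<open>H + H^T\<close> has twice
    its quadratic form and keeps \<open>M\<close> symmetric, as
    \<open>data_determine_quadratic_form\<close> requires.\<close>
  define H where "H = L1 * K"
  have H: "H \<in> carrier_mat n n" unfolding H_def using L1 K by auto
  have HT: "sym_mat n (H + H\<^sup>T)"
    using H by (auto simp: sym_mat_def transpose_add comm_add_mat[of "H\<^sup>T" n n H])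
  \<comment> \<open>\<open>M\<close>, \<open>N\<close> and \<open>S\<close> collect the state, mixed
    and input coefficients of the row computed in \<open>psi_mult_entry\<close>.\<close>
  define M where "M = A\<^sup>T * P * A - (1 / g\<^sup>2) \<cdot>\<^sub>m P - (H + H\<^sup>T) + K\<^sup>T * L2 * K"
  define N where "N = 2 \<cdot>\<^sub>m (A\<^sup>T * P * B - L1)"
  define S where "S = B\<^sup>T * P * B - L2"
  have sAPA: "sym_mat n (A\<^sup>T * P * A)" and sKLK: "sym_mat n (K\<^sup>T * L2 * K)" and sBPB: "sym_mat m (B\<^sup>T * P * B)"
    using sym_mat_congruence[OF P(1) A] sym_mat_congruence[OF L2(1) K] sym_mat_congruence[OF P(1) B] by auto
  have M: "sym_mat n M" unfolding M_def
    by (intro sym_mat_add sym_mat_minus sym_mat_smult sAPA sKLK HT P)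
  have cAPB: "A\<^sup>T * P * B \<in> carrier_mat n m" using A B cP by auto
  have N: "N \<in> carrier_mat n m" unfolding N_def using cAPB L1 by (intro smult_carrier_mat minus_carrier_mat)
  have S: "sym_mat m S" unfolding S_def by (intro sym_mat_minus sBPB L2)
  have qM: "qform M v = qform P (A *\<^sub>v v) - 1 / g\<^sup>2 * qform P v - 2 * bform L1 v (K *\<^sub>v v) + qform L2 (K *\<^sub>v v)"
    if v: "v \<in> carrier_vec n" for v
  proof -
    have s1: "sym_mat n (A\<^sup>T * P * A - (1 / g\<^sup>2) \<cdot>\<^sub>m P)" by (intro sym_mat_minus sym_mat_smult sAPA P)
    have s2: "sym_mat n (A\<^sup>T * P * A - (1 / g\<^sup>2) \<cdot>\<^sub>m P - (H + H\<^sup>T))" by (intro sym_mat_minus s1 HT)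
    have "qform M v = qform (A\<^sup>T * P * A) v - qform ((1 / g\<^sup>2) \<cdot>\<^sub>m P) v - (qform H v + qform H\<^sup>T v) + qform (K\<^sup>T * L2 * K) v"
      unfolding M_def
      using bform_add_mat[OF sym_matD(1)[OF s2] sym_matD(1)[OF sKLK] v v]
        bform_minus_mat[OF sym_matD(1)[OF s1] sym_matD(1)[OF HT] v v]
        bform_minus_mat[OF sym_matD(1)[OF sAPA] sym_matD(1)[OF sym_mat_smult[OF P(1)]] v v]
        bform_add_mat[OF H _ v v, of "H\<^sup>T"] H by simp
    then show ?thesis
      using bform_congruence[OF A cP A v v] bform_congruence[OF K cL2 K v v] bform_smult_mat[OF cP v v]
        bform_transpose[OF H v v] bform_mult[OF L1(1) K v v] by (simp add: H_def)
  qed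
  have bN: "bform N v w = 2 * (bform P (A *\<^sub>v v) (B *\<^sub>v w) - bform L1 v w)"
    if v: "v \<in> carrier_vec n" and w: "w \<in> carrier_vec m" for v w
    unfolding N_def
    using bform_smult_mat[OF minus_carrier_mat[OF L1(1)] v w] bform_minus_mat[OF cAPB L1(1) v w]
      bform_congruence[OF A cP B v w] by simp
  have qS: "qform S w = qform P (B *\<^sub>v w) - qform L2 w" if w: "w \<in> carrier_vec m" for w
    unfolding S_def
    using bform_minus_mat[OF sym_matD(1)[OF sBPB] cL2 w w] bform_congruence[OF B cP B w w] by simp
  have residual: "qform M (x (k l)) + bform N (x (k l)) (u (k l)) + qform S (u (k l)) = 0" if l: "l \<le> s" for l
  proof -
    have "(psi n m x u k s g K *\<^sub>v z) $ l = 0" using ker l by simp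
    moreover have "A *\<^sub>v x (k l) \<in> carrier_vec n" "B *\<^sub>v u (k l) \<in> carrier_vec n"
      using A B x[OF l] u[OF l] by auto
    ultimately show ?thesis
      using psi_mult_entry[OF K P(1) L1(1) L2(1) l, of g] qform_add[OF P(1)]
      unfolding qM[OF x[OF l]] bN[OF x[OF l] u[OF l]] qS[OF u[OF l]] z_split P(2) L1(2) L2(2)
      by simp
  qed
  have zero: "M = 0\<^sub>m n n" "N = 0\<^sub>m n m" "S = 0\<^sub>m m m"
    by (rule data_determine_quadratic_form(1)[OF M N S residual], assumption)
      (rule data_determine_quadratic_form(2)[OF M N S residual], assumption,
       rule data_determine_quadratic_form(3)[OF M N S residual], assumption)
  have bL1: "bform L1 v w = bform P (A *\<^sub>v v) (B *\<^sub>v w)"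
    if "v \<in> carrier_vec n" "w \<in> carrier_vec m" for v w
    using bN[OF that] that unfolding zero(2) by (simp add: bform_zero_mat)
  have qL2: "qform L2 w = qform P (B *\<^sub>v w)" if "w \<in> carrier_vec m" for w
    using qS[OF that] that unfolding zero(3) by (simp add: bform_zero_mat)
  have P0: "P = 0\<^sub>m n n"
  proof (rule homogeneous_lyapunov_zero[OF K g rho P(1)])
    fix v :: "real vec" assume v: "v \<in> carrier_vec n"
    have c: "K *\<^sub>v v \<in> carrier_vec m" "A *\<^sub>v v \<in> carrier_vec n" "B *\<^sub>v (K *\<^sub>v v) \<in> carrier_vec n"
      using A B K v by auto
    \<comment> \<open>Once \<open>L1\<close> and \<open>L2\<close> are expressed through
      \<open>P\<close>, the terms of \<open>qform M v\<close> other than the scaled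
      \<open>qform P v\<close> combine to the form at \<open>A v - B K v\<close>.\<close>
    have "1 / g\<^sup>2 * qform P v = qform P (A *\<^sub>v v - B *\<^sub>v (K *\<^sub>v v))"
      using qM[OF v] bL1[OF v c(1)] qL2[OF c(1)] qform_minus[OF P(1) c(2,3)] v
      unfolding zero(1) by (simp add: bform_zero_mat)
    then show "qform P v = g\<^sup>2 * qform P (A *\<^sub>v v - B *\<^sub>v (K *\<^sub>v v))"
      using g by (simp add: field_simps)
  qed
  have "L1 = 0\<^sub>m n m"
    using L1(1) A B by (intro mat_eqI_bform[of _ n m]) (auto simp: bL1 P0 bform_zero_mat)
  moreover have "L2 = 0\<^sub>m m m"
    using L2(1) B by (intro sym_mat_eqI_qform[of m]) (auto simp: qL2 P0 bform_zero_mat sym_mat_def)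
  ultimately show ?thesis
    unfolding z_split P(2)[symmetric] L1(2)[symmetric] L2(2)[symmetric] P0
    by (simp add: vecs_zero vec_stack_zero append_zero_vec)
qed

text \<open>Stability alone provides a cost matrix \<open>P'\<close> of the current gain, and the
  triple built from it solves the system exactly. The trivial kernel makes it the least-squares
  output, and injectivity of \<open>vecs\<close> and \<open>vec_stack\<close> identifies the given
  matrices with it.\<close>

lemma least_squares_lyapunov:
  assumes K: "K \<in> carrier_mat m n" and g: "0 < g" and rho: "rho (A - B * K) < 1 / g"
    and P: "sym_mat n P" and L1: "L1 \<in> carrier_mat n m" and L2: "sym_mat m L2"
    and eq: "vecs P @\<^sub>v vec_stack L1 @\<^sub>v vecs L2 =
      least_squares (psi n m x u k s g K) (phi n x k s Q R g K)"
  shows "lyapunov g K P" "L1 = A\<^sup>T * P * B" "L2 = B\<^sup>T * P * B"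
proof -
  obtain P' where lyap: "lyapunov g K P'" using lyapunov_exists[OF K g rho] .
  note sP' = lyapunovD(2)[OF lyap]
  note cP' = sym_matD(1)[OF sP']
  have N: "A\<^sup>T * P' * B \<in> carrier_mat n m" using A B cP' by auto
  have S: "sym_mat m (B\<^sup>T * P' * B)" by (rule sym_mat_congruence[OF sP' B])
  let ?z = "vecs P' @\<^sub>v vec_stack (A\<^sup>T * P' * B) @\<^sub>v vecs (B\<^sup>T * P' * B)"
  note zc = vecs_carrier[OF sP'] vec_stack_carrier[OF N] vecs_carrier[OF S]
  have z: "?z \<in> carrier_vec (tri n + (m * n + tri m))" using zc by (intro append_carrier_vec)
  have "psi n m x u k s g K *\<^sub>v ?z = phi n x k s Q R g K"
  proof (rule eq_vecI)
    fix l assume "l < dim_vec (phi n x k s Q R g K)"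
    then have l: "l \<le> s" using Xi_carrier(5) by (simp add: phi_def)
    let ?v = "x (k l)" and ?w = "u (k l)"
    note v = x[OF l] and w = u[OF l]
    have c: "A *\<^sub>v ?v \<in> carrier_vec n" "B *\<^sub>v ?w \<in> carrier_vec n" "K *\<^sub>v ?v \<in> carrier_vec m"
      "B *\<^sub>v (K *\<^sub>v ?v) \<in> carrier_vec n"
      using A B K v w by auto
    \<comment> \<open>The choices for \<open>L1\<close> and \<open>L2\<close> cancel every term
      containing the input sample \<open>?w\<close>; the remaining terms in \<open>K ?v\<close>
      complete the closed-loop form.\<close>
    have "(psi n m x u k s g K *\<^sub>v ?z) $ l = qform P' (A *\<^sub>v ?v - B *\<^sub>v (K *\<^sub>v ?v)) - 1 / g\<^sup>2 * qform P' ?v"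
      unfolding psi_mult_entry[OF K sP' N S l] bform_congruence[OF A cP' B v c(3)]
        bform_congruence[OF A cP' B v w] bform_congruence[OF B cP' B w w]
        bform_congruence[OF B cP' B c(3) c(3)] qform_add[OF sP' c(1,2)] qform_minus[OF sP' c(1,4)]
      by simp
    also have "\<dots> = - 1 / g\<^sup>2 * (qform Q ?v + qform R (K *\<^sub>v ?v))"
      unfolding lyapunovD(4)[OF lyap v] using g by (simp add: field_simps)
    finally show "(psi n m x u k s g K *\<^sub>v ?z) $ l = phi n x k s Q R g K $ l"
      unfolding phi_entry[OF K l] .
  qed (simp add: phi_def carrier_matD(1)[OF psi_blocks_carrier(6)[OF K]] carrier_matD(1)[OF Xi_carrier(5)])
  then have "least_squares (psi n m x u k s g K) (phi n x k s Q R g K) = ?z"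
    using least_squares_solution[OF psi_blocks_carrier(6)[OF K] z psi_kernel_trivial[OF K g rho]] by metis
  then have "vecs P @\<^sub>v (vec_stack L1 @\<^sub>v vecs L2) = ?z" using eq by simp
  then have "vecs P = vecs P'" "vec_stack L1 = vec_stack (A\<^sup>T * P' * B)" "vecs L2 = vecs (B\<^sup>T * P' * B)"
    using append_vec_eq[OF vecs_carrier[OF P] zc(1)] append_vec_eq[OF vec_stack_carrier[OF L1] zc(2)] by auto
  then have "P = P'" "L1 = A\<^sup>T * P' * B" "L2 = B\<^sup>T * P' * B"
    using vecs_inject[OF P sP'] vec_stack_inject[OF L1 N] vecs_inject[OF L2 S] by auto
  then show "lyapunov g K P" "L1 = A\<^sup>T * P * B" "L2 = B\<^sup>T * P * B" using lyap by auto
qed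

text \<open>The second iteration is the first one at \<open>g = 1\<close>, so its well-posedness and
  the identification of its output are instances of the results above.\<close>

lemma Psi_eq_psi: "Psi n m x u k s K = psi n m x u k s 1 K"
proof -
  have "Xi1 n x k s - (1 / 1\<^sup>2 - 1) \<cdot>\<^sub>m Xi5 n x k s = Xi1 n x k s"
    using Xi_carrier(1,5) by (intro eq_matI) auto
  then show ?thesis unfolding Psi_def psi_def by (simp only:)
qed

lemma Phi_eq_phi: "Phi n x k s Q R K = phi n x k s Q R 1 K"
  unfolding Phi_def phi_def by simp

text \<open>With \<open>W = Q + K'^T R K'\<close> for the new gain \<open>K'\<close>,
  \<open>policy_improvement\<close> is precisely the decrease demanded by
  \<open>rho_less_of_sigma_step\<close>.\<close>

lemma rho_after_gain_update:
  assumes P: "lyapunov g K P" and K: "K \<in> carrier_mat m n" and g: "0 < g"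
    and a: "0 < a"
    "a < g * sqrt (sigma_min (Q + (gain g P)\<^sup>T * R * gain g P)
      / sigma_max (P - Q - (gain g P)\<^sup>T * R * gain g P) + 1) - g"
  shows "rho (A - B * gain g P) < 1 / (g + a)"
proof -
  let ?K = "gain g P"
  let ?W = "Q + ?K\<^sup>T * R * ?K"
  have K': "?K \<in> carrier_mat m n" by (rule gain_carrier[OF lyapunovD(2,3)[OF P]])
  note sK = sym_mat_congruence[OF pos_defD(1)[OF R] K'] and sQ = pos_defD(1)[OF Q]
  have qW: "qform ?W v = qform Q v + qform R (?K *\<^sub>v v)" if v: "v \<in> carrier_vec n" for v
    using bform_add_mat[OF sym_matD(1)[OF sQ] sym_matD(1)[OF sK] v v]
      bform_congruence[OF K' pos_defD(2)[OF R] K' v v] by simp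
  have W: "pos_def n ?W"
  proof (rule pos_defI[OF sym_mat_add[OF sQ sK]])
    fix v :: "real vec" assume v: "v \<in> carrier_vec n" "v \<noteq> 0\<^sub>v n"
    show "0 < qform ?W v"
      unfolding qW[OF v(1)] using pos_defD(3)[OF Q v] qform_input_nonneg[OF K' v(1)] by simp
  qed
  have "P - Q - ?K\<^sup>T * R * ?K = P - ?W"
    using sym_matD(1)[OF sK] sym_matD(1)[OF sQ] pos_defD(2)[OF lyapunovD(1)[OF P]]
    by (intro eq_matI) auto
  then have a2: "a < g * sqrt (sigma_min ?W / sigma_max (P - ?W) + 1) - g" using a(2) by simp
  show ?thesis
  proof (rule rho_less_of_sigma_step[OF n_pos closed_loop_carrier[OF K'] lyapunovD(1)[OF P] W g _ a(1) a2])
    fix v :: "real vec" assume v: "v \<in> carrier_vec n"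
    show "g\<^sup>2 * qform P ((A - B * ?K) *\<^sub>v v) \<le> qform P v - qform ?W v"
      unfolding closed_loop_mult_vec[OF K' v] qW[OF v] using policy_improvement[OF P K v] by simp
  qed
qed

end

text \<open>The step sizes are free choices, so the algorithm appears as constraints on given
  sequences, imposed on the passes that the loop performs. As \<open>vecs\<close> on symmetric
  matrices and \<open>vec_stack\<close> are injective, the vector equations determine the
  matrices.\<close>

theorem theorem3:
  fixes n m s :: nat
    and A B Q R :: "real mat"
    and x u :: "nat \<Rightarrow> real vec"
    and k :: "nat \<Rightarrow> nat"
    and \<beta> :: real
    and \<alpha> :: "nat \<Rightarrow> real"
    and Pt L1t L2t Kt :: "nat \<Rightarrow> real mat"
  assumes "0 < n" and "0 < m"
    and "A \<in> carrier_mat n n" and "B \<in> carrier_mat n m"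
    and "stabilizable A B" and "rho A > 0"
    and "pos_def n Q" and "pos_def m R"
    and "\<beta> > 0" and "\<alpha> 0 > 0" and "\<beta> + \<alpha> 0 < 1 / rho A"
    and "\<forall>l<s. k l < k (Suc l)"
    and "\<forall>l\<le>s. x (k l) \<in> carrier_vec n \<and> u (k l) \<in> carrier_vec m \<and>
           x (k l + 1) = A *\<^sub>v x (k l) + B *\<^sub>v u (k l)"
    and "vec_space.rank (Suc s) (Xi2 n x k s @\<^sub>c Xi3 n m x u k s @\<^sub>c Xi4 m u k s)
           = (n + m) * (n + m + 1) div 2"
    and "Kt 0 = 0\<^sub>m m n"
    and "\<forall>j. performed \<beta> \<alpha> j \<longrightarrow>
           sym_mat n (Pt j) \<and> L1t j \<in> carrier_mat n m \<and> sym_mat m (L2t j) \<and>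
           vecs (Pt j) @\<^sub>v vec_stack (L1t j) @\<^sub>v vecs (L2t j) =
             least_squares (psi n m x u k s (gam \<beta> \<alpha> j) (Kt j))
               (phi n x k s Q R (gam \<beta> \<alpha> j) (Kt j))"
    and "\<forall>j. performed \<beta> \<alpha> j \<longrightarrow>
           Kt (Suc j) =
             (gam \<beta> \<alpha> j)\<^sup>2 \<cdot>\<^sub>m (minv (R + (gam \<beta> \<alpha> j)\<^sup>2 \<cdot>\<^sub>m L2t j) * (L1t j)\<^sup>T)"
    and "\<forall>j. performed \<beta> \<alpha> j \<longrightarrow>
           0 < \<alpha> (Suc j) \<and>
           \<alpha> (Suc j) < gam \<beta> \<alpha> j *
             sqrt (sigma_min (Q + (Kt (Suc j))\<^sup>T * R * Kt (Suc j))
                   / sigma_max (Pt j - Q - (Kt (Suc j))\<^sup>T * R * Kt (Suc j)) + 1)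
             - gam \<beta> \<alpha> j"
  shows "(\<forall>j. performed \<beta> \<alpha> j \<longrightarrow>
            rho (A - B * Kt (Suc j)) < 1 / gam \<beta> \<alpha> (Suc j)) \<and>
         (\<forall>j. performed \<beta> \<alpha> j \<and> gam \<beta> \<alpha> (Suc j) \<ge> 1 \<longrightarrow>
            rho (A - B * Kt (Suc j)) < 1 \<and>
            (\<forall>P L1 L2 K :: nat \<Rightarrow> real mat.
               K 0 = Kt (Suc j) \<and>
               (\<forall>i. sym_mat n (P i) \<and> L1 i \<in> carrier_mat n m \<and> sym_mat m (L2 i) \<and>
                    vecs (P i) @\<^sub>v vec_stack (L1 i) @\<^sub>v vecs (L2 i) =
                      least_squares (Psi n m x u k s (K i)) (Phi n x k s Q R (K i)) \<and>
                    K (Suc i) = minv (R + L2 i) * (L1 i)\<^sup>T) \<longrightarrow>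
               mat_tendsto n n P (riccati_sol A B Q R) \<and>
               mat_tendsto m n K (optimal_gain A B Q R)))"
proof -
  interpret sampled_lq n m A B Q R s x u k
    using assms(1,3,4,7,8,13,14) by unfold_locales auto
  let ?g = "gam \<beta> \<alpha>"
  have gam_Suc: "?g (Suc j) = ?g j + \<alpha> (Suc j)" for j by (simp add: gam_def)
  \<comment> \<open>The spectral bound is consumed to identify the least-squares output and then
    re-established for the enlarged \<open>gam\<close>.\<close>
  have step: "0 < ?g (Suc j) \<and> Kt (Suc j) \<in> carrier_mat m n \<and> rho (A - B * Kt (Suc j)) < 1 / ?g (Suc j)"
    if j: "performed \<beta> \<alpha> j" and g: "0 < ?g j" and K: "Kt j \<in> carrier_mat m n"
      and rho: "rho (A - B * Kt j) < 1 / ?g j" for j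
  proof -
    have L: "lyapunov (?g j) (Kt j) (Pt j)" "L1t j = A\<^sup>T * Pt j * B" "L2t j = B\<^sup>T * Pt j * B"
      using assms(16) j least_squares_lyapunov[OF K g rho, of "Pt j" "L1t j" "L2t j"] by auto
    have Kg: "Kt (Suc j) = gain (?g j) (Pt j)"
      using assms(17) j unfolding lq_gain_def L(2,3)[symmetric] by blast
    have a: "0 < \<alpha> (Suc j)" and "\<alpha> (Suc j) < ?g j *
             sqrt (sigma_min (Q + (Kt (Suc j))\<^sup>T * R * Kt (Suc j))
                   / sigma_max (Pt j - Q - (Kt (Suc j))\<^sup>T * R * Kt (Suc j)) + 1) - ?g j"
      using assms(18) j by blast+
    then have "rho (A - B * Kt (Suc j)) < 1 / ?g (Suc j)"
      unfolding gam_Suc Kg by (intro rho_after_gain_update[OF L(1) K g])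
    moreover have "Kt (Suc j) \<in> carrier_mat m n"
      unfolding Kg by (rule gain_carrier[OF lyapunovD(2,3)[OF L(1)]])
    ultimately show ?thesis using g a by (simp add: gam_Suc)
  qed
  \<comment> \<open>\<open>performed\<close> is closed under predecessors, so the induction never
    leaves the passes that are actually run.\<close>
  have inv: "performed \<beta> \<alpha> j \<Longrightarrow> 0 < ?g j \<and> Kt j \<in> carrier_mat m n \<and> rho (A - B * Kt j) < 1 / ?g j" for j
  proof (induction j)
    case 0
    \<comment> \<open>With zero gain the closed loop is \<open>A\<close> itself, and
      \<open>gam \<beta> \<alpha> 0 = \<beta> + \<alpha> 0\<close>; the initial choice is thus the
      invariant of pass 0.\<close>
    have "A - B * Kt 0 = A" unfolding assms(15) using assms(3,4) by (intro eq_matI) auto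
    moreover have "0 < \<beta> + \<alpha> 0" using assms(9,10) by simp
    ultimately show ?case
      using assms(6,11,15) by (simp add: gam_def field_simps)
  next
    case (Suc j)
    then have "performed \<beta> \<alpha> j" by (simp add: performed_def)
    then show ?case using step Suc.IH by blast
  qed
  have rate: "Kt (Suc j) \<in> carrier_mat m n \<and> rho (A - B * Kt (Suc j)) < 1 / ?g (Suc j)"
    if "performed \<beta> \<alpha> j" for j
    using step[OF that] inv[OF that] by blast
  moreover have "rho (A - B * Kt (Suc j)) < 1 \<and>
      (\<forall>P L1 L2 K :: nat \<Rightarrow> real mat.
         K 0 = Kt (Suc j) \<and>
         (\<forall>i. sym_mat n (P i) \<and> L1 i \<in> carrier_mat n m \<and> sym_mat m (L2 i) \<and>
              vecs (P i) @\<^sub>v vec_stack (L1 i) @\<^sub>v vecs (L2 i) =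
                least_squares (Psi n m x u k s (K i)) (Phi n x k s Q R (K i)) \<and>
              K (Suc i) = minv (R + L2 i) * (L1 i)\<^sup>T) \<longrightarrow>
         mat_tendsto n n P (riccati_sol A B Q R) \<and> mat_tendsto m n K (optimal_gain A B Q R))"
    if j: "performed \<beta> \<alpha> j" and ge: "1 \<le> ?g (Suc j)" for j
  proof (intro conjI allI impI; (elim conjE)?)
    have "1 / ?g (Suc j) \<le> 1" using ge by simp
    then show stable: "rho (A - B * Kt (Suc j)) < 1" using rate[OF j] by linarith
    fix P L1 L2 K :: "nat \<Rightarrow> real mat"
    assume K0: "K 0 = Kt (Suc j)"
      and upd: "\<forall>i. sym_mat n (P i) \<and> L1 i \<in> carrier_mat n m \<and> sym_mat m (L2 i) \<and>
              vecs (P i) @\<^sub>v vec_stack (L1 i) @\<^sub>v vecs (L2 i) =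
                least_squares (Psi n m x u k s (K i)) (Phi n x k s Q R (K i)) \<and>
              K (Suc i) = minv (R + L2 i) * (L1 i)\<^sup>T"
    have one: "1\<^sup>2 \<cdot>\<^sub>m M = M" for M :: "real mat" by (rule eq_matI) auto
    \<comment> \<open>This is the conditional premise of \<open>policy_iteration_converges\<close>:
      stability of \<open>K i\<close> is the spectral bound at \<open>g = 1\<close> under which the
      data identify its cost.\<close>
    have L: "lyapunov 1 (K i) (P i) \<and> K (Suc i) = gain 1 (P i)"
      if "K i \<in> carrier_mat m n" "rho (A - B * K i) < 1" for i
    proof -
      have u: "sym_mat n (P i)" "L1 i \<in> carrier_mat n m" "sym_mat m (L2 i)"
        "vecs (P i) @\<^sub>v vec_stack (L1 i) @\<^sub>v vecs (L2 i) =
          least_squares (psi n m x u k s 1 (K i)) (phi n x k s Q R 1 (K i))"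
        "K (Suc i) = minv (R + L2 i) * (L1 i)\<^sup>T"
        using upd unfolding Psi_eq_psi Phi_eq_phi by blast+
      have r: "rho (A - B * K i) < 1 / 1" using that(2) by simp
      have g: "(0 :: real) < 1" by simp
      note lyap = least_squares_lyapunov[OF that(1) g r u(1-4)]
      show ?thesis using lyap(1) u(5) unfolding lq_gain_def one lyap(2,3) by blast
    qed
    have "K 0 \<in> carrier_mat m n" "rho (A - B * K 0) < 1" using K0 rate[OF j] stable by auto
    note conv = policy_iteration_converges[of K P, OF this L]
    show "mat_tendsto n n P (riccati_sol A B Q R)" "mat_tendsto m n K (optimal_gain A B Q R)"
      using conv by blast+
  qed
  ultimately show ?thesis by blast
qed

end
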